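(* Let $F\subseteq E$ be an extension of fields and $\alpha_1,\ldots,\alpha_n\in E$. Then: (1) $K=F(\alpha_1,\ldots,\alpha_n)$ has only finitely many maximal subrings if and only if $F$ has only finitely many maximal subrings and $K/F$ is finite. (2) $R=F[\alpha_1,\ldots,\alpha_n]$ has only finitely many maximal subrings if and only if $F$ has only finitely many maximal subrings and each $\alpha_i$ is algebraic over $F$ (i.e. $R/F$ is a finite extension of fields).
   Context: All rings are commutative with $1\neq 0$ and subrings are unital. A proper subring $S$ of a ring $R$ is a maximal subring of $R$ if it is maximal with respect to inclusion among all proper subrings of $R$ (a subring of a field need not be a field). *)

theory Defs
  imports "HOL-Algebra.Algebra"
begin

definition maximal_subring :: "'a set \<Rightarrow> ('a, 'b) ring_scheme \<Rightarrow> bool" where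
  "maximal_subring S R \<longleftrightarrow>
     subring S R \<and> S \<noteq> carrier R \<and>
     (\<forall>T. subring T R \<and> T \<noteq> carrier R \<and> S \<subseteq> T \<longrightarrow> T = S)"

(* A is a subring of E, regarded as a ring in its own right. *)
definition finitely_many_maximal_subrings :: "('a, 'b) ring_scheme \<Rightarrow> 'a set \<Rightarrow> bool" where
  "finitely_many_maximal_subrings E A \<longleftrightarrow>
     finite {S. maximal_subring S (E\<lparr>carrier := A\<rparr>)}"

end

theory Submission
  imports Defs
begin

text \<open>
  Two facts carry the proof.

  First, a field with only finitely many maximal subrings is algebraic over a finite prime field
  (\<open>finitely_many_imp_absolutely_algebraic\<close>). Otherwise the field is algebraic over the fraction
  field of a principal ideal domain \<open>B\<close> inside it which has elements \<open>1 + t G\<close> that are not units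
  for every nonzero \<open>G\<close>: either \<open>B\<close> is the ring of integers, or \<open>B = L[x]\<close> for a subfield \<open>L\<close>
  that is maximal among those over which \<open>x\<close> is transcendental; the exchange property shows that
  the field is algebraic over \<open>L(x)\<close>. For a non-unit \<open>b\<close> of \<open>B\<close>, a subring which contains \<open>B\<close> and
  is maximal among those omitting \<open>1/b\<close> is a valuation ring (\<open>maximal_avoiding_valuation\<close>), and it
  is a maximal subring because nonzero prime ideals of \<open>B\<close> are maximal. Euclid's argument with
  \<open>b = 1 + t G\<close> produces a new such ring for every finite list of old ones.

  Secondly, in a field \<open>K\<close> that is algebraic over the prime field with \<open>p\<close> elements, subrings are
  subfields, and a subfield is determined by the degrees of its elements over the prime field.
  The maximal ones correspond to the primes \<open>q\<close> for which the exponents of \<open>q\<close> in these degrees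
  are bounded but not all zero (\<open>finitely_many_iff_critical\<close>). Adjoining finitely many elements to a
  subfield affects only the primes dividing the degrees of these elements, so finiteness of the
  number of maximal subrings passes up and down a finite extension
  (\<open>finitely_many_iff_of_finite_extension\<close>).

  Together they give the criterion for \<open>K = F(\<alpha>\<^sub>1,\<dots>,\<alpha>\<^sub>n)\<close>: if there are only finitely many maximal
  subrings in \<open>K\<close>, all \<open>\<alpha>\<^sub>i\<close> are algebraic over the prime field and hence over \<open>F\<close>, and for algebraic
  generators the second fact applies. If all \<open>\<alpha>\<^sub>i\<close> are algebraic, then \<open>F[\<alpha>\<^sub>1,\<dots>,\<alpha>\<^sub>n] = K\<close>. There
  remains a ring \<open>R = F[\<alpha>\<^sub>1,\<dots>,\<alpha>\<^sub>n]\<close> with some generator \<open>z\<close> transcendental over \<open>F\<close>. It has infinitely many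
  maximal subrings (\<open>infinitely_many_of_affine_domain\<close>): by a version of Zariski's lemma
  (\<open>units_descend_finite_extension\<close>) many \<open>h \<in> F[z]\<close> remain non-units in \<open>R\<close>, each proper subring
  \<open>F + h\<^sup>2 R\<close> lies in a maximal one, and comaximal choices of \<open>h\<close> lead to different maximal subrings.
\<close>

section \<open>Valuation rings from Zorn's lemma\<close>

text \<open>The closure property behind all applications of Zorn's lemma below.\<close>
lemma (in ring) chain_Union_subring:
  assumes "C \<noteq> {}" "\<And>S. S \<in> C \<Longrightarrow> subring S R"
    and "\<And>S T. \<lbrakk>S \<in> C; T \<in> C\<rbrakk> \<Longrightarrow> S \<subseteq> T \<or> T \<subseteq> S"
  shows "subring (\<Union>C) R"
proof (rule subringI)
  show "\<Union>C \<subseteq> carrier R" using subringE(1)[OF assms(2)] by auto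
  obtain S where "S \<in> C" using assms(1) by auto
  then show "\<one> \<in> \<Union>C" using subringE(3)[OF assms(2)] by auto
  show "\<ominus> h \<in> \<Union>C" if "h \<in> \<Union>C" for h
    using that subringE(5)[OF assms(2)] by auto
  fix h1 h2 assume "h1 \<in> \<Union>C" "h2 \<in> \<Union>C"
  then obtain S where S: "S \<in> C" "h1 \<in> S" "h2 \<in> S"
    using assms(3) by (metis UnionE subsetD)
  show "h1 \<otimes> h2 \<in> \<Union>C" "h1 \<oplus> h2 \<in> \<Union>C"
    using S subringE(6,7)[OF assms(2)] by blast+
qed

text \<open>Maximality is only among the subrings omitting \<open>a\<close>; larger proper subrings of \<open>R\<close> may exist.\<close>
definition (in ring) maximal_avoiding :: "'a set \<Rightarrow> 'a \<Rightarrow> bool" where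
  "maximal_avoiding T a \<longleftrightarrow> subring T R \<and> a \<notin> T \<and>
     (\<forall>T'. subring T' R \<and> T \<subseteq> T' \<and> a \<notin> T' \<longrightarrow> T' = T)"

lemma (in ring) maximal_avoiding_exists:
  assumes "subring S R" "a \<notin> S"
  obtains T where "S \<subseteq> T" "maximal_avoiding T a"
proof -
  define A where "A = {T. subring T R \<and> S \<subseteq> T \<and> a \<notin> T}"
  have "\<exists>M\<in>A. \<forall>T\<in>A. M \<subseteq> T \<longrightarrow> T = M"
  proof (rule subset_Zorn_nonempty)
    show "A \<noteq> {}" using assms by (auto simp: A_def)
    fix C assume C: "C \<noteq> {}" "subset.chain A C"
    have "subring (\<Union>C) R"
      by (rule chain_Union_subring) (use C in \<open>auto simp: subset.chain_def A_def\<close>)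
    then show "\<Union>C \<in> A" using C by (auto simp: subset.chain_def A_def)
  qed
  then obtain M where "M \<in> A" "\<And>T. \<lbrakk>T \<in> A; M \<subseteq> T\<rbrakk> \<Longrightarrow> T = M" by blast
  then show ?thesis by (intro that[of M]) (auto simp: A_def maximal_avoiding_def)
qed

text \<open>The \<open>T\<close>-module \<open>T + T z + \<dots> + T z\<^sup>m\<close>, in Horner form. The ring \<open>T[z]\<close> is the union of these modules,
  and a relation of smallest possible degree is found by minimizing \<open>m\<close>.\<close>
primrec (in ring) bounded_degree :: "'a set \<Rightarrow> 'a \<Rightarrow> nat \<Rightarrow> 'a set" where
  "bounded_degree T z 0 = T"
| "bounded_degree T z (Suc m) = {t \<oplus> z \<otimes> s | t s. t \<in> T \<and> s \<in> bounded_degree T z m}"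

context cring
begin

context
  fixes T z assumes T: "subring T R" and z: "z \<in> carrier R"
begin

lemma coeff_carrier: "t \<in> T \<Longrightarrow> t \<in> carrier R" using subringE(1)[OF T] by auto

lemma bounded_degree_carrier: "s \<in> bounded_degree T z m \<Longrightarrow> s \<in> carrier R"
  using z by (induct m arbitrary: s) (auto simp: coeff_carrier)

lemma bounded_degree_add:
  "\<lbrakk>s \<in> bounded_degree T z m; s' \<in> bounded_degree T z m\<rbrakk> \<Longrightarrow> s \<oplus> s' \<in> bounded_degree T z m"
proof (induct m arbitrary: s s')
  case (Suc m)
  then obtain t r t' r' where *: "s = t \<oplus> z \<otimes> r" "s' = t' \<oplus> z \<otimes> r'" "t \<in> T" "t' \<in> T"
    "r \<in> bounded_degree T z m" "r' \<in> bounded_degree T z m" by auto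
  have c: "t \<in> carrier R" "t' \<in> carrier R" "r \<in> carrier R" "r' \<in> carrier R"
    using * coeff_carrier bounded_degree_carrier by auto
  have "s \<oplus> s' = (t \<oplus> t') \<oplus> z \<otimes> (r \<oplus> r')"
    unfolding * using c z by algebra
  then show ?case using Suc(1)[OF *(5,6)] subringE(7)[OF T *(3,4)] by auto
qed (auto simp: subringE(7)[OF T])

lemma bounded_degree_smult:
  "\<lbrakk>a \<in> T; s \<in> bounded_degree T z m\<rbrakk> \<Longrightarrow> a \<otimes> s \<in> bounded_degree T z m"
proof (induct m arbitrary: s)
  case (Suc m)
  then obtain t r where *: "s = t \<oplus> z \<otimes> r" "t \<in> T" "r \<in> bounded_degree T z m" by auto
  have c: "t \<in> carrier R" "r \<in> carrier R" "a \<in> carrier R"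
    using * coeff_carrier bounded_degree_carrier Suc by auto
  have "a \<otimes> s = (a \<otimes> t) \<oplus> z \<otimes> (a \<otimes> r)"
    unfolding * using c z by algebra
  then show ?case using Suc(1)[OF Suc(2) *(3)] subringE(6)[OF T Suc(2) *(2)] by auto
qed (auto simp: subringE(6)[OF T])

lemma bounded_degree_Suc: "s \<in> bounded_degree T z m \<Longrightarrow> s \<in> bounded_degree T z (Suc m)"
proof (induct m arbitrary: s)
  case 0
  then have "s = s \<oplus> z \<otimes> \<zero>" using z coeff_carrier by auto
  then show ?case using 0 subringE(2)[OF T] by auto
qed auto

lemma bounded_degree_mult: 
  assumes "s \<in> bounded_degree T z m" shows "z \<otimes> s \<in> bounded_degree T z (Suc m)"
proof -
  have "z \<otimes> s = \<zero> \<oplus> z \<otimes> s" using z bounded_degree_carrier[OF assms] by auto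
  then show ?thesis using assms subringE(2)[OF T] by auto
qed

lemma bounded_degree_pow_mult:
  "s \<in> bounded_degree T z m \<Longrightarrow> z [^] k \<otimes> s \<in> bounded_degree T z (k + m)"
proof (induct k)
  case 0 then show ?case using bounded_degree_carrier[OF 0] by simp
next
  case (Suc k)
  have "z [^] Suc k \<otimes> s = z \<otimes> (z [^] k \<otimes> s)"
    using z bounded_degree_carrier[OF Suc(2)] by (simp add: m_ac)
  then show ?case using bounded_degree_mult[OF Suc(1)[OF Suc(2)]] by simp
qed

lemma bounded_degree_split_top:
  "s \<in> bounded_degree T z (Suc m) \<Longrightarrow>
    \<exists>r\<in>bounded_degree T z m. \<exists>t\<in>T. s = r \<oplus> t \<otimes> z [^] Suc m"
proof (induct m arbitrary: s)
  case 0
  then obtain t r where *: "s = t \<oplus> z \<otimes> r" "t \<in> T" "r \<in> T" by auto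
  then show ?case using coeff_carrier z by (auto simp: m_comm)
next
  case (Suc m)
  then obtain t r where *: "s = t \<oplus> z \<otimes> r" "t \<in> T" "r \<in> bounded_degree T z (Suc m)" by auto
  obtain r' t' where r: "r' \<in> bounded_degree T z m" "t' \<in> T" "r = r' \<oplus> t' \<otimes> z [^] Suc m"
    using Suc(1)[OF *(3)] by auto
  have c: "t \<in> carrier R" "t' \<in> carrier R" "r' \<in> carrier R" "z [^] Suc m \<in> carrier R"
    using * r coeff_carrier bounded_degree_carrier z by auto
  have e: "z [^] Suc (Suc m) = z \<otimes> z [^] Suc m" using z by (simp add: m_ac)
  have "s = (t \<oplus> z \<otimes> r') \<oplus> t' \<otimes> z [^] Suc (Suc m)"
    unfolding e unfolding *(1) r(3) using c z by algebra
  moreover have "t \<oplus> z \<otimes> r' \<in> bounded_degree T z (Suc m)" using *(2) r(1) by auto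
  ultimately show ?case using r(2) by blast
qed

lemma simple_extension_bounded_degree:
  "s \<in> simple_extension T z \<Longrightarrow> \<exists>m. s \<in> bounded_degree T z m"
proof (induct rule: simple_extension.induct)
  case zero
  then show ?case using subringE(2)[OF T] by (intro exI[of _ 0]) auto
next
  case (lin k1 k2)
  then obtain m where m: "k1 \<in> bounded_degree T z m" by auto
  have "k1 \<otimes> z \<oplus> k2 = k2 \<oplus> z \<otimes> k1"
    using bounded_degree_carrier[OF m] coeff_carrier[OF lin(3)] z by algebra
  then have "k1 \<otimes> z \<oplus> k2 \<in> bounded_degree T z (Suc m)" using m lin(3) by auto
  then show ?case by blast
qed

end

text \<open>Substituting \<open>w = 1/z\<close> and clearing denominators reverses the order of the coefficients.\<close>
lemma bounded_degree_reverse: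
  assumes T: "subring T R" and z: "z \<in> carrier R" "w \<in> carrier R" "z \<otimes> w = \<one>"
  shows "s \<in> bounded_degree T w m \<Longrightarrow> z [^] m \<otimes> s \<in> bounded_degree T z m"
proof (induct m arbitrary: s)
  case 0 then show ?case using subringE(1)[OF T] by auto
next
  case (Suc m)
  then obtain t r where *: "s = t \<oplus> w \<otimes> r" "t \<in> T" "r \<in> bounded_degree T w m" by auto
  have c: "t \<in> carrier R" "r \<in> carrier R"
    using * coeff_carrier[OF T] bounded_degree_carrier[OF T z(2)] by auto
  have "z [^] Suc m \<otimes> s = t \<otimes> z [^] Suc m \<oplus> z [^] m \<otimes> (z \<otimes> w) \<otimes> r"
  proof -
    have "z [^] Suc m = z [^] m \<otimes> z" by simp
    moreover have "z [^] m \<in> carrier R" using z by simp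
    ultimately show ?thesis unfolding * using c z(1,2) by algebra
  qed
  also have "\<dots> = z [^] Suc m \<otimes> t \<oplus> z [^] m \<otimes> r" using z c by (simp add: m_comm)
  finally have e: "z [^] Suc m \<otimes> s = z [^] Suc m \<otimes> t \<oplus> z [^] m \<otimes> r" .
  have "z [^] Suc m \<otimes> t \<in> bounded_degree T z (Suc m + 0)"
    by (rule bounded_degree_pow_mult[OF T z(1)]) (use * in auto)
  moreover have "z [^] m \<otimes> r \<in> bounded_degree T z (Suc m)"
    using bounded_degree_Suc[OF T z(1)] Suc(1)[OF *(3)] by blast
  ultimately show ?case unfolding e using bounded_degree_add[OF T z(1)] by fastforce
qed

end

context field
begin

lemma inv_props:
  assumes "x \<in> carrier R" "x \<noteq> \<zero>"
  shows "inv x \<in> carrier R" "x \<otimes> inv x = \<one>" "inv x \<otimes> x = \<one>" "inv x \<noteq> \<zero>"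
proof -
  have u: "x \<in> Units R" using assms field_Units by auto
  show c: "inv x \<in> carrier R" "x \<otimes> inv x = \<one>" "inv x \<otimes> x = \<one>" using u by auto
  show "inv x \<noteq> \<zero>" using c assms by auto
qed

lemma inv_inv_nonzero: "\<lbrakk>x \<in> carrier R; x \<noteq> \<zero>\<rbrakk> \<Longrightarrow> inv (inv x) = x"
  using field_Units by auto

lemma inv_mult_nonzero:
  "\<lbrakk>x \<in> carrier R; x \<noteq> \<zero>; y \<in> carrier R; y \<noteq> \<zero>\<rbrakk> \<Longrightarrow> inv (x \<otimes> y) = inv x \<otimes> inv y"
  by (rule comm_inv_char) (simp_all add: inv_props, metis inv_props(1,2) l_one m_closed m_lcomm m_assoc)

lemma maximal_avoidingD:
  assumes "maximal_avoiding T a"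
  shows "subring T R" "a \<notin> T" "\<And>T'. \<lbrakk>subring T' R; T \<subseteq> T'; T' \<noteq> T\<rbrakk> \<Longrightarrow> a \<in> T'"
  using assms unfolding maximal_avoiding_def by blast+

text \<open>Elements of \<open>T[1/u]\<close> are fractions with a power of \<open>u\<close> as denominator.\<close>
lemma simple_extension_inv_denominator:
  assumes T: "subring T R" and u: "u \<in> T" "u \<noteq> \<zero>" and s: "s \<in> simple_extension T (inv u)"
  shows "\<exists>k::nat. u [^] k \<otimes> s \<in> T"
  using s
proof (induct rule: simple_extension.induct)
  case zero
  then show ?case using subringE(2)[OF T] by (intro exI[of _ 0]) auto
next
  case (lin k1 k2)
  then obtain k :: nat where k: "u [^] k \<otimes> k1 \<in> T" by auto
  have uc: "u \<in> carrier R" using u subringE(1)[OF T] by auto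
  have iu: "inv u \<in> carrier R" "u \<otimes> inv u = \<one>" using inv_props[OF uc u(2)] by auto
  have kc: "k1 \<in> carrier R" "k2 \<in> carrier R" 
    using lin(1,3) simple_extension_in_carrier[OF subringE(1)[OF T] iu(1)] subringE(1)[OF T] by auto
  have pc: "u [^] k \<in> carrier R" using uc by simp
  have "u [^] Suc k \<otimes> (k1 \<otimes> inv u \<oplus> k2) = (u [^] k \<otimes> k1) \<otimes> (u \<otimes> inv u) \<oplus> (u [^] Suc k) \<otimes> k2"
    using uc iu(1) kc pc by (simp, algebra)
  also have "\<dots> = (u [^] k \<otimes> k1) \<oplus> (u [^] Suc k) \<otimes> k2"
    using iu kc pc uc by simp
  also have "\<dots> \<in> T"
  proof -
    have "u [^] Suc k \<in> T" 
    proof -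
      have "u [^] (n::nat) \<in> T" for n
        by (induct n) (auto simp: subringE(3)[OF T] subringE(6)[OF T] u)
      then show ?thesis .
    qed
    then show ?thesis using k lin(3) subringE(6,7)[OF T] by auto
  qed
  finally show ?case by blast
qed

lemma subring_pow: "\<lbrakk>subring T R; x \<in> T\<rbrakk> \<Longrightarrow> x [^] (n::nat) \<in> T"
  by (induct n) (auto simp: subringE(3,6))

text \<open>If \<open>u = 1 + h t\<close> were not invertible, maximality would force \<open>1/h\<close> into \<open>T[1/u]\<close>. Then \<open>h\<close> divides a
  power of \<open>u\<close> in \<open>T\<close>; but powers of \<open>u\<close> are congruent to one modulo \<open>h\<close>, so \<open>h\<close> would be a unit.\<close>
lemma maximal_avoiding_unit:
  assumes M: "maximal_avoiding T (inv h)" and h: "h \<in> T" "h \<noteq> \<zero>" and t: "t \<in> T"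
  shows "\<one> \<oplus> h \<otimes> t \<noteq> \<zero>" "inv (\<one> \<oplus> h \<otimes> t) \<in> T"
proof -
  note T = maximal_avoidingD(1)[OF M]
  have c: "h \<in> carrier R" "t \<in> carrier R" using h t subringE(1)[OF T] by auto
  let ?u = "\<one> \<oplus> h \<otimes> t"
  have uT: "?u \<in> T" using h t T subringE(3,6,7) by metis
  then have uc: "?u \<in> carrier R" using subringE(1)[OF T] by auto
  show u0: "?u \<noteq> \<zero>"
  proof
    assume "?u = \<zero>"
    then have "h \<otimes> (\<ominus> t) = \<one>" using c
      by (metis a_comm m_closed minus_equality one_closed r_minus)
    then have "inv h = \<ominus> t" using c comm_inv_char by auto
    then show False using maximal_avoidingD(2)[OF M] t subringE(5)[OF T] by auto
  qed
  show "inv ?u \<in> T"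
  proof (rule ccontr)
    assume n: "inv ?u \<notin> T"
    let ?T' = "simple_extension T (inv ?u)"
    have iu: "inv ?u \<in> carrier R" using inv_props[OF uc u0] by auto
    have "subring ?T' R" "T \<subseteq> ?T'" "inv ?u \<in> ?T'"
      using simple_extension_is_subring[OF T iu] simple_extension_incl[OF subringE(1)[OF T] iu]
        simple_extension_mem[OF T iu] by auto
    then have "inv h \<in> ?T'" using maximal_avoidingD(3)[OF M] n by metis
    then obtain k :: nat where k: "?u [^] k \<otimes> inv h \<in> T"
      using simple_extension_inv_denominator[OF T uT u0] by blast
    \<comment> \<open>Modulo \<open>h\<close> every power of \<open>u\<close> is one.\<close>
    have "\<exists>t'\<in>T. ?u [^] k = \<one> \<oplus> h \<otimes> t'"
    proof (induct k)
      case 0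
      show ?case using subringE(2)[OF T] c by (intro bexI[of _ "\<zero>"]) auto
    next
      case (Suc k)
      then obtain t' where t': "t' \<in> T" "?u [^] k = \<one> \<oplus> h \<otimes> t'" by auto
      have "t' \<in> carrier R" using t' subringE(1)[OF T] by auto
      then have "?u [^] Suc k = \<one> \<oplus> h \<otimes> (t \<oplus> t' \<oplus> h \<otimes> t \<otimes> t')"
        unfolding nat_pow_Suc t'(2) using c by algebra
      moreover have "t \<oplus> t' \<oplus> h \<otimes> t \<otimes> t' \<in> T"
        using t' t h subringE(6,7)[OF T] by metis
      ultimately show ?case by blast
    qed
    then obtain t' where t': "t' \<in> T" "?u [^] k = \<one> \<oplus> h \<otimes> t'" by auto
    have ih: "inv h \<in> carrier R" "h \<otimes> inv h = \<one>" using inv_props[OF c(1) h(2)] by auto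
    have tc: "t' \<in> carrier R" using t' subringE(1)[OF T] by auto
    have "?u [^] k \<otimes> inv h = inv h \<oplus> (h \<otimes> inv h) \<otimes> t'"
      unfolding t'(2) using ih(1) c tc by algebra
    then have e: "?u [^] k \<otimes> inv h = inv h \<oplus> t'" using ih tc by simp
    have "inv h = (inv h \<oplus> t') \<oplus> (\<ominus> t')" using ih(1) tc by algebra
    also have "\<dots> \<in> T" using k t' e subringE(5,7)[OF T] by auto
    finally show False using maximal_avoidingD(2)[OF M] by auto
  qed
qed

text \<open>The descent step for \<open>maximal_avoiding_valuation\<close>. A relation \<open>1 = h r\<close> with \<open>r\<close> of degree at most \<open>k + 1\<close> in
  \<open>w = 1/z\<close> can be freed of its constant term, because \<open>1 - h t\<^sub>0\<close> is a unit. It then expresses the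
  leading power of \<open>z\<close> through lower ones, and this lowers the degree of a relation in \<open>z\<close>.\<close>
lemma maximal_avoiding_reduce:
  assumes M: "maximal_avoiding T (inv h)" and h: "h \<in> T" "h \<noteq> \<zero>"
    and z: "z \<in> carrier R" "w \<in> carrier R" "z \<otimes> w = \<one>"
    and m: "s \<in> bounded_degree T z (Suc m)" "\<one> = h \<otimes> s"
    and k: "r \<in> bounded_degree T w (Suc k)" "\<one> = h \<otimes> r" and km: "k \<le> m"
  shows "\<exists>s'\<in>bounded_degree T z m. \<one> = h \<otimes> s'"
proof -
  note T = maximal_avoidingD(1)[OF M]
  have hc: "h \<in> carrier R" using h subringE(1)[OF T] by auto
  obtain t0 r' where r: "r = t0 \<oplus> w \<otimes> r'" "t0 \<in> T" "r' \<in> bounded_degree T w k"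
    using k by auto
  have c: "t0 \<in> carrier R" "r' \<in> carrier R" "z [^] k \<in> carrier R"
    using r subringE(1)[OF T] bounded_degree_carrier[OF T z(2)] z by auto
  let ?u = "\<one> \<oplus> h \<otimes> (\<ominus> t0)"
  have "\<ominus> t0 \<in> T" using r subringE(5)[OF T] by auto
  from maximal_avoiding_unit[OF M h this] have u: "?u \<noteq> \<zero>" "inv ?u \<in> T" by auto
  have uc: "?u \<in> carrier R" using c hc by auto
  have iu: "inv ?u \<in> carrier R" "inv ?u \<otimes> ?u = \<one>" using inv_props[OF uc u(1)] by auto
  have uu: "?u = h \<otimes> (w \<otimes> r')"
  proof -
    have "\<one> = h \<otimes> t0 \<oplus> h \<otimes> (w \<otimes> r')" using k(2) unfolding r(1) using hc c z by algebra
    then have "?u = h \<otimes> t0 \<oplus> h \<otimes> (w \<otimes> r') \<oplus> h \<otimes> (\<ominus> t0)" by simp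
    also have "\<dots> = h \<otimes> (w \<otimes> r')" using hc c z by algebra
    finally show ?thesis .
  qed
  \<comment> \<open>Multiplying by \<open>z\<close> to the power \<open>Suc k\<close> expresses that power through lower ones.\<close>
  let ?y = "inv ?u \<otimes> (z [^] k \<otimes> r')"
  have y: "?y \<in> bounded_degree T z k"
    by (rule bounded_degree_smult[OF T z(1) u(2)]) (rule bounded_degree_reverse[OF T z r(3)])
  have yc: "?y \<in> carrier R" using iu c by auto
  have zk: "z [^] Suc k = h \<otimes> ?y"
  proof -
    have "z [^] Suc k = (inv ?u \<otimes> ?u) \<otimes> (z [^] k \<otimes> z)" using iu z by simp
    also have "\<dots> = inv ?u \<otimes> (h \<otimes> (w \<otimes> r')) \<otimes> (z [^] k \<otimes> z)" using uu by simp
    also have "\<dots> = inv ?u \<otimes> h \<otimes> r' \<otimes> z [^] k \<otimes> (z \<otimes> w)"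
      using iu(1) hc z(1,2) c by algebra
    also have "\<dots> = h \<otimes> ?y" unfolding z(3) using iu(1) hc c by algebra
    finally show ?thesis .
  qed
  let ?y' = "z [^] (m - k) \<otimes> ?y"
  have y': "?y' \<in> bounded_degree T z m"
    using bounded_degree_pow_mult[OF T z(1) y, of "m - k"] km by simp
  have zm: "z [^] Suc m = h \<otimes> ?y'"
  proof -
    have "z [^] Suc m = z [^] (m - k) \<otimes> z [^] Suc k" using km z nat_pow_mult[of z "m - k" "Suc k"]
      by (simp del: nat_pow_Suc)
    then show ?thesis unfolding zk using z yc hc by (simp add: m_lcomm)
  qed
  obtain s0 t where s: "s0 \<in> bounded_degree T z m" "t \<in> T" "s = s0 \<oplus> t \<otimes> z [^] Suc m"
    using bounded_degree_split_top[OF T z(1) m(1)] by auto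
  have "s = s0 \<oplus> (t \<otimes> h) \<otimes> ?y'" unfolding s(3) zm using s(2) hc yc z subringE(1)[OF T]
    by (simp add: m_assoc subset_iff)
  moreover have "s0 \<oplus> (t \<otimes> h) \<otimes> ?y' \<in> bounded_degree T z m"
    using bounded_degree_add[OF T z(1) s(1)] bounded_degree_smult[OF T z(1) _ y']
      subringE(6)[OF T s(2) h(1)] by blast
  ultimately show ?thesis using m(2) by blast
qed

text \<open>The whole field counts as a valuation ring.\<close>
definition valuation_subring :: "'a set \<Rightarrow> bool" where
  "valuation_subring T \<longleftrightarrow> subring T R \<and> (\<forall>z\<in>carrier R - {\<zero>}. z \<in> T \<or> inv z \<in> T)"

lemma valuation_subringD:
  assumes "valuation_subring T"
  shows "subring T R" "\<lbrakk>z \<in> carrier R; z \<noteq> \<zero>\<rbrakk> \<Longrightarrow> z \<in> T \<or> inv z \<in> T"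
  using assms unfolding valuation_subring_def by auto

text \<open>If neither \<open>z\<close> nor \<open>1/z\<close> lay in \<open>T\<close>, then \<open>1/h\<close> would be a polynomial in \<open>z\<close> and also one in \<open>1/z\<close>
  over \<open>T\<close>. With both degrees minimal, the one of larger degree can still be shortened.\<close>
lemma maximal_avoiding_valuation:
  assumes M: "maximal_avoiding T (inv h)" and h: "h \<in> T" "h \<noteq> \<zero>"
  shows "valuation_subring T"
  unfolding valuation_subring_def
proof (intro conjI ballI)
  show T: "subring T R" using maximal_avoidingD(1)[OF M] .
  fix z assume "z \<in> carrier R - {\<zero>}"
  then have z: "z \<in> carrier R" "z \<noteq> \<zero>" by auto
  have w: "inv z \<in> carrier R" "z \<otimes> inv z = \<one>" "inv z \<otimes> z = \<one>" using inv_props[OF z] by auto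
  have hc: "h \<in> carrier R" using h subringE(1)[OF T] by auto
  have ih: "inv h \<in> carrier R" "h \<otimes> inv h = \<one>" using inv_props[OF hc h(2)] by auto
  let ?P = "\<lambda>x m. \<exists>s\<in>bounded_degree T x m. \<one> = h \<otimes> s"
  have ex: "\<exists>m. ?P x m" if "x \<in> carrier R" "x \<notin> T" for x
  proof -
    have "inv h \<in> simple_extension T x"
      using maximal_avoidingD(3)[OF M simple_extension_is_subring[OF T that(1)]
          simple_extension_incl[OF subringE(1)[OF T] that(1)]]
        simple_extension_mem[OF T that(1)] that(2) by auto
    then obtain m where m: "inv h \<in> bounded_degree T x m"
      using simple_extension_bounded_degree[OF T \<open>x \<in> carrier R\<close>] by metis
    moreover have "\<one> = h \<otimes> inv h" using ih by simp
    ultimately show ?thesis using m by blast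
  qed
  have n0: "\<not> ?P x 0" if "x \<in> carrier R" for x
  proof
    assume "?P x 0"
    then obtain s where "s \<in> T" "h \<otimes> s = \<one>" by auto
    then have "inv h = s" using comm_inv_char hc subringE(1)[OF T] by blast
    then show False using \<open>s \<in> T\<close> maximal_avoidingD(2)[OF M] by auto
  qed
  show "z \<in> T \<or> inv z \<in> T"
  proof (rule ccontr)
    assume "\<not> ?thesis"
    then have e: "\<exists>m. ?P z m" "\<exists>m. ?P (inv z) m" using ex z w by auto
    define m where "m = (LEAST m. ?P z m)"
    define k where "k = (LEAST m. ?P (inv z) m)"
    have m: "?P z m" "\<And>i. i < m \<Longrightarrow> \<not> ?P z i"
      unfolding m_def using e(1) by (rule LeastI_ex) (rule not_less_Least)
    have k: "?P (inv z) k" "\<And>i. i < k \<Longrightarrow> \<not> ?P (inv z) i"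
      unfolding k_def using e(2) by (rule LeastI_ex) (rule not_less_Least)
    obtain m' where m': "m = Suc m'" using m(1) n0[OF z(1)] by (cases m) auto
    obtain k' where k': "k = Suc k'" using k(1) n0[OF w(1)] by (cases k) auto
    show False
    proof (cases "k' \<le> m'")
      case True
      then have "?P z m'" using maximal_avoiding_reduce[OF M h z(1) w(1,2)] m(1) k(1)
        unfolding m' k' by blast
      then show False using m(2)[of m'] m' by simp
    next
      case False
      then have "?P (inv z) k'" using maximal_avoiding_reduce[OF M h w(1) z(1) w(3)] m(1) k(1)
        unfolding m' k' by (meson linorder_le_cases)
      then show False using k(2)[of k'] k' by simp
    qed
  qed
qed

text \<open>For a valuation ring this is the maximal ideal. Zero is listed separately, because its inverse
  is an unspecified value that might lie in \<open>T\<close>.\<close>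
definition nonunits :: "'a set \<Rightarrow> 'a set" where
  "nonunits T = {x \<in> T. x = \<zero> \<or> inv x \<notin> T}"

lemma nonunits_mult:
  assumes T: "subring T R" and "a \<in> T" "b \<in> nonunits T"
  shows "a \<otimes> b \<in> nonunits T"
proof -
  have bT: "b \<in> T" using assms by (auto simp: nonunits_def)
  have c: "a \<in> carrier R" "b \<in> carrier R" using assms bT subringE(1)[OF T] by auto
  have ab: "a \<otimes> b \<in> T" using assms bT subringE(6)[OF T] by auto
  moreover have "a \<otimes> b = \<zero>" if i: "inv (a \<otimes> b) \<in> T"
  proof (rule ccontr)
    assume n: "a \<otimes> b \<noteq> \<zero>"
    then have nz: "a \<noteq> \<zero>" "b \<noteq> \<zero>" using c by auto
    have "inv b = a \<otimes> inv (a \<otimes> b)"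
      using inv_mult_nonzero[OF c(1) nz(1) c(2) nz(2)] inv_props[OF c(1) nz(1)] inv_props[OF c(2) nz(2)] c
      by (simp add: m_assoc[symmetric])
    then have "inv b \<in> T" using i assms subringE(6)[OF T] by auto
    then show False using assms nz by (auto simp: nonunits_def)
  qed
  ultimately show ?thesis by (auto simp: nonunits_def)
qed

text \<open>Divide by that one of the two summands which divides the other.\<close>
lemma nonunits_add:
  assumes V: "valuation_subring T" and a: "a \<in> nonunits T" "b \<in> nonunits T"
  shows "a \<oplus> b \<in> nonunits T"
proof -
  note T = valuation_subringD(1)[OF V]
  have aT: "a \<in> T" "b \<in> T" using a by (auto simp: nonunits_def)
  have *: "a \<oplus> b \<in> nonunits T"
    if a: "a \<in> nonunits T" "b \<in> nonunits T" "a \<noteq> \<zero>" "b \<otimes> inv a \<in> T" for a b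
  proof -
    have c: "a \<in> carrier R" "b \<in> carrier R" using a subringE(1)[OF T] by (auto simp: nonunits_def)
    have ia: "inv a \<in> carrier R" "inv a \<otimes> a = \<one>" using inv_props[OF c(1) a(3)] by auto
    have "a \<oplus> b = (\<one> \<oplus> b \<otimes> inv a) \<otimes> a"
    proof -
      have "(\<one> \<oplus> b \<otimes> inv a) \<otimes> a = a \<oplus> b \<otimes> (inv a \<otimes> a)" using c ia(1) by algebra
      then show ?thesis using c ia by simp
    qed
    then show ?thesis
      using nonunits_mult[OF T _ a(1)] a(4) subringE(3,7)[OF T] by auto
  qed
  have c: "a \<in> carrier R" "b \<in> carrier R" using aT subringE(1)[OF T] by auto
  show ?thesis
  proof (cases "a = \<zero> \<or> b = \<zero>")
    case True
    then show ?thesis using a c by auto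
  next
    case False
    have ia: "inv a \<in> carrier R" "inv b \<in> carrier R" "inv a \<noteq> \<zero>" "inv b \<noteq> \<zero>"
      using inv_props[OF c(1)] inv_props[OF c(2)] False by auto
    have "inv (b \<otimes> inv a) = a \<otimes> inv b"
      using inv_mult_nonzero[OF c(2) _ ia(1) ia(3)] inv_inv_nonzero[OF c(1)] False c ia
      by (simp add: m_comm)
    moreover have "b \<otimes> inv a \<noteq> \<zero>" "b \<otimes> inv a \<in> carrier R"
      using False c ia by (auto simp: integral_iff)
    ultimately have "b \<otimes> inv a \<in> T \<or> a \<otimes> inv b \<in> T"
      using valuation_subringD(2)[OF V, of "b \<otimes> inv a"] by auto
    then show ?thesis using *[OF a] *[OF a(2,1)] False c by (auto simp: a_comm)
  qed
qed

lemma one_notin_nonunits: "subring T R \<Longrightarrow> \<one> \<notin> nonunits T"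
  using subringE(3) by (auto simp: nonunits_def)

lemma nonunits_uminus:
  assumes "subring T R" "a \<in> nonunits T" shows "\<ominus> a \<in> nonunits T"
proof -
  have "a \<in> carrier R" using assms subringE(1) by (auto simp: nonunits_def)
  then have "\<ominus> a = (\<ominus> \<one>) \<otimes> a" by (simp add: l_minus)
  then show ?thesis using nonunits_mult[OF assms(1) _ assms(2)] subringE(3,5)[OF assms(1)] by auto
qed

lemma overring_valuation:
  "\<lbrakk>valuation_subring T; subring T' R; T \<subseteq> T'\<rbrakk> \<Longrightarrow> valuation_subring T'"
  unfolding valuation_subring_def by blast

text \<open>A valuation ring is integrally closed: at a root outside it the leading term of a monic
  polynomial would dominate all the others.\<close>
lemma valuation_integrally_closed:
  assumes V: "valuation_subring T" and z: "z \<in> carrier R"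
    and p: "set p \<subseteq> T" "p \<noteq> []" "hd p \<noteq> \<zero>" "inv (hd p) \<in> T" "eval p z = \<zero>"
  shows "z \<in> T"
proof (rule ccontr)
  assume n: "z \<notin> T"
  note T = valuation_subringD(1)[OF V]
  have z0: "z \<noteq> \<zero>" using n subringE(2)[OF T] by auto
  have w: "inv z \<in> carrier R" "inv z \<in> T" "z \<otimes> inv z = \<one>"
    using inv_props[OF z z0] valuation_subringD(2)[OF V z z0] n by auto
  have wn: "inv z \<in> nonunits T" using w n inv_inv_nonzero[OF z z0] by (auto simp: nonunits_def)
  obtain a q where pq: "p = a # q" using p(2) by (cases p) auto
  have pw: "inv z [^] i \<otimes> z [^] i = \<one>" for i :: nat
    using w z by (metis inv_props(3) nat_pow_distrib nat_pow_one z0)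
  \<comment> \<open>Divided by the power of \<open>z\<close>, the lower part of the polynomial is a non-unit.\<close>
  have lower: "inv z [^] length q \<otimes> eval q z \<in> nonunits T" if "set q \<subseteq> T" for q
    using that
  proof (induct q)
    case Nil
    then show ?case using subringE(2)[OF T] by (auto simp: nonunits_def)
  next
    case (Cons b q)
    have c: "b \<in> carrier R" "eval q z \<in> carrier R" "b \<in> T"
      using Cons(2) subringE(1)[OF T] eval_in_carrier[of q z] z by auto
    have pc: "inv z [^] length q \<in> carrier R" "z [^] length q \<in> carrier R" using w z by auto
    have "inv z [^] length (b # q) \<otimes> eval (b # q) z
       = inv z \<otimes> b \<otimes> (inv z [^] length q \<otimes> z [^] length q) \<oplus> inv z \<otimes> (inv z [^] length q \<otimes> eval q z)"
      using c pc w by (simp, algebra)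
    also have "\<dots> = b \<otimes> inv z \<oplus> inv z \<otimes> (inv z [^] length q \<otimes> eval q z)"
      using pw c w by (simp add: m_comm)
    also have "\<dots> \<in> nonunits T"
      using nonunits_add[OF V] nonunits_mult[OF T] wn Cons c(3) w(2) by simp
    finally show ?case .
  qed
  have c: "a \<in> carrier R" "eval q z \<in> carrier R" "a \<in> T"
    using p(1) pq subringE(1)[OF T] eval_in_carrier[of q z] z by auto
  have pc: "inv z [^] length q \<in> carrier R" "z [^] length q \<in> carrier R" using w z by auto
  have "\<zero> = inv z [^] length q \<otimes> eval p z" using p(5) pc by simp
  also have "\<dots> = a \<otimes> (inv z [^] length q \<otimes> z [^] length q) \<oplus> inv z [^] length q \<otimes> eval q z"
    unfolding pq using c pc by (simp, algebra)
  also have "\<dots> = a \<oplus> inv z [^] length q \<otimes> eval q z" using pw c by simp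
  finally have "a = \<ominus> (inv z [^] length q \<otimes> eval q z)"
    using c pc by (metis m_closed minus_equality)
  then have "a \<in> nonunits T" using nonunits_uminus[OF T lower] p(1) pq by auto
  then show False using p(3,4) pq by (auto simp: nonunits_def)
qed

end

section \<open>Fields that are not algebraic over a finite field\<close>

context field
begin

text \<open>The field generated by a subring is its fraction field.\<close>
lemma generate_field_denominator:
  assumes A: "subring A R" and c: "c \<in> generate_field R A"
  shows "\<exists>a\<in>A. a \<noteq> \<zero> \<and> a \<otimes> c \<in> A"
  using c
proof (induct rule: generate_field.induct)
  case one
  show ?case using subringE(3)[OF A] by (intro bexI[of _ \<one>]) auto
next
  case (incl h)
  then show ?case using subringE(1,3)[OF A] by (intro bexI[of _ \<one>]) auto
next
  case (a_inv h)
  then obtain a where a: "a \<in> A" "a \<noteq> \<zero>" "a \<otimes> h \<in> A" by auto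
  have "h \<in> carrier R" using a_inv(1) generate_field_in_carrier[OF subringE(1)[OF A]] by auto
  then have "a \<otimes> (\<ominus> h) = \<ominus> (a \<otimes> h)" using a subringE(1)[OF A] by (auto simp: r_minus)
  then show ?case using a subringE(5)[OF A] by force
next
  case (m_inv h)
  then obtain a where a: "a \<in> A" "a \<noteq> \<zero>" "a \<otimes> h \<in> A" by auto
  have h: "h \<in> carrier R" using m_inv(1) generate_field_in_carrier[OF subringE(1)[OF A]] by auto
  have ac: "a \<in> carrier R" using a subringE(1)[OF A] by auto
  have "a \<otimes> h \<noteq> \<zero>" using a h ac m_inv(3) integral by blast
  moreover have "(a \<otimes> h) \<otimes> inv h = a" using h ac inv_props[OF h m_inv(3)] by (simp add: m_assoc)
  ultimately show ?case using a by metis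
next
  case (eng_add c d)
  then obtain a b where a: "a \<in> A" "a \<noteq> \<zero>" "a \<otimes> c \<in> A" and b: "b \<in> A" "b \<noteq> \<zero>" "b \<otimes> d \<in> A" by auto
  have cc: "c \<in> carrier R" "d \<in> carrier R" "a \<in> carrier R" "b \<in> carrier R"
    using eng_add(1,3) generate_field_in_carrier[OF subringE(1)[OF A]] a b subringE(1)[OF A] by auto
  have "(a \<otimes> b) \<otimes> (c \<oplus> d) = b \<otimes> (a \<otimes> c) \<oplus> a \<otimes> (b \<otimes> d)" using cc by algebra
  moreover have "a \<otimes> b \<noteq> \<zero>" using a b cc integral by blast
  ultimately show ?case using a b subringE(6,7)[OF A] by metis
next
  case (eng_mult c d)
  then obtain a b where a: "a \<in> A" "a \<noteq> \<zero>" "a \<otimes> c \<in> A" and b: "b \<in> A" "b \<noteq> \<zero>" "b \<otimes> d \<in> A" by auto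
  have cc: "c \<in> carrier R" "d \<in> carrier R" "a \<in> carrier R" "b \<in> carrier R"
    using eng_mult(1,3) generate_field_in_carrier[OF subringE(1)[OF A]] a b subringE(1)[OF A] by auto
  have "(a \<otimes> b) \<otimes> (c \<otimes> d) = (a \<otimes> c) \<otimes> (b \<otimes> d)" using cc by algebra
  moreover have "a \<otimes> b \<noteq> \<zero>" using a b cc integral by blast
  ultimately show ?case using a b subringE(6)[OF A] by metis
qed

lemma generate_field_common_denominator:
  assumes A: "subring A R" and "finite D" "D \<subseteq> generate_field R A"
  shows "\<exists>a\<in>A. a \<noteq> \<zero> \<and> (\<forall>c\<in>D. a \<otimes> c \<in> A)"
  using assms(2,3)
proof (induct D rule: finite_induct)
  case empty
  then show ?case using subringE(3)[OF A] one_not_zero by blast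
next
  case (insert c D)
  then obtain a where a: "a \<in> A" "a \<noteq> \<zero>" "\<forall>c\<in>D. a \<otimes> c \<in> A" by auto
  obtain b where b: "b \<in> A" "b \<noteq> \<zero>" "b \<otimes> c \<in> A"
    using generate_field_denominator[OF A, of c] insert(4) by auto
  have cc: "a \<in> carrier R" "b \<in> carrier R" using a b subringE(1)[OF A] by auto
  have dc: "d \<in> carrier R" if "d \<in> insert c D" for d
    using that insert(4) generate_field_in_carrier[OF subringE(1)[OF A]] by blast
  have "a \<otimes> b \<otimes> d \<in> A" if "d \<in> insert c D" for d
  proof (cases "d = c")
    case True
    then have "a \<otimes> b \<otimes> d = a \<otimes> (b \<otimes> c)" using cc dc[OF that] by (simp add: m_assoc)
    then show ?thesis using a b subringE(6)[OF A] by simp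
  next
    case False
    then have "a \<otimes> b \<otimes> d = b \<otimes> (a \<otimes> d)" using cc dc[OF that] by (simp add: m_ac)
    then show ?thesis using a b subringE(6)[OF A] False that by auto
  qed
  moreover have "a \<otimes> b \<noteq> \<zero>" using a b cc integral by blast
  ultimately show ?case using subringE(6)[OF A a(1) b(1)] by blast
qed

text \<open>The inverse of an algebraic element is a polynomial in that element.\<close>
lemma algebraic_inv_mem:
  assumes F: "subfield F R" and T: "subring T R" "F \<subseteq> T"
    and z: "z \<in> T" "z \<noteq> \<zero>" "(algebraic over F) z"
  shows "inv z \<in> T"
proof -
  have zc: "z \<in> carrier R" using z subringE(1)[OF T(1)] by auto
  have "subfield (simple_extension F z) R"
    using simple_extension_is_subfield[OF F zc] z by auto
  then have "inv z \<in> simple_extension F z"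
    using subfield_m_inv(1) z simple_extension_mem[OF subfieldE(1)[OF F] zc] by blast
  then show ?thesis using simple_extension_subring_incl[OF T z(1)] by auto
qed

text \<open>Every element of the generated field is a quotient of two elements of \<open>A\<close>.\<close>
lemma generate_field_subset:
  assumes A: "subring A R" and T: "subring T R" "A \<subseteq> T"
    and "\<And>a. \<lbrakk>a \<in> A; a \<noteq> \<zero>\<rbrakk> \<Longrightarrow> inv a \<in> T"
  shows "generate_field R A \<subseteq> T"
proof
  fix c assume c: "c \<in> generate_field R A"
  then obtain a where a: "a \<in> A" "a \<noteq> \<zero>" "a \<otimes> c \<in> A" using generate_field_denominator[OF A] by auto
  have cc: "a \<in> carrier R" "c \<in> carrier R"
    using a subringE(1)[OF A] generate_field_in_carrier[OF _ c] by auto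
  have "c = inv a \<otimes> (a \<otimes> c)" using inv_props[OF cc(1) a(2)] cc by (simp add: m_assoc[symmetric])
  then show "c \<in> T" using subringE(6)[OF T(1) assms(4)[OF a(1,2)], of "a \<otimes> c"] a(3) T(2) by auto
qed

lemma nonunits_comap_ideal:
  assumes h: "ring_hom_ring B R \<phi>" and B: "cring B" and V: "valuation_subring T"
    and A: "\<phi> ` carrier B \<subseteq> T"
  shows "ideal {b \<in> carrier B. \<phi> b \<in> nonunits T} B"
proof -
  interpret B: cring B by fact
  interpret h: ring_hom_ring B R \<phi> by fact
  note T = valuation_subringD(1)[OF V]
  have z: "\<zero> \<in> nonunits T" using subringE(2)[OF T] by (auto simp: nonunits_def)
  show ?thesis
  proof (rule idealI)
    show "ring B" by (rule B.ring_axioms)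
    show "subgroup {b \<in> carrier B. \<phi> b \<in> nonunits T} (add_monoid B)"
    proof (rule B.add.subgroupI)
      show "{b \<in> carrier B. \<phi> b \<in> nonunits T} \<noteq> {}"
        using z by (auto intro!: exI[of _ "\<zero>\<^bsub>B\<^esub>"])
    qed (auto simp: nonunits_uminus[OF T] nonunits_add[OF V])
    fix a x assume *: "a \<in> {b \<in> carrier B. \<phi> b \<in> nonunits T}" "x \<in> carrier B"
    have "\<phi> x \<otimes> \<phi> a \<in> nonunits T" by (rule nonunits_mult[OF T]) (use * A in auto)
    then show "x \<otimes>\<^bsub>B\<^esub> a \<in> {b \<in> carrier B. \<phi> b \<in> nonunits T}" using * by auto
    then show "a \<otimes>\<^bsub>B\<^esub> x \<in> {b \<in> carrier B. \<phi> b \<in> nonunits T}" using * by (auto simp: B.m_comm)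
  qed
qed

text \<open>Let \<open>T'\<close> be a subring properly containing the valuation ring \<open>T\<close>. The non-units of \<open>T'\<close> in \<open>B\<close> form a prime ideal
  properly contained in the principal ideal \<open>(f)\<close> of non-units of \<open>T\<close>. Its generator \<open>q = c f\<close> satisfies
  \<open>q dvd c\<close>, since \<open>f\<close> is a unit in \<open>T'\<close>, and this forces \<open>q = 0\<close>. So \<open>T'\<close> contains the fraction field of
  \<open>B\<close>, over which everything is algebraic, and \<open>T'\<close> is itself a valuation ring.\<close>
lemma maximal_avoiding_is_maximal_subring:
  assumes B: "principal_domain B" and h: "ring_hom_ring B R \<phi>" and inj: "inj_on \<phi> (carrier B)"
    and alg: "\<And>x. x \<in> carrier R \<Longrightarrow> (algebraic over (generate_field R (\<phi> ` carrier B))) x"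
    and b: "b \<in> carrier B" "b \<noteq> \<zero>\<^bsub>B\<^esub>" and M: "maximal_avoiding T (inv (\<phi> b))"
    and A: "\<phi> ` carrier B \<subseteq> T"
  shows "maximal_subring T R"
proof -
  interpret B: principal_domain B by fact
  interpret h: ring_hom_ring B R \<phi> by fact
  have nz: "\<phi> c \<noteq> \<zero>" if "c \<in> carrier B" "c \<noteq> \<zero>\<^bsub>B\<^esub>" for c
    using that inj by (metis B.zero_closed h.hom_zero inj_onD)
  have A_ring: "subring (\<phi> ` carrier B) R" by (rule h.img_is_subring[OF B.carrier_is_subring])
  note T = maximal_avoidingD(1)[OF M]
  have bT: "\<phi> b \<in> T" "\<phi> b \<in> carrier R" using A b by auto
  have V: "valuation_subring T" by (rule maximal_avoiding_valuation[OF M bT(1) nz[OF b]])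
  have "inv (\<phi> b) \<in> carrier R" using inv_props[OF bT(2) nz[OF b]] by auto
  then have proper: "T \<noteq> carrier R" using maximal_avoidingD(2)[OF M] by auto
  let ?P = "\<lambda>T. {b \<in> carrier B. \<phi> b \<in> nonunits T}"
  have cgen: "\<exists>g\<in>?P T'. \<forall>c\<in>?P T'. \<exists>d\<in>carrier B. c = d \<otimes>\<^bsub>B\<^esub> g"
    if T': "valuation_subring T'" "\<phi> ` carrier B \<subseteq> T'" for T'
  proof -
    obtain g where g: "g \<in> carrier B" "?P T' = PIdl\<^bsub>B\<^esub> g"
      using B.exists_gen[OF nonunits_comap_ideal[OF h B.is_cring T']] by auto
    then have "g \<in> ?P T'" using B.cgenideal_self by auto
    moreover have "\<forall>c\<in>?P T'. \<exists>d\<in>carrier B. c = d \<otimes>\<^bsub>B\<^esub> g"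
      unfolding g(2) cgenideal_def by auto
    ultimately show ?thesis by blast
  qed
  obtain f where f: "f \<in> ?P T" "\<And>c. c \<in> ?P T \<Longrightarrow> \<exists>d\<in>carrier B. c = d \<otimes>\<^bsub>B\<^esub> f"
    using cgen[OF V A] by blast
  have fc: "f \<in> carrier B" using f by auto
  have bP: "b \<in> ?P T" using b bT maximal_avoidingD(2)[OF M] by (auto simp: nonunits_def)
  then obtain d where d: "d \<in> carrier B" "b = d \<otimes>\<^bsub>B\<^esub> f" using f(2) by blast
  have f0: "f \<noteq> \<zero>\<^bsub>B\<^esub>" "d \<noteq> \<zero>\<^bsub>B\<^esub>" using d b fc by auto
  have "T' = carrier R" if T': "subring T' R" "T \<subseteq> T'" "T' \<noteq> T" for T'
  proof -
    note V' = overring_valuation[OF V T'(1,2)]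
    have A': "\<phi> ` carrier B \<subseteq> T'" using A T'(2) by auto
    have "inv (\<phi> b) \<in> T'" using maximal_avoidingD(3)[OF M T'] .
    moreover have "inv (\<phi> f) = \<phi> d \<otimes> inv (\<phi> b)"
    proof -
      have "inv (\<phi> b) = inv (\<phi> d) \<otimes> inv (\<phi> f)"
        using d fc nz[OF d(1) f0(2)] nz[OF fc f0(1)] by (simp add: inv_mult_nonzero)
      then show ?thesis using inv_props[of "\<phi> d"] inv_props[of "\<phi> f"] nz[OF d(1) f0(2)] nz[OF fc f0(1)] d(1) fc
        by (simp add: m_assoc[symmetric])
    qed
    ultimately have invf: "inv (\<phi> f) \<in> T'" using subringE(6)[OF T'(1)] A' d by auto
    \<comment> \<open>The centre of \<open>T'\<close> on \<open>B\<close> is a prime ideal strictly inside the centre of \<open>T\<close>, so it vanishes.\<close>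
    obtain q where q: "q \<in> ?P T'" "\<And>c. c \<in> ?P T' \<Longrightarrow> \<exists>d\<in>carrier B. c = d \<otimes>\<^bsub>B\<^esub> q"
      using cgen[OF V' A'] by blast
    have qc: "q \<in> carrier B" using q by auto
    have "q \<in> ?P T" using q(1) A T'(2) by (auto simp: nonunits_def)
    then obtain c where c: "c \<in> carrier B" "q = c \<otimes>\<^bsub>B\<^esub> f" using f(2) by blast
    have q0: "q = \<zero>\<^bsub>B\<^esub>"
    proof (rule ccontr)
      assume n: "q \<noteq> \<zero>\<^bsub>B\<^esub>"
      then have c0: "c \<noteq> \<zero>\<^bsub>B\<^esub>" using c fc by auto
      have "c \<in> ?P T'"
      proof (rule ccontr)
        assume "c \<notin> ?P T'"
        then have "inv (\<phi> c) \<in> T'" using c(1) A' by (auto simp: nonunits_def)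
        then have "inv (\<phi> c) \<otimes> inv (\<phi> f) \<in> T'" using invf subringE(6)[OF T'(1)] by auto
        then have "inv (\<phi> q) \<in> T'" using c fc nz[OF c(1) c0] nz[OF fc f0(1)] by (simp add: inv_mult_nonzero)
        then show False using q(1) nz[OF qc n] by (auto simp: nonunits_def)
      qed
      then obtain e where e: "e \<in> carrier B" "c = e \<otimes>\<^bsub>B\<^esub> q" using q(2) by blast
      have "q \<otimes>\<^bsub>B\<^esub> (e \<otimes>\<^bsub>B\<^esub> f) = q \<otimes>\<^bsub>B\<^esub> \<one>\<^bsub>B\<^esub>" using c e qc fc
        by (metis B.m_assoc B.m_comm B.m_closed B.r_one)
      then have "e \<otimes>\<^bsub>B\<^esub> f = \<one>\<^bsub>B\<^esub>" using B.m_lcancel[OF n qc] e fc by auto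
      then have "\<phi> e \<otimes> \<phi> f = \<one>" using e fc by (metis h.hom_mult h.hom_one)
      moreover have "\<phi> e \<otimes> \<phi> f \<in> nonunits T"
        using nonunits_mult[OF T] f(1) e(1) A by auto
      ultimately show False using one_notin_nonunits[OF T] by auto
    qed
    have "inv a \<in> T'" if a: "a \<in> \<phi> ` carrier B" "a \<noteq> \<zero>" for a
    proof (rule ccontr)
      assume n: "inv a \<notin> T'"
      obtain c where c: "c \<in> carrier B" "a = \<phi> c" using a by auto
      then have "c \<in> ?P T'" using n A' by (auto simp: nonunits_def)
      then obtain d where "d \<in> carrier B" "c = d \<otimes>\<^bsub>B\<^esub> q" using q(2) by blast
      then show False using q0 c a by auto
    qed
    then have K: "generate_field R (\<phi> ` carrier B) \<subseteq> T'"
      using generate_field_subset[OF A_ring T'(1) A'] by blast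
    have Kf: "subfield (generate_field R (\<phi> ` carrier B)) R"
      by (rule generate_field_is_subfield[OF subringE(1)[OF A_ring]])
    show ?thesis
    proof (intro equalityI subringE(1)[OF T'(1)] subsetI)
      fix z assume z: "z \<in> carrier R"
      show "z \<in> T'"
      proof (cases "z = \<zero> \<or> z \<in> T'")
        case True
        then show ?thesis using subringE(2)[OF T'(1)] by auto
      next
        case False
        then have "inv z \<in> T'" using valuation_subringD(2)[OF V' z] by auto
        then have "inv (inv z) \<in> T'"
          using algebraic_inv_mem[OF Kf T'(1) K] inv_props[OF z] False alg by auto
        then show ?thesis using inv_inv_nonzero[OF z] False by auto
      qed
    qed
  qed
  then show ?thesis unfolding maximal_subring_def using T proper by auto
qed

text \<open>Euclid's proof that there are infinitely many primes, with maximal subrings in place of primes.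
  Given finitely many, choose a nonzero \<open>G\<close> in \<open>B\<close> that is a non-unit in each of those which contain
  \<open>B\<close> without inverting all of it. A maximal subring \<open>T\<close> that is a
  valuation ring in which \<open>1 + t G\<close> is a non-unit is a new one, since \<open>G\<close> is a unit in it.\<close>
theorem infinitely_many_maximal_subrings:
  assumes B: "principal_domain B" and h: "ring_hom_ring B R \<phi>" and inj: "inj_on \<phi> (carrier B)"
    and alg: "\<And>x. x \<in> carrier R \<Longrightarrow> (algebraic over (generate_field R (\<phi> ` carrier B))) x"
    and nonunit: "\<And>G. \<lbrakk>G \<in> carrier B; G \<noteq> \<zero>\<^bsub>B\<^esub>\<rbrakk> \<Longrightarrow>
      \<exists>t\<in>carrier B. \<one>\<^bsub>B\<^esub> \<oplus>\<^bsub>B\<^esub> t \<otimes>\<^bsub>B\<^esub> G \<notin> Units B \<union> {\<zero>\<^bsub>B\<^esub>}"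
  shows "infinite {S. maximal_subring S R}"
proof
  assume fin: "finite {S. maximal_subring S R}"
  interpret B: principal_domain B by fact
  interpret h: ring_hom_ring B R \<phi> by fact
  have nz: "\<phi> c \<noteq> \<zero>" if "c \<in> carrier B" "c \<noteq> \<zero>\<^bsub>B\<^esub>" for c
    using that inj by (metis B.zero_closed h.hom_zero inj_onD)
  have A_ring: "subring (\<phi> ` carrier B) R" by (rule h.img_is_subring[OF B.carrier_is_subring])
  define centred where "centred = {S. maximal_subring S R \<and> \<phi> ` carrier B \<subseteq> S \<and>
    (\<exists>g\<in>carrier B. g \<noteq> \<zero>\<^bsub>B\<^esub> \<and> \<phi> g \<in> nonunits S)}"
  have "finite centred" using fin by (rule finite_subset[rotated]) (auto simp: centred_def)
  moreover have "centred \<subseteq> centred" ..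
  ultimately have "\<exists>G\<in>carrier B. G \<noteq> \<zero>\<^bsub>B\<^esub> \<and> (\<forall>S\<in>centred. \<phi> G \<in> nonunits S)"
  proof (induct rule: finite_subset_induct')
    case empty
    then show ?case using B.one_not_zero by blast
  next
    case (insert S D)
    then obtain G where G: "G \<in> carrier B" "G \<noteq> \<zero>\<^bsub>B\<^esub>" "\<forall>S\<in>D. \<phi> G \<in> nonunits S" by auto
    obtain g where g: "g \<in> carrier B" "g \<noteq> \<zero>\<^bsub>B\<^esub>" "\<phi> g \<in> nonunits S"
      using insert(2) by (auto simp: centred_def)
    have sub: "subring S R" "\<phi> ` carrier B \<subseteq> S" if "S \<in> centred" for S
      using that by (auto simp: centred_def maximal_subring_def)
    have "\<phi> (G \<otimes>\<^bsub>B\<^esub> g) \<in> nonunits S'" if S': "S' \<in> insert S D" for S'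
    proof (cases "S' = S")
      case True
      have "\<phi> G \<otimes> \<phi> g \<in> nonunits S"
        by (rule nonunits_mult[OF sub(1)[OF insert(2)] _ g(3)]) (use sub(2)[OF insert(2)] G in auto)
      then show ?thesis using True G g by simp
    next
      case False
      then have S'D: "S' \<in> D" "S' \<in> centred" using S' insert(3) by auto
      have "\<phi> g \<otimes> \<phi> G \<in> nonunits S'"
        by (rule nonunits_mult[OF sub(1)[OF S'D(2)]]) (use sub(2)[OF S'D(2)] G g S'D(1) in auto)
      then show ?thesis using G g by (simp add: m_comm)
    qed
    moreover have "G \<otimes>\<^bsub>B\<^esub> g \<noteq> \<zero>\<^bsub>B\<^esub>" using G g B.integral by blast
    ultimately show ?case using G(1) g(1) by (meson B.m_closed)
  qed
  then obtain G where G: "G \<in> carrier B" "G \<noteq> \<zero>\<^bsub>B\<^esub>" "\<And>S. S \<in> centred \<Longrightarrow> \<phi> G \<in> nonunits S" by auto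
  obtain t where t: "t \<in> carrier B" "\<one>\<^bsub>B\<^esub> \<oplus>\<^bsub>B\<^esub> t \<otimes>\<^bsub>B\<^esub> G \<notin> Units B \<union> {\<zero>\<^bsub>B\<^esub>}"
    using nonunit[OF G(1,2)] by auto
  define b where "b = \<one>\<^bsub>B\<^esub> \<oplus>\<^bsub>B\<^esub> t \<otimes>\<^bsub>B\<^esub> G"
  have b: "b \<in> carrier B" "b \<noteq> \<zero>\<^bsub>B\<^esub>" "b \<notin> Units B" using t G by (auto simp: b_def)
  have bc: "\<phi> b \<in> carrier R" "\<phi> b \<noteq> \<zero>" using b nz by auto
  have "inv (\<phi> b) \<notin> \<phi> ` carrier B"
  proof
    assume "inv (\<phi> b) \<in> \<phi> ` carrier B"
    then obtain c where c: "c \<in> carrier B" "inv (\<phi> b) = \<phi> c" by auto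
    then have "\<phi> (b \<otimes>\<^bsub>B\<^esub> c) = \<phi> \<one>\<^bsub>B\<^esub>" using b inv_props[OF bc] by auto
    then have "b \<otimes>\<^bsub>B\<^esub> c = \<one>\<^bsub>B\<^esub>" using inj b c by (meson B.m_closed B.one_closed inj_onD)
    then have "b \<in> Units B" using b c by (auto simp: Units_def B.m_comm)
    then show False using b by auto
  qed
  then obtain T where T: "\<phi> ` carrier B \<subseteq> T" "maximal_avoiding T (inv (\<phi> b))"
    using maximal_avoiding_exists[OF A_ring] by blast
  have max: "maximal_subring T R"
    by (rule maximal_avoiding_is_maximal_subring[OF B h inj alg b(1,2) T(2,1)])
  have bT: "\<phi> b \<in> T" using T b by auto
  have bn: "\<phi> b \<in> nonunits T" using maximal_avoidingD(2)[OF T(2)] bT by (auto simp: nonunits_def)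
  have "T \<in> centred" using max T b bn by (auto simp: centred_def)
  then have Gn: "\<phi> G \<in> nonunits T" by (rule G(3))
  have V: "valuation_subring T" by (rule maximal_avoiding_valuation[OF T(2) bT bc(2)])
  note T' = valuation_subringD(1)[OF V]
  have "\<phi> t \<otimes> \<phi> G \<in> nonunits T" by (rule nonunits_mult[OF T' _ Gn]) (use T t in auto)
  then have "\<phi> b \<oplus> \<ominus> (\<phi> t \<otimes> \<phi> G) \<in> nonunits T"
    using nonunits_add[OF V bn] nonunits_uminus[OF T'] by blast
  moreover have "\<phi> b \<oplus> \<ominus> (\<phi> t \<otimes> \<phi> G) = \<one>"
  proof -
    have "\<phi> b = \<one> \<oplus> \<phi> t \<otimes> \<phi> G" unfolding b_def using t G by simp
    moreover have "\<phi> t \<in> carrier R" "\<phi> G \<in> carrier R" using t G by auto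
    ultimately show ?thesis by (simp add: a_assoc r_neg)
  qed
  ultimately show False using one_notin_nonunits[OF T'] by auto
qed

end

text \<open>The linear polynomial \<open>X\<close> plays the part of \<open>t\<close> in the hypothesis on non-units above.\<close>
lemma (in domain) one_plus_var_mult_nonconstant:
  assumes K: "subfield K R" and G: "G \<in> carrier (K[X])" "G \<noteq> []"
  shows "degree (\<one>\<^bsub>K[X]\<^esub> \<oplus>\<^bsub>K[X]\<^esub> X \<otimes>\<^bsub>K[X]\<^esub> G) \<noteq> 0"
proof
  let ?p = "\<one>\<^bsub>K[X]\<^esub> \<oplus>\<^bsub>K[X]\<^esub> X \<otimes>\<^bsub>K[X]\<^esub> G"
  assume d: "degree ?p = 0"
  note K' = subfieldE(1)[OF K]
  interpret UP: domain "K[X]" using univ_poly_is_domain[OF K'] .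
  let ?C = "poly_of_const ` K"
  have C: "?C = {p \<in> carrier (K[X]). degree p = 0}" by (rule poly_of_const_over_subfield[OF K])
  have sub: "subring ?C (K[X])" using univ_poly_subfield_of_consts[OF K] subfieldE(1) by auto
  have Xc: "X \<in> carrier (K[X])" using var_closed(1)[OF K'] .
  have "?p \<in> ?C" unfolding C using d Xc G by auto
  moreover have "\<one>\<^bsub>K[X]\<^esub> \<in> ?C" using subringE(3)[OF sub] .
  ultimately have "?p \<oplus>\<^bsub>K[X]\<^esub> \<ominus>\<^bsub>K[X]\<^esub> \<one>\<^bsub>K[X]\<^esub> \<in> ?C" using subringE(5,7)[OF sub] by blast
  moreover have "?p \<oplus>\<^bsub>K[X]\<^esub> \<ominus>\<^bsub>K[X]\<^esub> \<one>\<^bsub>K[X]\<^esub> = X \<otimes>\<^bsub>K[X]\<^esub> G"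
    using Xc G by algebra
  ultimately have "degree (X \<otimes>\<^bsub>K[X]\<^esub> G) = 0" unfolding C by auto
  moreover have "degree (X \<otimes>\<^bsub>K[X]\<^esub> G) = Suc (degree G)"
  proof -
    have "polynomial K X" "polynomial K G" using Xc G by (auto simp: univ_poly_carrier)
    from poly_mult_degree_eq[OF K' this] show ?thesis
      using G by (auto simp: univ_poly_mult var_def)
  qed
  ultimately show False by simp
qed

context field
begin

lemma transcendentalD:
  assumes "(transcendental over L) x" "set p \<subseteq> L" "p \<noteq> []" "hd p \<noteq> \<zero>"
  shows "eval p x \<noteq> \<zero>"
  using eval_transcendental[OF assms(1), of p] assms(2-4)
  by (auto simp: univ_poly_carrier[symmetric] polynomial_def)

lemma infinitely_many_of_function_field:
  assumes L: "subfield L R" and x: "x \<in> carrier R" "(transcendental over L) x"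
    and alg: "\<And>y. y \<in> carrier R \<Longrightarrow> (algebraic over (generate_field R (L \<union> {x}))) y"
  shows "infinite {S. maximal_subring S R}"
proof (rule infinitely_many_maximal_subrings[of "L[X]" "\<lambda>p. eval p x"])
  note L' = subfieldE(1)[OF L]
  show "principal_domain (L[X])" by (rule univ_poly_is_principal[OF L])
  show "ring_hom_ring (L[X]) R (\<lambda>p. eval p x)" by (rule eval_ring_hom[OF L' x(1)])
  show "inj_on (\<lambda>p. eval p x) (carrier (L[X]))"
    using x(2) by (simp add: over_def transcendental_def)
  have img: "(\<lambda>p. eval p x) ` carrier (L[X]) = simple_extension L x"
    by (rule simple_extension_as_eval_img[OF subringE(1)[OF L'] x(1), symmetric])
  have "generate_field R (L \<union> {x}) \<subseteq> generate_field R (simple_extension L x)"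
    by (rule mono_generate_field) (use simple_extension_incl[OF subringE(1)[OF L'] x(1)]
      simple_extension_mem[OF L' x(1)] simple_extension_in_carrier[OF subringE(1)[OF L'] x(1)] in auto)
  then show "(algebraic over (generate_field R ((\<lambda>p. eval p x) ` carrier (L[X])))) y" if "y \<in> carrier R" for y
    unfolding img using algebraic_mono alg[OF that] by blast
  fix G assume G: "G \<in> carrier (L[X])" "G \<noteq> \<zero>\<^bsub>L[X]\<^esub>"
  have "degree (\<one>\<^bsub>L[X]\<^esub> \<oplus>\<^bsub>L[X]\<^esub> X \<otimes>\<^bsub>L[X]\<^esub> G) \<noteq> 0"
    by (rule one_plus_var_mult_nonconstant[OF L]) (use G in \<open>auto simp: univ_poly_zero\<close>)
  then have "\<one>\<^bsub>L[X]\<^esub> \<oplus>\<^bsub>L[X]\<^esub> X \<otimes>\<^bsub>L[X]\<^esub> G \<notin> Units (L[X]) \<union> {\<zero>\<^bsub>L[X]\<^esub>}"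
    using univ_poly_units'[OF L] unfolding univ_poly_zero by fastforce
  then show "\<exists>t\<in>carrier (L[X]). \<one>\<^bsub>L[X]\<^esub> \<oplus>\<^bsub>L[X]\<^esub> t \<otimes>\<^bsub>L[X]\<^esub> G \<notin> Units (L[X]) \<union> {\<zero>\<^bsub>L[X]\<^esub>}"
    using var_closed(1)[OF L'] by blast
qed

text \<open>Reads a list of polynomials in \<open>y\<close>, the coefficients of a polynomial in \<open>x\<close>,
  as a polynomial in \<open>y\<close> with coefficients in \<open>x\<close>.\<close>
primrec swap_variables :: "'a \<Rightarrow> 'a list list \<Rightarrow> 'a list" where
  "swap_variables x [] = []"
| "swap_variables x (r # rs) = poly_add (map (\<lambda>c. x [^] length rs \<otimes> c) r) (swap_variables x rs)"

lemma eval_smult: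
  assumes "set p \<subseteq> carrier R" "a \<in> carrier R" "x \<in> carrier R"
  shows "eval (map (\<lambda>c. a \<otimes> c) p) x = a \<otimes> eval p x"
  using assms(1) assms(2,3) eval_in_carrier by (induct p) (auto simp: m_assoc r_distr)

lemma swap_variables:
  assumes F: "subring F R" "x \<in> F" and y: "y \<in> carrier R" and rs: "\<And>r. r \<in> set rs \<Longrightarrow> set r \<subseteq> F"
  shows "set (swap_variables x rs) \<subseteq> F" "swap_variables x rs \<in> carrier (F[X])"
    "eval (swap_variables x rs) y = eval (map (\<lambda>r. eval r y) rs) x"
    "coeff (swap_variables x rs) j = eval (map (\<lambda>r. coeff r j) rs) x"
proof -
  have Fc: "a \<in> carrier R" if "a \<in> F" for a using that subringE(1)[OF F(1)] by auto
  have "set (swap_variables x rs) \<subseteq> F \<and> swap_variables x rs \<in> carrier (F[X]) \<and>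
    eval (swap_variables x rs) y = eval (map (\<lambda>r. eval r y) rs) x \<and>
    coeff (swap_variables x rs) j = eval (map (\<lambda>r. coeff r j) rs) x"
    using rs
  proof (induct rs)
    case Nil
    then show ?case by auto
  next
    case (Cons r rs)
    let ?a = "x [^] length rs" let ?m = "map (\<lambda>c. ?a \<otimes> c) r" let ?s = "swap_variables x rs"
    have IH: "set ?s \<subseteq> F" "eval ?s y = eval (map (\<lambda>r. eval r y) rs) x"
      "coeff ?s j = eval (map (\<lambda>r. coeff r j) rs) x" using Cons by auto
    have a: "?a \<in> F" "?a \<in> carrier R" using subring_pow[OF F] Fc by auto
    have r: "set r \<subseteq> F" "set r \<subseteq> carrier R" using Cons(2) Fc by auto
    have m: "set ?m \<subseteq> F" using a r subringE(6)[OF F(1)] by auto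
    have mc: "set ?m \<subseteq> carrier R" "set ?s \<subseteq> carrier R" using m IH(1) Fc by blast+
    have p: "polynomial F (poly_add ?m ?s)" by (rule poly_add_is_polynomial[OF F(1) m IH(1)])
    have "eval (poly_add ?m ?s) y = eval ?m y \<oplus> eval ?s y" by (rule eval_poly_add[OF mc y])
    also have "\<dots> = ?a \<otimes> eval r y \<oplus> eval ?s y" using eval_smult[OF r(2) a(2) y] by simp
    finally have e: "eval (poly_add ?m ?s) y = eval r y \<otimes> ?a \<oplus> eval ?s y"
      using a eval_in_carrier[OF r(2) y] by (simp add: m_comm)
    have "coeff (poly_add ?m ?s) j = coeff ?m j \<oplus> coeff ?s j" using poly_add_coeff[OF mc] by simp
    also have "\<dots> = coeff r j \<otimes> ?a \<oplus> coeff ?s j"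
      using scalar_coeff[OF a(2), of r] a coeff_in_carrier[OF r(2)] by (simp add: m_comm)
    finally show ?case using e p polynomial_incl[OF p] IH
      by (simp del: poly_add.simps add: univ_poly_carrier)
  qed
  then show "set (swap_variables x rs) \<subseteq> F" "swap_variables x rs \<in> carrier (F[X])"
    "eval (swap_variables x rs) y = eval (map (\<lambda>r. eval r y) rs) x"
    "coeff (swap_variables x rs) j = eval (map (\<lambda>r. coeff r j) rs) x" by auto
qed

text \<open>The exchange property of algebraic dependence: a relation for \<open>x\<close> over \<open>L(y)\<close>, cleared of
  denominators, is a polynomial in two variables, and it is nonzero as a polynomial in \<open>y\<close> because \<open>x\<close>
  is transcendental over \<open>L\<close>.\<close>
lemma algebraic_exchange:
  assumes L: "subfield L R" and x: "x \<in> carrier R" "(transcendental over L) x"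
    and y: "y \<in> carrier R" and alg: "(algebraic over (generate_field R (L \<union> {y}))) x"
  shows "(algebraic over (generate_field R (L \<union> {x}))) y"
proof -
  note L' = subfieldE(1)[OF L]
  have Lc: "L \<subseteq> carrier R" using subringE(1)[OF L'] .
  let ?A = "simple_extension L y" let ?F = "generate_field R (L \<union> {x})"
  have A: "subring ?A R" by (rule simple_extension_is_subring[OF L' y])
  have F: "subfield ?F R" by (rule generate_field_is_subfield) (use Lc x in auto)
  have LF: "L \<subseteq> ?F" "x \<in> ?F" by (auto intro: generate_field.incl)
  have "generate_field R (L \<union> {y}) \<subseteq> generate_field R ?A"
    by (rule mono_generate_field) (use simple_extension_incl[OF Lc y]
      simple_extension_mem[OF L' y] subringE(1)[OF A] in auto)
  then have "(algebraic over (generate_field R ?A)) x" using algebraic_mono alg by blast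
  moreover have gA: "subfield (generate_field R ?A) R"
    by (rule generate_field_is_subfield[OF subringE(1)[OF A]])
  ultimately obtain p where p: "p \<in> carrier ((generate_field R ?A)[X])" "p \<noteq> []" "eval p x = \<zero>"
    using algebraicE[OF subfieldE(1)[OF gA] x(1)] by blast
  have pP: "set p \<subseteq> generate_field R ?A" "hd p \<noteq> \<zero>"
    using p by (auto simp: univ_poly_carrier[symmetric] polynomial_def)
  have pc: "set p \<subseteq> carrier R" using pP(1) subfieldE(3)[OF gA] by auto
  obtain a where a: "a \<in> ?A" "a \<noteq> \<zero>" "\<And>c. c \<in> set p \<Longrightarrow> a \<otimes> c \<in> ?A"
    using generate_field_common_denominator[OF A _ pP(1)] by blast
  have ac: "a \<in> carrier R" using a subringE(1)[OF A] by auto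
  let ?p = "map (\<lambda>c. a \<otimes> c) p"
  have ev: "eval ?p x = \<zero>" using eval_smult[OF pc ac x(1)] p(3) ac by simp
  have "\<exists>r\<in>carrier (L[X]). eval r y = c" if "c \<in> set ?p" for c
  proof -
    have "c \<in> ?A" using that a(3) by auto
    then show ?thesis unfolding simple_extension_as_eval_img[OF Lc y] by auto
  qed
  then obtain r where r: "\<And>c. c \<in> set ?p \<Longrightarrow> r c \<in> carrier (L[X]) \<and> eval (r c) y = c" by metis
  let ?rs = "map r ?p"
  have mr: "map (\<lambda>s. eval s y) ?rs = ?p" using r by (auto simp: map_idI)
  have rsL: "set s \<subseteq> L" if "s \<in> set ?rs" for s
    using that r by (force simp: univ_poly_carrier[symmetric] polynomial_def)
  then have rsF: "set s \<subseteq> ?F" if "s \<in> set ?rs" for s using that LF by blast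
  note sw = swap_variables[OF subfieldE(1)[OF F] LF(2) y, of ?rs, OF rsF]
  obtain c q where cq: "p = c # q" using p(2) by (cases p) auto
  have cc: "c \<in> carrier R" "c \<noteq> \<zero>" using cq pc pP by auto
  have "a \<otimes> c \<noteq> \<zero>" using a ac cc integral by blast
  moreover have r0: "r (a \<otimes> c) \<in> carrier (L[X])" "eval (r (a \<otimes> c)) y = a \<otimes> c" using r cq by auto
  ultimately have rn: "r (a \<otimes> c) \<noteq> []" by auto
  let ?j = "degree (r (a \<otimes> c))"
  have cj: "coeff (r (a \<otimes> c)) ?j \<noteq> \<zero>"
    using r0(1) rn lead_coeff_simp[OF rn] by (auto simp: univ_poly_carrier[symmetric] polynomial_def)
  have "eval (map (\<lambda>s. coeff s ?j) ?rs) x \<noteq> \<zero>"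
  proof (rule transcendentalD[OF x(2)])
    have "coeff s j \<in> L" if "s \<in> set ?rs" for s j
    proof (cases "j < length s")
      case True
      then show ?thesis using coeff_img(1)[of s] rsL[OF that] by blast
    next
      case False
      then show ?thesis using coeff_length subringE(2)[OF L'] by auto
    qed
    then show "set (map (\<lambda>s. coeff s ?j) ?rs) \<subseteq> L" by auto
    show "map (\<lambda>s. coeff s ?j) ?rs \<noteq> []" "hd (map (\<lambda>s. coeff s ?j) ?rs) \<noteq> \<zero>" using cj cq by auto
  qed
  then have "swap_variables x ?rs \<noteq> []" using sw(4)[of ?j] by fastforce
  moreover have "eval (swap_variables x ?rs) y = \<zero>" using sw(3) ev unfolding mr by simp
  ultimately show ?thesis using algebraicI[OF sw(2)] by blast
qed

text \<open>By Zorn's lemma there is a maximal subfield \<open>L\<close> over which \<open>x\<close> remains transcendental. Adjoining any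
  further \<open>y\<close> makes \<open>x\<close> algebraic, so by exchange \<open>y\<close> is algebraic over \<open>L(x)\<close>.\<close>
theorem infinitely_many_of_transcendental:
  assumes L0: "subfield L0 R" and x: "x \<in> carrier R" "(transcendental over L0) x"
  shows "infinite {S. maximal_subring S R}"
proof -
  define A where "A = {L. subfield L R \<and> L0 \<subseteq> L \<and> (transcendental over L) x}"
  have "\<exists>M\<in>A. \<forall>L\<in>A. M \<subseteq> L \<longrightarrow> L = M"
  proof (rule subset_Zorn_nonempty)
    show "A \<noteq> {}" using assms by (auto simp: A_def)
    fix C assume C: "C \<noteq> {}" "subset.chain A C"
    have mem: "subfield L R" "L0 \<subseteq> L" "(transcendental over L) x" if "L \<in> C" for L
      using C(2) that by (auto simp: subset.chain_def A_def)
    have sr: "subring (\<Union>C) R"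
    proof (rule chain_Union_subring[OF C(1)])
      show "subring S R" if "S \<in> C" for S using mem(1)[OF that] by (rule subfieldE(1))
      show "S \<subseteq> T \<or> T \<subseteq> S" if "S \<in> C" "T \<in> C" for S T
        using C(2) that unfolding subset.chain_def by blast
    qed
    have "subfield (\<Union>C) R"
    proof (rule subfieldI'[OF sr])
      fix k assume "k \<in> \<Union>C - {\<zero>}"
      then obtain L where "L \<in> C" "k \<in> L" "k \<noteq> \<zero>" by auto
      then show "inv k \<in> \<Union>C" using subfield_m_inv(1)[OF mem(1)] by blast
    qed
    moreover have "(transcendental over (\<Union>C)) x"
    proof (rule ccontr)
      assume "\<not> ?thesis"
      then have "(algebraic over (\<Union>C)) x" by (simp add: over_def)
      then obtain p where p: "p \<in> carrier ((\<Union>C)[X])" "p \<noteq> []" "eval p x = \<zero>"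
        using algebraicE[OF sr x(1)] by blast
      then have pp: "set p \<subseteq> \<Union>C" "hd p \<noteq> \<zero>" by (auto simp: univ_poly_carrier[symmetric] polynomial_def)
      then obtain L where "L \<in> C" "set p \<subseteq> L"
        using finite_subset_Union_chain[OF finite_set _ C(1,2)] by blast
      then show False using transcendentalD[OF mem(3)] p pp by auto
    qed
    ultimately show "\<Union>C \<in> A" using C(1) mem(2) by (auto simp: A_def)
  qed
  then obtain L where "L \<in> A" and max: "\<And>L'. \<lbrakk>L' \<in> A; L \<subseteq> L'\<rbrakk> \<Longrightarrow> L' = L" by blast
  then have L: "subfield L R" "L0 \<subseteq> L" "(transcendental over L) x" by (auto simp: A_def)
  show ?thesis
  proof (rule infinitely_many_of_function_field[OF L(1) x(1) L(3)])
    fix y assume y: "y \<in> carrier R"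
    have Lc: "L \<subseteq> carrier R" using subfieldE(3)[OF L(1)] .
    show "(algebraic over (generate_field R (L \<union> {x}))) y"
    proof (cases "y \<in> L")
      case True
      have "subfield (generate_field R (L \<union> {x})) R"
        by (rule generate_field_is_subfield) (use Lc x in auto)
      then show ?thesis using algebraic_self[OF subfieldE(1)] True by (auto intro: generate_field.incl)
    next
      case False
      let ?L = "generate_field R (L \<union> {y})"
      have "subfield ?L R" by (rule generate_field_is_subfield) (use Lc y in auto)
      moreover have "L \<subseteq> ?L" "y \<in> ?L" by (auto intro: generate_field.incl)
      ultimately have "\<not> (transcendental over ?L) x" using max[of ?L] False L(2) by (auto simp: A_def)
      then show ?thesis using algebraic_exchange[OF L(1) x(1) L(3) y] by (simp add: over_def)
    qed
  qed
qed

end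

section \<open>Finite subrings and the Frobenius map\<close>

text \<open>Stated in order to obtain additivity of the Frobenius map.\<close>
lemma (in cring) binomial_expansion:
  assumes x: "x \<in> carrier R" and y: "y \<in> carrier R"
  shows "(x \<oplus> y) [^] n = (\<Oplus>k\<in>{..n}. [(n choose k)] \<cdot> (x [^] k \<otimes> y [^] (n - k)))"
proof (induct n)
  case 0
  then show ?case by simp
next
  case (Suc n)
  let ?t = "\<lambda>n k. [(n choose k)] \<cdot> (x [^] k \<otimes> y [^] (n - k))"
  let ?c = "\<lambda>m k. [m] \<cdot> (x [^] Suc k \<otimes> y [^] (n - k))"
  have c: "?c m k \<in> carrier R" "?t m k \<in> carrier R" for m k using x y by auto
  have up: "x \<otimes> ?t n k = ?c (n choose k) k" for k
    using x y by (simp add: add_pow_rdistr m_ac)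
  have low: "y \<otimes> ?t n k = [(n choose k)] \<cdot> (x [^] k \<otimes> y [^] (Suc n - k))" if "k \<le> n" for k
    using x y that by (simp add: add_pow_rdistr m_ac Suc_diff_le)
  have "(x \<oplus> y) [^] Suc n = x \<otimes> (\<Oplus>k\<in>{..n}. ?t n k) \<oplus> y \<otimes> (\<Oplus>k\<in>{..n}. ?t n k)"
    using x y c Suc by (simp add: m_comm r_distr l_distr)
  also have "x \<otimes> (\<Oplus>k\<in>{..n}. ?t n k) = (\<Oplus>k\<in>{..n}. ?c (n choose k) k)"
    using x c up by (subst finsum_rdistr) auto
  also have "y \<otimes> (\<Oplus>k\<in>{..n}. ?t n k) = (\<Oplus>k\<in>{..n}. [(n choose k)] \<cdot> (x [^] k \<otimes> y [^] (Suc n - k)))"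
    using y c x by (subst finsum_rdistr) (auto intro!: finsum_cong' simp: low simp del: nat_pow_Suc)
  also have "\<dots> = (\<Oplus>k\<in>{..Suc n}. [(n choose k)] \<cdot> (x [^] k \<otimes> y [^] (Suc n - k)))"
    using x y by (subst finsum_Suc) (auto simp del: nat_pow_Suc simp: binomial_eq_0)
  also have "\<dots> = (\<Oplus>k\<in>{..n}. ?c (n choose Suc k) k) \<oplus> y [^] Suc n"
    using x y by (subst finsum_Suc2) (auto simp del: nat_pow_Suc)
  finally have "(x \<oplus> y) [^] Suc n =
      (\<Oplus>k\<in>{..n}. ?c (n choose k) k) \<oplus> ((\<Oplus>k\<in>{..n}. ?c (n choose Suc k) k) \<oplus> y [^] Suc n)" .
  also have "\<dots> = (\<Oplus>k\<in>{..n}. ?c (n choose k) k \<oplus> ?c (n choose Suc k) k) \<oplus> y [^] Suc n"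
    using c y by (subst finsum_addf) (auto simp: a_assoc simp del: nat_pow_Suc)
  also have "\<dots> = (\<Oplus>k\<in>{..n}. ?c (Suc n choose Suc k) k) \<oplus> y [^] Suc n"
  proof -
    have "?c (n choose k) k \<oplus> ?c (n choose Suc k) k = ?c (Suc n choose Suc k) k" for k
      using x y by (simp add: add.nat_pow_mult del: nat_pow_Suc)
    then show ?thesis by presburger
  qed
  also have "\<dots> = (\<Oplus>k\<in>{..Suc n}. ?t (Suc n) k)"
    using x y by (subst finsum_Suc2) (auto simp del: nat_pow_Suc)
  finally show ?case .
qed

lemma (in ring) subring_restrict:
  assumes "subring K R"
  shows "subring S (R\<lparr>carrier := K\<rparr>) \<longleftrightarrow> subring S R \<and> S \<subseteq> K"
proof -
  interpret K: ring "R\<lparr>carrier := K\<rparr>" using subring_is_ring[OF assms] .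
  show ?thesis
    using K.subring_iff[of S] subring_iff[of S] subringE(1)[OF assms] subringE(1)[of S "R\<lparr>carrier := K\<rparr>"]
    by auto
qed

lemma (in ring) maximal_subring_restrict:
  assumes "subring K R"
  shows "maximal_subring S (R\<lparr>carrier := K\<rparr>) \<longleftrightarrow>
    subring S R \<and> S \<subset> K \<and> (\<forall>T. subring T R \<and> T \<subset> K \<and> S \<subseteq> T \<longrightarrow> T = S)"
  unfolding maximal_subring_def subring_restrict[OF assms] by auto

context field
begin

lemma nat_pow_nonzero: "\<lbrakk>x \<in> carrier R; x \<noteq> \<zero>\<rbrakk> \<Longrightarrow> x [^] (n::nat) \<noteq> \<zero>"
  by (induct n) (auto simp: integral_iff)

lemma pow_eq_imp_one:
  assumes "x \<in> carrier R" "x \<noteq> \<zero>" "x [^] (i::nat) = x [^] j" "i < j"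
  shows "x [^] (j - i) = \<one>"
proof -
  have "x [^] i \<noteq> \<zero>" "x [^] i \<in> carrier R"
    using assms(1,2) by (auto simp: nat_pow_nonzero)
  moreover have "x [^] i \<otimes> x [^] (j - i) = x [^] j"
    using nat_pow_mult[of x i "j - i"] assms(1,4) by simp
  then have "x [^] i \<otimes> x [^] (j - i) = x [^] i \<otimes> \<one>"
    using assms(1,3) by simp
  ultimately show ?thesis using assms(1) m_lcancel by (meson nat_pow_closed one_closed)
qed

text \<open>The powers of a nonzero element repeat, so its inverse is one of them.\<close>
lemma finite_subring_subfield:
  assumes W: "subring W R" "finite W"
  shows "subfield W R"
proof (rule subfieldI'[OF W(1)])
  fix k assume "k \<in> W - {\<zero>}"
  then have k: "k \<in> W" "k \<in> carrier R" "k \<noteq> \<zero>" using subringE(1)[OF W(1)] by auto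
  have "range (\<lambda>n::nat. k [^] n) \<subseteq> W" using subring_pow[OF W(1) k(1)] by auto
  then have "\<not> inj (\<lambda>n::nat. k [^] n)" using W(2) by (meson finite_subset infinite_UNIV_nat finite_imageD)
  then obtain i j :: nat where ij: "k [^] i = k [^] j" "i < j"
    unfolding inj_def by (metis linorder_neqE_nat)
  have "k \<otimes> k [^] (j - i - 1) = k [^] (j - i)"
    using k ij(2) by (metis Suc_diff_1 nat_pow_Suc2 zero_less_diff)
  then have "k \<otimes> k [^] (j - i - 1) = \<one>" using pow_eq_imp_one[OF k(2,3) ij] by simp
  then have "inv k = k [^] (j - i - 1)" using k comm_inv_char by auto
  then show "inv k \<in> W" using subring_pow[OF W(1) k(1)] by auto
qed

lemma finite_simple_extension:
  assumes W: "subfield W R" "finite W" and x: "x \<in> carrier R" "(algebraic over W) x"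
  shows "finite (simple_extension W x)"
proof -
  obtain n where "dimension n W (simple_extension W x)"
    using finite_dimension_simple_extension[OF W(1) x(1)] x(2) by auto
  then obtain Us where Us: "set Us \<subseteq> carrier R" "Span W Us = simple_extension W x"
    using exists_base[OF W(1)] by blast
  have "simple_extension W x = (\<lambda>Ks. combine Ks Us) ` {Ks. set Ks \<subseteq> W \<and> length Ks = length Us}"
    unfolding Us(2)[symmetric] Span_eq_combine_set_length_version[OF W(1) Us(1)] by auto
  then show ?thesis using finite_lists_length_eq[OF W(2)] by simp
qed

lemma algebraic_of_pow_eq:
  assumes F: "subring F R" and x: "x \<in> carrier R" "x [^] N = x" and N: "2 \<le> (N::nat)"
  shows "(algebraic over F) x"
proof -
  let ?a = "monom \<one> N" let ?b = "monom (\<ominus> \<one>) 1"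
  have m: "\<ominus> \<one> \<noteq> \<zero>" by (metis minus_minus minus_zero one_closed one_not_zero)
  have p: "polynomial F ?a" "polynomial F ?b"
    using monom_is_polynomial[OF F] subringE(3,5)[OF F] m by auto
  have l: "length ?a = Suc N" "length ?b = 2" by (auto simp: monom_def)
  have "length (poly_add ?a ?b) = Suc N" using poly_add_length_eq[OF F p] l N by auto
  then have "poly_add ?a ?b \<noteq> []" by auto
  moreover have "poly_add ?a ?b \<in> carrier (F[X])"
    using poly_add_closed[OF F p] by (simp add: univ_poly_carrier)
  moreover have "eval (poly_add ?a ?b) x = \<zero>"
  proof -
    have "eval (poly_add ?a ?b) x = eval ?a x \<oplus> eval ?b x"
      by (rule eval_poly_add) (auto simp: monom_def x)
    also have "\<dots> = x \<oplus> \<ominus> x" using x by (simp add: eval_monom l_minus)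
    finally show ?thesis using x by (simp add: r_neg)
  qed
  ultimately show ?thesis using algebraicI by blast
qed

text \<open>\<open>absolutely_algebraic p S\<close> says that the characteristic is \<open>p\<close> and that the elements of \<open>S\<close>
  are algebraic over the prime field, in the form in which it is used: each of them is fixed by a
  power of the Frobenius map.\<close>
definition absolutely_algebraic :: "nat \<Rightarrow> 'a set \<Rightarrow> bool" where
  "absolutely_algebraic p S \<longleftrightarrow> Factorial_Ring.prime p \<and> add_pow R p \<one> = \<zero> \<and> (\<forall>x\<in>S. \<exists>n\<ge>1. x [^] (p ^ n) = x)"

context
  fixes p :: nat
  assumes p: "Factorial_Ring.prime p" and char_p: "add_pow R p \<one> = \<zero>"
begin

lemma char_smult:
  assumes "x \<in> carrier R" "p dvd n" shows "add_pow R n x = \<zero>"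
proof -
  obtain k where k: "n = p * k" using assms(2) by auto
  have "add_pow R p y = \<zero>" if "y \<in> carrier R" for y
    using add_pow_ldistr[of \<one> y p] char_p that by simp
  then show ?thesis using assms(1) add.nat_pow_pow[of x k p] add.nat_pow_pow[of x p k]
    by (simp add: k mult.commute)
qed

lemma frobenius_add:
  assumes x: "x \<in> carrier R" "y \<in> carrier R"
  shows "(x \<oplus> y) [^] p = x [^] p \<oplus> y [^] p"
proof -
  have p1: "p \<ge> 2" using p prime_ge_2_nat by auto
  define r where "r = p - 2"
  have pr: "p = Suc (Suc r)" using p1 by (simp add: r_def)
  let ?t = "\<lambda>k. [(p choose k)] \<cdot> (x [^] k \<otimes> y [^] (p - k))"
  have t: "?t k \<in> carrier R" for k using x by auto
  have z: "?t k = \<zero>" if "0 < k" "k < p" for k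
    by (rule char_smult) (use x that p dvd_choose_prime[of k p] in auto)
  have "(x \<oplus> y) [^] p = (\<Oplus>k\<in>{..Suc (Suc r)}. ?t k)"
    using binomial_expansion[OF x, of p] pr by simp
  also have "\<dots> = ?t (Suc (Suc r)) \<oplus> ((\<Oplus>k\<in>{..r}. ?t (Suc k)) \<oplus> ?t 0)"
    using t by (subst finsum_Suc, blast, subst finsum_Suc2) auto
  also have "(\<Oplus>k\<in>{..r}. ?t (Suc k)) = (\<Oplus>k\<in>{..r}. \<zero>)"
  proof (rule finsum_cong')
    fix k assume "k \<in> {..r}"
    then show "?t (Suc k) = \<zero>" by (intro z) (simp_all add: pr)
  qed auto
  also have "\<dots> = \<zero>" by simp
  also have "?t (Suc (Suc r)) = x [^] p" using x pr by (simp del: nat_pow_Suc)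
  also have "?t 0 = y [^] p" using x by simp
  finally show ?thesis using x by simp
qed

lemma frobenius_power_add:
  assumes "x \<in> carrier R" "y \<in> carrier R"
  shows "(x \<oplus> y) [^] (p ^ n) = x [^] (p ^ n) \<oplus> y [^] (p ^ n)"
proof (induct n)
  case (Suc n)
  have "z [^] (p ^ Suc n) = (z [^] (p ^ n)) [^] p" if "z \<in> carrier R" for z
    using that by (simp add: nat_pow_pow mult.commute)
  then show ?case using Suc frobenius_add assms by simp
qed (use assms in auto)

lemma fixed_by_frobenius_subring: "subring {x \<in> carrier R. x [^] (p ^ n) = x} R" (is "subring ?S R")
proof (rule subringI)
  fix h assume "h \<in> ?S"
  then have h: "h \<in> carrier R" "h [^] (p ^ n) = h" by auto
  have "p ^ n \<noteq> 0" using p by (simp add: prime_gt_0_nat)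
  then have "\<zero> = (h \<oplus> \<ominus> h) [^] (p ^ n)" using h by (simp add: r_neg nat_pow_zero)
  also have "\<dots> = h \<oplus> (\<ominus> h) [^] (p ^ n)" using frobenius_power_add[of h "\<ominus> h"] h by simp
  finally have "(\<ominus> h) [^] (p ^ n) = \<ominus> h" using h
    by (metis a_inv_closed minus_equality nat_pow_closed a_comm)
  then show "\<ominus> h \<in> ?S" using h by auto
qed (auto simp: frobenius_power_add nat_pow_distrib)

text \<open>The iterates of the Frobenius map at \<open>x\<close> repeat, and the Frobenius map is injective.\<close>
lemma finite_subring_frobenius:
  assumes W: "subring W R" "finite W" and x: "x \<in> W"
  shows "\<exists>n\<ge>1. x [^] (p ^ n) = x"
proof -
  have xc: "x \<in> carrier R" using x subringE(1)[OF W(1)] by auto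
  have "range (\<lambda>n. x [^] (p ^ n)) \<subseteq> W" using subring_pow[OF W(1) x] by auto
  then have "\<not> inj (\<lambda>n. x [^] (p ^ n))" using W(2) by (meson finite_subset infinite_UNIV_nat finite_imageD)
  then obtain i j where ij: "x [^] (p ^ i) = x [^] (p ^ j)" "i < j"
    unfolding inj_def by (metis linorder_neqE_nat)
  show ?thesis
  proof (intro exI conjI)
    show "1 \<le> j - i" using ij by auto
    let ?y = "x [^] (p ^ (j - i))"
    have pp: "p ^ n \<noteq> 0" for n using p by (simp add: prime_gt_0_nat)
    have "?y = (?y \<oplus> \<ominus> x) \<oplus> x" using xc by (simp add: a_assoc l_neg)
    then have "?y [^] (p ^ i) = (?y \<oplus> \<ominus> x) [^] (p ^ i) \<oplus> x [^] (p ^ i)"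
      using frobenius_power_add[of "?y \<oplus> \<ominus> x" x i] xc by simp
    moreover have "?y [^] (p ^ i) = x [^] (p ^ i)"
      using xc ij by (simp add: nat_pow_pow power_add[symmetric])
    ultimately have "(?y \<oplus> \<ominus> x) [^] (p ^ i) = \<zero>"
      using xc add.r_cancel_one'[of "x [^] (p ^ i)" "(?y \<oplus> \<ominus> x) [^] (p ^ i)"] by simp
    then have "?y \<oplus> \<ominus> x = \<zero>" using nat_pow_nonzero[of "?y \<oplus> \<ominus> x"] xc by blast
    then show "?y = x" using xc r_right_minus_eq[of ?y x] by (simp add: minus_eq)
  qed
qed

end

subsection \<open>The prime ring\<close>

lemma int_embedding_hom: "ring_hom_ring \<Z> R (\<lambda>i. add_pow R i \<one>)"
proof (rule ring_hom_ringI2)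
  show "ring \<Z>" by (rule int.ring_axioms)
  show "ring R" by (rule ring_axioms)
  show "(\<lambda>i. add_pow R i \<one>) \<in> ring_hom \<Z> R"
  proof (rule ring_hom_memI)
    fix i j :: int
    show "add_pow R (i \<otimes>\<^bsub>\<Z>\<^esub> j) \<one> = add_pow R i \<one> \<otimes> add_pow R j \<one>"
      using add.int_pow_pow[of \<one> i j] add_pow_ldistr_int[of \<one> "add_pow R j \<one>" i]
      by (simp add: mult.commute)
    show "add_pow R (i \<oplus>\<^bsub>\<Z>\<^esub> j) \<one> = add_pow R i \<one> \<oplus> add_pow R j \<one>"
      by (simp add: add.int_pow_mult)
  qed auto
qed

lemma int_principal_domain: "principal_domain \<Z>"
proof -
  have "\<exists>a\<in>carrier \<Z>. I = PIdl\<^bsub>\<Z>\<^esub> a" if I: "ideal I \<Z>" for I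
  proof (cases "\<exists>a\<in>I. a > 0")
    case False
    interpret I: ideal I \<Z> by fact
    have "I = {0}"
    proof -
      have "a = 0" if "a \<in> I" for a
        using False that I.I_r_closed[of a "-1"] by (cases "a = 0") (auto simp: not_less, force)
      moreover have "0 \<in> I" using I.zero_closed by simp
      ultimately show ?thesis by auto
    qed
    then show ?thesis by (intro bexI[of _ 0]) (auto simp: cgenideal_def)
  next
    case True
    interpret I: ideal I \<Z> by fact
    define m where "m = (LEAST m::nat. m > 0 \<and> int m \<in> I)"
    have "\<exists>m::nat. m > 0 \<and> int m \<in> I" using True by (metis zero_less_imp_eq_int)
    then have m: "m > 0" "int m \<in> I" "\<And>k. \<lbrakk>k > 0; int k \<in> I\<rbrakk> \<Longrightarrow> m \<le> k"
      unfolding m_def by (metis (mono_tags, lifting) LeastI_ex, metis (mono_tags, lifting) LeastI_ex, simp add: Least_le)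
    have "I = {x * int m |x. True}"
    proof (intro equalityI subsetI)
      fix a assume a: "a \<in> I"
      have "(a div int m) * int m \<in> I" using I.I_l_closed[OF m(2), of "a div int m"] by simp
      then have "- ((a div int m) * int m) \<in> I" using I.I_r_closed[of "(a div int m) * int m" "-1"] by simp
      then have "a + - ((a div int m) * int m) \<in> I" using I.a_closed[OF a, of "- ((a div int m) * int m)"] by simp
      moreover have "a + - ((a div int m) * int m) = a mod int m" by (simp add: minus_div_mult_eq_mod)
      ultimately have *: "a mod int m \<in> I" by simp
      have "a mod int m = 0"
      proof (rule ccontr)
        assume n: "a mod int m \<noteq> 0"
        have ge: "a mod int m \<ge> 0" "a mod int m < int m" using m(1) by auto
        then have "m \<le> nat (a mod int m)" using m(3)[of "nat (a mod int m)"] * n by auto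
        then show False using ge by linarith
      qed
      then have "a = (a div int m) * int m" by (metis add.right_neutral div_mult_mod_eq)
      then show "a \<in> {x * int m |x. True}" by blast
    next
      fix a assume "a \<in> {x * int m |x. True}"
      then show "a \<in> I" using I.I_l_closed[OF m(2)] by auto
    qed
    then show ?thesis by (intro bexI[of _ "int m"]) (auto simp: cgenideal_def)
  qed
  then show ?thesis
    by (intro principal_domain.intro principal_domain_axioms.intro) (auto intro: int.domain_axioms)
qed

text \<open>The least positive integer that vanishes in the field has no proper factor with this property.\<close>
lemma prime_characteristic:
  assumes "\<not> inj (\<lambda>i::int. add_pow R i \<one>)"
  shows "\<exists>p::nat. Factorial_Ring.prime p \<and> add_pow R p \<one> = \<zero>"
proof -
  interpret h: ring_hom_ring \<Z> R "\<lambda>i. add_pow R i \<one>" by (rule int_embedding_hom)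
  obtain i j :: int where ij: "add_pow R i \<one> = add_pow R j \<one>" "i < j"
    using assms unfolding inj_def by (metis linorder_neqE)
  have "add_pow R (j - i) \<one> = add_pow R j \<one> \<oplus> \<ominus> (add_pow R i \<one>)"
    by (simp add: add.int_pow_diff)
  then have "add_pow R (j - i) \<one> = \<zero>" using ij by (simp add: r_neg)
  then have ex: "\<exists>n::nat. n > 0 \<and> add_pow R n \<one> = \<zero>"
    using ij by (intro exI[of _ "nat (j - i)"]) (simp add: add_pow_int_ge)
  define n where "n = (LEAST n::nat. n > 0 \<and> add_pow R n \<one> = \<zero>)"
  have n: "n > 0" "add_pow R n \<one> = \<zero>" using LeastI_ex[OF ex] by (auto simp: n_def)
  have min: "\<And>m. \<lbrakk>m > 0; add_pow R m \<one> = \<zero>\<rbrakk> \<Longrightarrow> n \<le> m" by (simp add: n_def Least_le)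
  have "n \<noteq> 1" using n(2) by auto
  then obtain q where q: "Factorial_Ring.prime q" "q dvd n" using prime_factor_nat by blast
  then obtain m where m: "n = q * m" by auto
  have "add_pow R q \<one> \<otimes> add_pow R m \<one> = add_pow R n \<one>"
    using add.nat_pow_pow[of \<one> q m] add_pow_ldistr[of \<one> "add_pow R m \<one>" q] by (simp add: m mult.commute)
  then have "add_pow R q \<one> = \<zero> \<or> add_pow R m \<one> = \<zero>" using n(2) by (simp add: integral_iff)
  moreover have "add_pow R m \<one> \<noteq> \<zero>"
  proof
    assume "add_pow R m \<one> = \<zero>"
    moreover have "m > 0" using n(1) m by auto
    ultimately have "n \<le> m" using min by auto
    then show False using \<open>m > 0\<close> prime_gt_1_nat[OF q(1)] by (simp add: m)
  qed
  ultimately show ?thesis using q by blast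
qed

lemma finite_prime_subring:
  assumes "add_pow R p \<one> = \<zero>" "(p::nat) > 0"
  shows "\<exists>W. subring W R \<and> finite W"
proof (intro exI conjI)
  interpret h: ring_hom_ring \<Z> R "\<lambda>i. add_pow R i \<one>" by (rule int_embedding_hom)
  let ?W = "(\<lambda>i. add_pow R i \<one>) ` carrier \<Z>"
  show "subring ?W R" by (rule h.img_is_subring[OF ring.carrier_is_subring[OF int.ring_axioms]])
  have pz: "add_pow R (int p) \<one> = \<zero>" using assms by (simp add: add_pow_int_ge)
  have "add_pow R i \<one> = add_pow R (i mod int p) \<one>" for i :: int
  proof -
    have "add_pow R i \<one> = add_pow R (int p * (i div int p) + i mod int p) \<one>" by simp
    also have "\<dots> = add_pow R (int p) \<one> \<otimes> add_pow R (i div int p) \<one> \<oplus> add_pow R (i mod int p) \<one>"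
      using h.hom_add[of "int p * (i div int p)" "i mod int p"] h.hom_mult[of "int p" "i div int p"] by simp
    finally show ?thesis using pz by simp
  qed
  then have "?W \<subseteq> (\<lambda>i. add_pow R i \<one>) ` {0..<int p}"
  proof -
    assume eq: "\<And>i::int. add_pow R i \<one> = add_pow R (i mod int p) \<one>"
    show ?thesis
    proof (rule image_subsetI)
      fix i :: int
      have "i mod int p \<in> {0..<int p}" using assms(2) by auto
      then show "add_pow R i \<one> \<in> (\<lambda>i. add_pow R i \<one>) ` {0..<int p}"
        using eq[of i] by (metis imageI)
    qed
  qed
  then show "finite ?W" using finite_subset by blast
qed

text \<open>In characteristic zero, either some element is transcendental over the prime field, or the field is
  algebraic over the fraction field of the integers, where \<open>1 + 3 G\<close> is never a unit for \<open>G \<noteq> 0\<close>. In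
  characteristic \<open>p\<close>, a simple algebraic extension of the finite prime ring is finite.\<close>
theorem finitely_many_imp_absolutely_algebraic:
  assumes fin: "finite {S. maximal_subring S R}"
  shows "\<exists>p. absolutely_algebraic p (carrier R)"
proof (cases "inj (\<lambda>i::int. add_pow R i \<one>)")
  case True
  interpret h: ring_hom_ring \<Z> R "\<lambda>i. add_pow R i \<one>" by (rule int_embedding_hom)
  let ?W = "(\<lambda>i. add_pow R i \<one>) ` carrier \<Z>"
  have "subfield (generate_field R ?W) R" by (rule generate_field_is_subfield) auto
  then have "(algebraic over (generate_field R ?W)) x" if "x \<in> carrier R" for x
    using infinitely_many_of_transcendental[OF _ that] fin by (auto simp: over_def)
  moreover have "\<exists>t\<in>carrier \<Z>. \<one>\<^bsub>\<Z>\<^esub> \<oplus>\<^bsub>\<Z>\<^esub> t \<otimes>\<^bsub>\<Z>\<^esub> G \<notin> Units \<Z> \<union> {\<zero>\<^bsub>\<Z>\<^esub>}" if "G \<noteq> \<zero>\<^bsub>\<Z>\<^esub>" for G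
  proof (intro bexI[of _ 3])
    have "(1 + 3 * G) * k \<noteq> 1" for k
    proof
      assume "(1 + 3 * G) * k = 1"
      then have "\<bar>1 + 3 * G\<bar> = 1" by (metis abs_zmult_eq_1 abs_one)
      then show False using that by auto
    qed
    moreover have "1 + 3 * G \<noteq> 0" by presburger
    ultimately show "\<one>\<^bsub>\<Z>\<^esub> \<oplus>\<^bsub>\<Z>\<^esub> 3 \<otimes>\<^bsub>\<Z>\<^esub> G \<notin> Units \<Z> \<union> {\<zero>\<^bsub>\<Z>\<^esub>}"
      by (auto simp: Units_def mult.commute)
  qed auto
  ultimately have False
    using infinitely_many_maximal_subrings[OF int_principal_domain int_embedding_hom] True fin by auto
  then show ?thesis ..
next
  case False
  then obtain p :: nat where p: "Factorial_Ring.prime p" "add_pow R p \<one> = \<zero>" using prime_characteristic by auto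
  obtain W where W: "subring W R" "finite W"
    using finite_prime_subring[OF p(2)] p(1) prime_gt_0_nat by auto
  have Wf: "subfield W R" by (rule finite_subring_subfield[OF W])
  have "\<exists>n\<ge>1. x [^] (p ^ n) = x" if x: "x \<in> carrier R" for x
  proof -
    have "(algebraic over W) x" using infinitely_many_of_transcendental[OF Wf x] fin by (auto simp: over_def)
    then have "finite (simple_extension W x)" by (rule finite_simple_extension[OF Wf W(2) x])
    then show ?thesis
      using finite_subring_frobenius[OF p simple_extension_is_subring[OF W(1) x]]
        simple_extension_mem[OF W(1) x] by blast
  qed
  then show ?thesis using p by (auto simp: absolutely_algebraic_def)
qed

end

section \<open>Degrees over the prime field\<close>

text \<open>For \<open>x\<close> algebraic over the prime field of characteristic \<open>p\<close>, this is the degree of \<open>x\<close> over it: the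
  number of conjugates of \<open>x\<close> under Frobenius.\<close>
definition (in ring) frobenius_degree :: "nat \<Rightarrow> 'a \<Rightarrow> nat" where
  "frobenius_degree p x = (LEAST n. n \<ge> 1 \<and> x [^] (p ^ n) = x)"

definition (in ring) q_bounded :: "nat \<Rightarrow> 'a set \<Rightarrow> nat \<Rightarrow> nat \<Rightarrow> 'a set" where
  "q_bounded p K q f = {x \<in> K. multiplicity q (frobenius_degree p x) < f}"

text \<open>The primes that index the maximal subrings of \<open>K\<close>. As \<open>f\<close> is the largest exponent of \<open>q\<close> in a degree,
  it is also the largest bound for which \<open>q_bounded p K q f\<close> is not all of \<open>K\<close>.\<close>
definition (in ring) critical :: "nat \<Rightarrow> 'a set \<Rightarrow> nat \<Rightarrow> nat \<Rightarrow> bool" where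
  "critical p K q f \<longleftrightarrow> Factorial_Ring.prime q \<and> f > 0 \<and>
     (\<forall>y\<in>K. multiplicity q (frobenius_degree p y) \<le> f) \<and>
     (\<exists>y\<in>K. multiplicity q (frobenius_degree p y) = f)"

context field
begin

text \<open>A finite abelian group of exponent \<open>p\<close> has order a power of \<open>p\<close>, by Cauchy's theorem.\<close>
lemma card_finite_subring:
  assumes p: "Factorial_Ring.prime (p::nat)" "add_pow R p \<one> = \<zero>" and W: "subring W R" "finite W"
  shows "\<exists>m. card W = p ^ m"
proof -
  let ?G = "add_monoid (R\<lparr>carrier := W\<rparr>)"
  interpret W: ring "R\<lparr>carrier := W\<rparr>" using subring_is_ring[OF W(1)] .
  have ord: "order ?G = card W" by (simp add: order_def)
  have pos: "card W > 0" using W(2) subringE(2)[OF W(1)] by (auto simp: card_gt_0_iff)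
  have only_p: "r = p" if r: "Factorial_Ring.prime r" "r dvd card W" for r
  proof -
    obtain k where k: "card W = r ^ 1 * k" using r(2) by auto
    obtain H where H: "subgroup H ?G" "card H = r ^ 1"
      using sylow_thm[OF r(1) W.add.is_group, of 1 k] k ord W(2) by auto
    have HW: "H \<subseteq> W" using subgroup.subset[OF H(1)] by simp
    have "card H \<ge> 2" using H(2) prime_ge_2_nat[OF r(1)] by simp
    moreover have "card H \<le> 1" if "H \<subseteq> {\<zero>}" using card_mono[OF _ that] by simp
    ultimately obtain h where h: "h \<in> H" "h \<noteq> \<zero>" by fastforce
    have hc: "h \<in> carrier R" "h \<in> W" using h HW subringE(1)[OF W(1)] by auto
    have "group (?G\<lparr>carrier := H\<rparr>)" using W.add.subgroup_imp_group[OF H(1)] .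
    then have "h [^]\<^bsub>?G\<lparr>carrier := H\<rparr>\<^esub> card H = \<zero>"
      using group.pow_order_eq_1[of "?G\<lparr>carrier := H\<rparr>" h] h(1) by (simp add: order_def)
    then have rh: "add_pow R r h = \<zero>" using H(2) by (simp add: add_pow_def nat_pow_def)
    have ph: "add_pow R p h = \<zero>" by (rule char_smult[OF p hc(1)]) simp
    show "r = p"
    proof (rule ccontr)
      assume "r \<noteq> p"
      then have "coprime r p" using r(1) p(1) by (simp add: primes_coprime)
      then have "add.ord h dvd 1"
        using add.pow_eq_id[OF hc(1), of r] add.pow_eq_id[OF hc(1), of p] rh ph
          coprime_common_divisor[of r p "add.ord h"] by simp
      then show False using add.pow_eq_id[OF hc(1), of 1] h(2) hc by simp
    qed
  qed
  have "card W = prod_mset (prime_factorization (card W))"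
    using prod_mset_prime_factorization_nat[OF pos] by simp
  moreover have "set_mset (prime_factorization (card W)) \<subseteq> {p}"
    using only_p by (auto simp: prime_factors_dvd)
  ultimately show ?thesis
    by (metis prod_mset_replicate_mset set_mset_subset_singletonD)
qed

context
  fixes p :: nat and K :: "'a set"
  assumes K: "subfield K R" and absalg: "absolutely_algebraic p K"
begin

lemma absalgD:
  shows p_prime: "Factorial_Ring.prime p" and p_char: "add_pow R p \<one> = \<zero>"
    and ex_fixed: "x \<in> K \<Longrightarrow> \<exists>n\<ge>1. x [^] (p ^ n) = x"
  using absalg by (auto simp: absolutely_algebraic_def)

lemma K_carrier: "x \<in> K \<Longrightarrow> x \<in> carrier R" using subfieldE(3)[OF K] by auto

lemma degree_fixed:
  assumes "x \<in> K"
  shows "frobenius_degree p x \<ge> 1" "x [^] (p ^ frobenius_degree p x) = x"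
    and "\<And>n. \<lbrakk>n \<ge> 1; x [^] (p ^ n) = x\<rbrakk> \<Longrightarrow> frobenius_degree p x \<le> n"
  using LeastI_ex[of "\<lambda>n. n \<ge> 1 \<and> x [^] (p ^ n) = x"] ex_fixed[OF assms]
  unfolding frobenius_degree_def by (auto intro: Least_le)

lemma fixed_iff_degree_dvd:
  assumes x: "x \<in> K"
  shows "x [^] (p ^ n) = x \<longleftrightarrow> frobenius_degree p x dvd n"
proof -
  let ?d = "frobenius_degree p x"
  have xc: "x \<in> carrier R" using K_carrier[OF x] .
  have mult: "x [^] (p ^ (?d * k)) = x" for k
  proof (induct k)
    case (Suc k)
    have "x [^] (p ^ (?d * Suc k)) = (x [^] (p ^ ?d)) [^] (p ^ (?d * k))"
      using xc by (simp add: nat_pow_pow power_add)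
    then show ?case using Suc degree_fixed(2)[OF x] by simp
  qed (use xc in auto)
  show ?thesis
  proof
    assume n: "x [^] (p ^ n) = x"
    have "n = ?d * (n div ?d) + n mod ?d" by simp
    then have "x [^] (p ^ n) = (x [^] (p ^ (?d * (n div ?d)))) [^] (p ^ (n mod ?d))"
      using xc by (metis nat_pow_pow power_add)
    then have r: "x [^] (p ^ (n mod ?d)) = x" using n mult by simp
    have "n mod ?d < ?d" using degree_fixed(1)[OF x] by auto
    then have "n mod ?d = 0" using degree_fixed(3)[OF x _ r] by (cases "n mod ?d = 0") auto
    then show "?d dvd n" by auto
  qed (use mult in \<open>auto elim: dvdE\<close>)
qed

lemma fixed_subring: "subring {x \<in> carrier R. x [^] (p ^ n) = x} R"
  by (rule fixed_by_frobenius_subring[OF p_prime p_char])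

text \<open>Each element of \<open>K\<close> is a root of some \<open>X\<^sup>N - X\<close>.\<close>
lemma finite_subring_adjoin:
  assumes W: "subring W R" "finite W" and x: "x \<in> K"
  shows "finite (simple_extension W x)"
proof (rule finite_simple_extension[OF finite_subring_subfield[OF W] W(2)])
  show "x \<in> carrier R" using K_carrier[OF x] .
  have "p ^ frobenius_degree p x \<ge> 2"
  proof -
    have "p ^ 1 \<le> p ^ frobenius_degree p x"
      using degree_fixed(1)[OF x] prime_gt_0_nat[OF p_prime] by (intro power_increasing) auto
    then show ?thesis using prime_ge_2_nat[OF p_prime] by simp
  qed
  then show "(algebraic over W) x"
    by (rule algebraic_of_pow_eq[OF W(1) K_carrier[OF x] degree_fixed(2)[OF x]])
qed

lemma fixed_pow_pred:
  assumes "x \<in> carrier R" "x \<noteq> \<zero>"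
  shows "x [^] (p ^ n) = x \<longleftrightarrow> x [^] (p ^ n - 1) = \<one>"
proof -
  have "p ^ n = Suc (p ^ n - 1)" using prime_gt_0_nat[OF p_prime] by simp
  then have "x [^] (p ^ n) = x [^] (p ^ n - 1) \<otimes> x" by (metis nat_pow_Suc)
  then show ?thesis using assms
    by (metis l_one m_rcancel nat_pow_closed one_closed)
qed

text \<open>The nonzero elements of \<open>W\<close> are roots of unity, and a domain has few of them.\<close>
lemma fixed_card_bound:
  assumes W: "subring W R" "finite W" "\<And>x. x \<in> W \<Longrightarrow> x [^] (p ^ n) = x" "n \<ge> 1"
  shows "card W \<le> p ^ n"
proof -
  interpret W: domain "R\<lparr>carrier := W\<rparr>" using subring_is_domain[OF W(1)] .
  have N: "p ^ n - 1 \<noteq> 0" using one_less_power[of p n] prime_gt_1_nat[OF p_prime] W(4) by auto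
  have "card {x \<in> W. x [^]\<^bsub>R\<lparr>carrier := W\<rparr>\<^esub> (p ^ n - 1) = \<one>} \<le> p ^ n - 1"
    using W.num_roots_le_deg[OF _ N] W(2) by simp
  moreover have "x [^]\<^bsub>R\<lparr>carrier := W\<rparr>\<^esub> (p ^ n - 1) = x [^] (p ^ n - 1)" for x
    by (simp add: nat_pow_def)
  moreover have "W - {\<zero>} \<subseteq> {x \<in> W. x [^] (p ^ n - 1) = \<one>}"
    using W(3) fixed_pow_pred subringE(1)[OF W(1)] by auto
  ultimately have "card (W - {\<zero>}) \<le> p ^ n - 1"
    using card_mono[of "{x \<in> W. x [^] (p ^ n - 1) = \<one>}" "W - {\<zero>}"] W(2) by auto
  moreover have "p ^ n > 0" using prime_gt_0_nat[OF p_prime] by simp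
  moreover have "card W = Suc (card (W - {\<zero>}))" using card.remove[OF W(2) subringE(2)[OF W(1)]] .
  ultimately show ?thesis by linarith
qed

text \<open>If \<open>W\<close> has \<open>p\<^sup>m\<close> elements, its multiplicative group shows that all of them are fixed by the power
  \<open>m\<close> of Frobenius. A further fixed element would generate a finite ring with too many of them. The
  element \<open>\<theta>\<close> is a generator of the cyclic multiplicative group.\<close>
lemma finite_subring_structure:
  assumes W: "subring W R" "finite W" "W \<subseteq> K"
  obtains m \<theta> where "m \<ge> 1" "W = {x \<in> K. x [^] (p ^ m) = x}" "\<theta> \<in> W" "\<theta> \<noteq> \<zero>"
    "\<forall>i::nat. \<theta> [^] i = \<one> \<longleftrightarrow> p ^ m - 1 dvd i"
proof -
  obtain m where m: "card W = p ^ m" using card_finite_subring[OF p_prime p_char W(1,2)] by auto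
  let ?W = "R\<lparr>carrier := W\<rparr>"
  interpret W: field ?W using subfield_iff(2)[OF finite_subring_subfield[OF W(1,2)]] .
  interpret G: group "Multiplicative_Group.mult_of ?W" by (rule W.field_mult_group)
  have pow: "x [^]\<^bsub>Multiplicative_Group.mult_of ?W\<^esub> n = x [^] n" for x and n :: nat
    by (simp add: nat_pow_def)
  have Wc: "x \<in> carrier R" if "x \<in> W" for x using that subringE(1)[OF W(1)] by auto
  have order: "order (Multiplicative_Group.mult_of ?W) = p ^ m - 1"
    using W.order_mult_of W(2) m by (simp add: order_def)
  have card2: "2 \<le> card W"
  proof -
    have "{\<zero>, \<one>} \<subseteq> W" using subringE(2,3)[OF W(1)] by auto
    then have "card {\<zero>, \<one>} \<le> card W" using W(2) card_mono by blast
    then show ?thesis by simp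
  qed
  then have m1: "m \<ge> 1" using m by (cases m) auto
  have fixed: "x [^] (p ^ m) = x" if "x \<in> W" for x
  proof (cases "x = \<zero>")
    case True
    then show ?thesis using prime_gt_0_nat[OF p_prime] by (simp add: nat_pow_zero)
  next
    case False
    then have "x [^] (p ^ m - 1) = \<one>" using G.pow_order_eq_1[of x] that order pow by simp
    then show ?thesis using fixed_pow_pred[OF Wc[OF that] False] by simp
  qed
  have eq: "W = {x \<in> K. x [^] (p ^ m) = x}"
  proof (intro equalityI subsetI)
    fix z assume z: "z \<in> {x \<in> K. x [^] (p ^ m) = x}"
    let ?V = "simple_extension W z"
    have zc: "z \<in> carrier R" using z K_carrier by auto
    have V: "subring ?V R" "finite ?V" "W \<subseteq> ?V" "z \<in> ?V"
      using simple_extension_is_subring[OF W(1) zc] finite_subring_adjoin[OF W(1,2)] z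
        simple_extension_incl[OF subringE(1)[OF W(1)] zc] simple_extension_mem[OF W(1) zc] by auto
    have "?V \<subseteq> {x \<in> carrier R. x [^] (p ^ m) = x}"
      by (rule simple_extension_subring_incl[OF fixed_subring]) (use fixed Wc z zc in auto)
    then have "card ?V \<le> p ^ m" using fixed_card_bound[OF V(1,2) _ m1] by auto
    then have "?V = W" using V(2,3) m by (metis card_seteq)
    then show "z \<in> W" using V(4) by auto
  qed (use W(3) fixed in auto)
  obtain \<theta> where \<theta>: "\<theta> \<in> carrier (Multiplicative_Group.mult_of ?W)" "carrier (Multiplicative_Group.mult_of ?W) = {\<theta> [^]\<^bsub>?W\<^esub> i |i::nat. i \<in> UNIV}"
    using W.finite_field_mult_group_has_gen W(2) by auto
  have \<theta>W: "\<theta> \<in> W" "\<theta> \<noteq> \<zero>" using \<theta>(1) by auto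
  have powW: "x [^]\<^bsub>?W\<^esub> n = x [^] n" for x and n :: nat by (simp add: nat_pow_def)
  have gen: "W - {\<zero>} = {\<theta> [^] i |i::nat. i \<in> UNIV}" using \<theta>(2) powW by simp
  have "G.ord \<theta> = order (Multiplicative_Group.mult_of ?W)"
  proof -
    have "generate (Multiplicative_Group.mult_of ?W) {\<theta>} = carrier (Multiplicative_Group.mult_of ?W)"
    proof -
      have "finite (carrier (Multiplicative_Group.mult_of ?W))" using W(2) by simp
      from G.generate_pow_on_finite_carrier[OF this \<theta>(1)] show ?thesis using gen pow by auto
    qed
    then show ?thesis using G.generate_pow_card[OF \<theta>(1)] by (simp add: order_def)
  qed
  then have "\<forall>i::nat. \<theta> [^] i = \<one> \<longleftrightarrow> p ^ m - 1 dvd i"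
    using G.pow_eq_id[OF \<theta>(1)] order pow by simp
  then show ?thesis by (rule that[OF m1 eq \<theta>W])
qed

text \<open>The least \<open>k\<close> for which \<open>p\<^sup>d - 1\<close> divides \<open>p\<^sup>k - 1\<close> is \<open>d\<close>.\<close>
lemma order_imp_degree:
  assumes z: "z \<in> K" "z \<noteq> \<zero>" and d: "d \<ge> 1" "\<And>i::nat. z [^] i = \<one> \<longleftrightarrow> p ^ d - 1 dvd i"
  shows "frobenius_degree p z = d"
proof (rule antisym)
  have zc: "z \<in> carrier R" using K_carrier[OF z(1)] .
  have *: "z [^] (p ^ k) = z \<longleftrightarrow> p ^ d - 1 dvd p ^ k - 1" for k
    using fixed_pow_pred[OF zc z(2)] d(2) by simp
  show "frobenius_degree p z \<le> d" by (rule degree_fixed(3)[OF z(1) d(1)]) (simp add: *)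
  let ?k = "frobenius_degree p z"
  have k: "?k \<ge> 1" "p ^ d - 1 dvd p ^ ?k - 1" using degree_fixed[OF z(1)] * by auto
  have "p ^ ?k - 1 > 0" using one_less_power[of p ?k] prime_gt_1_nat[OF p_prime] k(1) by auto
  then have "p ^ d - 1 \<le> p ^ ?k - 1" using k(2) dvd_imp_le by blast
  then have "p ^ d \<le> p ^ ?k" using \<open>p ^ ?k - 1 > 0\<close> by linarith
  then show "d \<le> ?k" using power_le_imp_le_exp[OF prime_gt_1_nat[OF p_prime]] by blast
qed

text \<open>The subring generated by \<open>x\<close> and \<open>y\<close>, built over the smallest subring of \<open>R\<close>, is finite.\<close>
lemma subring_contains_finite:
  assumes M: "subring M R" "M \<subseteq> K" and x: "x \<in> M" "y \<in> M"
  obtains W where "subring W R" "finite W" "W \<subseteq> M" "x \<in> W" "y \<in> W"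
    "\<And>T. \<lbrakk>subring T R; x \<in> T; y \<in> T\<rbrakk> \<Longrightarrow> W \<subseteq> T"
proof -
  obtain W0 where "subring W0 R" "finite W0"
    using finite_prime_subring[OF p_char] prime_gt_0_nat[OF p_prime] by auto
  define P where "P = \<Inter>{S. subring S R}"
  have P: "subring P R" unfolding P_def by (rule subring_Inter) (use carrier_is_subring in auto)
  have PT: "P \<subseteq> T" if "subring T R" for T using that by (auto simp: P_def)
  have Pf: "finite P" using finite_subset[OF PT] \<open>subring W0 R\<close> \<open>finite W0\<close> by blast
  have K: "x \<in> K" "y \<in> K" using x M by auto
  have c: "x \<in> carrier R" "y \<in> carrier R" using K K_carrier by auto
  let ?V = "simple_extension P x" let ?W = "simple_extension ?V y"
  have V: "subring ?V R" "finite ?V" "x \<in> ?V"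
    using simple_extension_is_subring[OF P c(1)] finite_subring_adjoin[OF P Pf K(1)]
      simple_extension_mem[OF P c(1)] by auto
  have W: "subring ?W R" "finite ?W" "y \<in> ?W" "?V \<subseteq> ?W"
    using simple_extension_is_subring[OF V(1) c(2)] finite_subring_adjoin[OF V(1,2) K(2)]
      simple_extension_mem[OF V(1) c(2)] simple_extension_incl[OF subringE(1)[OF V(1)] c(2)] by auto
  have min: "?W \<subseteq> T" if "subring T R" "x \<in> T" "y \<in> T" for T
    using simple_extension_subring_incl[OF that(1) simple_extension_subring_incl[OF that(1) PT[OF that(1)] that(2)] that(3)] .
  show ?thesis by (rule that[OF W(1,2) min[OF M(1) x] _ W(3) min]) (use V W in auto)
qed

text \<open>All statements concern the finite field generated by \<open>x\<close> and \<open>y\<close>. It is the fixed ring of the power \<open>l\<close>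
  of Frobenius, where \<open>l\<close> is the least common multiple of the two degrees, and a suitable power of a
  generator of its multiplicative group has any given degree dividing \<open>l\<close>.\<close>
lemma lcm_degree:
  assumes M: "subring M R" "M \<subseteq> K" and x: "x \<in> M" "y \<in> M"
  defines "l \<equiv> lcm (frobenius_degree p x) (frobenius_degree p y)"
  shows "\<And>z. \<lbrakk>z \<in> K; frobenius_degree p z dvd l\<rbrakk> \<Longrightarrow> z \<in> M"
    "\<exists>\<theta>\<in>M. frobenius_degree p \<theta> = l"
    "frobenius_degree p (x \<oplus> y) dvd l" "frobenius_degree p (x \<otimes> y) dvd l"
    "\<And>d. d dvd l \<Longrightarrow> \<exists>\<theta>\<in>M. frobenius_degree p \<theta> = d"
proof -
  obtain W where W: "subring W R" "finite W" "W \<subseteq> M" "x \<in> W" "y \<in> W"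
    "\<And>T. \<lbrakk>subring T R; x \<in> T; y \<in> T\<rbrakk> \<Longrightarrow> W \<subseteq> T"
    using subring_contains_finite[OF M x] by blast
  have WK: "W \<subseteq> K" using W(3) M(2) by auto
  obtain m \<theta> where m: "m \<ge> 1" "W = {x \<in> K. x [^] (p ^ m) = x}" and \<theta>: "\<theta> \<in> W" "\<theta> \<noteq> \<zero>"
    "\<forall>i::nat. \<theta> [^] i = \<one> \<longleftrightarrow> p ^ m - 1 dvd i"
    using finite_subring_structure[OF W(1,2) WK] by blast
  have xy: "x \<in> K" "y \<in> K" "\<theta> \<in> K" using W \<theta> WK by auto
  have W_iff: "z \<in> W \<longleftrightarrow> frobenius_degree p z dvd m" if "z \<in> K" for z
    using m(2) fixed_iff_degree_dvd[OF that] that by auto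
  have \<theta>m: "frobenius_degree p \<theta> = m" by (rule order_imp_degree[OF xy(3) \<theta>(2) m(1)]) (use \<theta>(3) in blast)
  have lm: "l dvd m" unfolding l_def using W_iff xy W(4,5) by simp
  have "W \<subseteq> {x \<in> carrier R. x [^] (p ^ l) = x}"
  proof (rule W(6)[OF fixed_subring])
    show "x \<in> {x \<in> carrier R. x [^] (p ^ l) = x}" "y \<in> {x \<in> carrier R. x [^] (p ^ l) = x}"
      using fixed_iff_degree_dvd xy K_carrier by (auto simp: l_def)
  qed
  then have "\<theta> [^] (p ^ l) = \<theta>" using \<theta>(1) by auto
  then have "m dvd l" using fixed_iff_degree_dvd[OF xy(3)] \<theta>m by simp
  then have ml: "m = l" using lm by (simp add: dvd_antisym)
  show "z \<in> M" if "z \<in> K" "frobenius_degree p z dvd l" for z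
    using W_iff[OF that(1)] that(2) ml W(3) by auto
  show "\<exists>\<theta>\<in>M. frobenius_degree p \<theta> = l" using \<theta>m ml \<theta>(1) W(3) by auto
  have "x \<oplus> y \<in> W" "x \<otimes> y \<in> W"
    using subringE(6,7)[OF W(1)] W(4,5) by auto
  then show "frobenius_degree p (x \<oplus> y) dvd l" "frobenius_degree p (x \<otimes> y) dvd l"
    using W_iff WK ml by auto
  fix d assume d: "d dvd l"
  then have d1: "d \<ge> 1" using m(1) ml by (cases "d = 0") auto
  have gt: "p ^ n - 1 > 0" if "n \<ge> 1" for n
    using one_less_power[of p n] prime_gt_1_nat[OF p_prime] that by auto
  obtain e where e: "m = d * e" using d ml by auto
  have "p ^ d - 1 dvd p ^ m - 1"
  proof -
    have "int (p ^ d) - 1 dvd int (p ^ d) ^ e - 1" unfolding power_diff_1_eq by simp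
    then have "int (p ^ d - 1) dvd int (p ^ m - 1)"
      using prime_gt_0_nat[OF p_prime] by (simp add: of_nat_diff e power_mult)
    then show ?thesis by (simp only: int_dvd_int_iff)
  qed
  then obtain k where k: "p ^ m - 1 = (p ^ d - 1) * k" by auto
  then have k0: "k > 0" using gt[OF m(1)] by (cases k) auto
  have \<theta>c: "\<theta> \<in> carrier R" using K_carrier[OF xy(3)] .
  have \<zeta>: "\<theta> [^] k \<in> W" "\<theta> [^] k \<noteq> \<zero>" using subring_pow[OF W(1) \<theta>(1)] nat_pow_nonzero[OF \<theta>c \<theta>(2)] by auto
  have "frobenius_degree p (\<theta> [^] k) = d"
  proof (rule order_imp_degree[OF _ \<zeta>(2) d1])
    show "\<theta> [^] k \<in> K" using \<zeta> WK by auto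
    fix i :: nat
    have "(\<theta> [^] k) [^] i = \<one> \<longleftrightarrow> (p ^ d - 1) * k dvd i * k"
      using \<theta>c \<theta>(3)[rule_format, of "k * i"] k by (simp add: nat_pow_pow mult.commute)
    then show "(\<theta> [^] k) [^] i = \<one> \<longleftrightarrow> p ^ d - 1 dvd i" using k0 by simp
  qed
  then show "\<exists>\<theta>\<in>M. frobenius_degree p \<theta> = d" using \<zeta>(1) W(3) by auto
qed

lemma degree_dvd_mem:
  "\<lbrakk>subring M R; M \<subseteq> K; x \<in> M; z \<in> K; frobenius_degree p z dvd frobenius_degree p x\<rbrakk> \<Longrightarrow> z \<in> M"
  using lcm_degree(1)[of M x x z] by auto

lemma degree_dvd_realized:
  "\<lbrakk>subring M R; M \<subseteq> K; x \<in> M; d dvd frobenius_degree p x\<rbrakk> \<Longrightarrow> \<exists>\<theta>\<in>M. frobenius_degree p \<theta> = d"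
  using lcm_degree(5)[of M x x d] by auto

lemma degree_pos: "x \<in> K \<Longrightarrow> frobenius_degree p x \<noteq> 0" using degree_fixed(1) by force

section \<open>Maximal subrings of an algebraic extension of a finite prime field\<close>

text \<open>The exponent of \<open>q\<close> in a least common multiple is the larger of the two exponents.\<close>
lemma q_bounded_subring:
  assumes q: "Factorial_Ring.prime q" and f: "f > 0"
  shows "subring (q_bounded p K q f) R"
proof -
  note K' = subfieldE(1)[OF K]
  have le: "multiplicity q (frobenius_degree p z) < f"
    if "x \<in> q_bounded p K q f" "y \<in> q_bounded p K q f" "z \<in> K"
      "frobenius_degree p z dvd lcm (frobenius_degree p x) (frobenius_degree p y)" for x y z
  proof -
    let ?d = "frobenius_degree p"
    have xy: "x \<in> K" "y \<in> K" using that by (auto simp: q_bounded_def)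
    have "lcm (?d x) (?d y) \<noteq> 0" using degree_pos xy by (simp add: lcm_eq_0_iff)
    then have "multiplicity q (?d z) \<le> multiplicity q (lcm (?d x) (?d y))"
      using dvd_imp_multiplicity_le that(4) by blast
    also have "\<dots> = max (multiplicity q (?d x)) (multiplicity q (?d y))"
      using multiplicity_lcm[OF degree_pos[OF xy(1)] degree_pos[OF xy(2)] q] .
    finally show ?thesis using that by (auto simp: q_bounded_def)
  qed
  have one: "\<one> \<in> K" using subringE(3)[OF K'] .
  have "frobenius_degree p \<one> dvd 1" using fixed_iff_degree_dvd[OF one, of 1] by simp
  then have one_q: "\<one> \<in> q_bounded p K q f" using one f by (simp add: q_bounded_def)
  show ?thesis
  proof (rule subringI)
    show "q_bounded p K q f \<subseteq> carrier R" using K_carrier by (auto simp: q_bounded_def)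
    show "\<one> \<in> q_bounded p K q f" by (rule one_q)
    show "h1 \<otimes> h2 \<in> q_bounded p K q f" "h1 \<oplus> h2 \<in> q_bounded p K q f"
      if "h1 \<in> q_bounded p K q f" "h2 \<in> q_bounded p K q f" for h1 h2
    proof -
      have "h1 \<in> K" "h2 \<in> K" using that by (auto simp: q_bounded_def)
      then show "h1 \<otimes> h2 \<in> q_bounded p K q f" "h1 \<oplus> h2 \<in> q_bounded p K q f"
        using le[OF that] lcm_degree(3,4)[OF K'] subringE(6,7)[OF K'] by (auto simp: q_bounded_def)
    qed
    show "\<ominus> h \<in> q_bounded p K q f" if h: "h \<in> q_bounded p K q f" for h
    proof -
      have hK: "h \<in> K" "\<ominus> h \<in> K" using h subringE(5)[OF K'] by (auto simp: q_bounded_def)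
      have "h [^] (p ^ frobenius_degree p h) = h" by (rule degree_fixed(2)[OF hK(1)])
      then have "\<ominus> h \<in> {x \<in> carrier R. x [^] (p ^ frobenius_degree p h) = x}"
        using subringE(5)[OF fixed_subring, of h "frobenius_degree p h"] K_carrier[OF hK(1)] by auto
      then have "frobenius_degree p (\<ominus> h) dvd frobenius_degree p h"
        using fixed_iff_degree_dvd[OF hK(2)] by auto
      then show ?thesis using le[OF h h hK(2)] hK by (auto simp: q_bounded_def)
    qed
  qed
qed

lemma critical_unique: "\<lbrakk>critical p K q f; critical p K q f'\<rbrakk> \<Longrightarrow> f = f'"
  by (metis critical_def le_antisym)

text \<open>A larger subring contains an element \<open>y\<close> whose degree has the full power of \<open>q\<close>. The degree of any \<open>z\<close>
  is a power of \<open>q\<close> dividing the degree of \<open>y\<close>, times a factor prime to \<open>q\<close>, which is the degree of an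
  element of \<open>q_bounded p K q f\<close>.\<close>
lemma q_bounded_maximal:
  assumes c: "critical p K q f"
  shows "maximal_subring (q_bounded p K q f) (R\<lparr>carrier := K\<rparr>)"
  unfolding maximal_subring_restrict[OF subfieldE(1)[OF K]]
proof (intro conjI allI impI)
  let ?d = "frobenius_degree p"
  have q: "Factorial_Ring.prime q" "f > 0" and max: "\<And>y. y \<in> K \<Longrightarrow> multiplicity q (?d y) \<le> f"
    using c by (auto simp: critical_def)
  show "subring (q_bounded p K q f) R" by (rule q_bounded_subring[OF q])
  show "q_bounded p K q f \<subset> K" 
  proof -
    obtain y where "y \<in> K" "multiplicity q (?d y) = f" using c by (auto simp: critical_def)
    then have "y \<notin> q_bounded p K q f" by (simp add: q_bounded_def)
    then show ?thesis using \<open>y \<in> K\<close> by (auto simp: q_bounded_def)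
  qed
  fix T assume T: "subring T R \<and> T \<subset> K \<and> q_bounded p K q f \<subseteq> T"
  show "T = q_bounded p K q f"
  proof (rule ccontr)
    assume "T \<noteq> q_bounded p K q f"
    then obtain y where y: "y \<in> T" "y \<in> K" "multiplicity q (?d y) \<ge> f"
      using T by (force simp: q_bounded_def)
    have "K \<subseteq> T"
    proof
      fix z assume z: "z \<in> K"
      obtain b where b: "?d z = q ^ multiplicity q (?d z) * b" "\<not> q dvd b"
        using multiplicity_decompose'[OF degree_pos[OF z], of q] prime_nat_not_dvd q(1)
        by (metis not_prime_unit)
      obtain \<zeta> where \<zeta>: "\<zeta> \<in> K" "?d \<zeta> = b"
        using degree_dvd_realized[OF subfieldE(1)[OF K] subset_refl z, of b] b(1) by (metis dvd_triv_right)
      have "multiplicity q b = 0" using b(2) by (rule not_dvd_imp_multiplicity_0)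
      then have "\<zeta> \<in> T" using \<zeta> q(2) T by (auto simp: q_bounded_def)
      moreover have "?d z dvd lcm (?d y) (?d \<zeta>)"
      proof -
        have "q ^ multiplicity q (?d z) dvd ?d y"
          using max[OF z] y(3) by (meson le_trans multiplicity_dvd')
        then have "q ^ multiplicity q (?d z) dvd lcm (?d y) b" by (meson dvd_lcm1 dvd_trans)
        moreover have "b dvd lcm (?d y) b" by simp
        moreover have "coprime (q ^ multiplicity q (?d z)) b"
          using b(2) q(1) prime_imp_coprime by (auto intro: coprime_power_left_iff[THEN iffD2])
        ultimately have "q ^ multiplicity q (?d z) * b dvd lcm (?d y) b" by (rule semiring_gcd_class.divides_mult)
        then show ?thesis using b(1) \<zeta>(2) by simp
      qed
      ultimately show "z \<in> T" using lcm_degree(1)[of T y \<zeta> z] T y z by auto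
    qed
    then show False using T by auto
  qed
qed

text \<open>For \<open>y\<close> outside \<open>S\<close>, the degree of \<open>y\<close> contains some prime power \<open>q\<^sup>f\<close> dividing no degree of \<open>S\<close>; otherwise
  it would divide a least common multiple of degrees of \<open>S\<close>. So \<open>S\<close> lies in a subring of the form
  \<open>q_bounded p K q g\<close>, for \<open>g = f\<close> as well as for any larger \<open>g\<close> that occurs, and maximality leaves room for
  one \<open>g\<close> only.\<close>
lemma maximal_subring_q_bounded:
  assumes S: "maximal_subring S (R\<lparr>carrier := K\<rparr>)"
  shows "\<exists>q f. critical p K q f \<and> S = q_bounded p K q f"
proof -
  let ?d = "frobenius_degree p"
  have S: "subring S R" "S \<subset> K" and max: "\<And>T. \<lbrakk>subring T R; T \<subset> K; S \<subseteq> T\<rbrakk> \<Longrightarrow> T = S"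
    using S unfolding maximal_subring_restrict[OF subfieldE(1)[OF K]] by auto
  obtain y where y: "y \<in> K" "y \<notin> S" using S by auto
  have "\<exists>q. Factorial_Ring.prime q \<and> (\<forall>x\<in>S. multiplicity q (?d x) < multiplicity q (?d y))"
  proof (rule ccontr)
    assume n: "\<not> ?thesis"
    have "\<exists>z\<in>S. \<forall>q\<in>P. multiplicity q (?d y) \<le> multiplicity q (?d z)"
      if "finite P" "\<forall>q\<in>P. Factorial_Ring.prime q" for P
      using that
    proof (induct P rule: finite_induct)
      case empty
      then show ?case using subringE(3)[OF S(1)] by auto
    next
      case (insert q P)
      then obtain z where z: "z \<in> S" "\<forall>q\<in>P. multiplicity q (?d y) \<le> multiplicity q (?d z)" by auto
      obtain x where x: "x \<in> S" "multiplicity q (?d y) \<le> multiplicity q (?d x)"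
        using n insert(4) by (auto simp: not_less)
      obtain w where w: "w \<in> S" "?d w = lcm (?d z) (?d x)"
        using lcm_degree(2)[OF S(1) _ z(1) x(1)] S(2) by auto
      have "z \<in> K" "x \<in> K" using z(1) x(1) S(2) by auto
      then have "lcm (?d z) (?d x) \<noteq> 0" using degree_pos by (simp add: lcm_eq_0_iff)
      then have "multiplicity r (?d z) \<le> multiplicity r (?d w)" "multiplicity r (?d x) \<le> multiplicity r (?d w)" for r
        using w(2) by (simp_all add: dvd_imp_multiplicity_le)
      then have "\<forall>r\<in>insert q P. multiplicity r (?d y) \<le> multiplicity r (?d w)"
        using z(2) x(2) le_trans by blast
      then show ?case using w(1) by blast
    qed
    from this[of "prime_factors (?d y)"] obtain z where
      z: "z \<in> S" "\<forall>q\<in>prime_factors (?d y). multiplicity q (?d y) \<le> multiplicity q (?d z)"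
      by auto
    have "?d y dvd ?d z"
    proof (rule multiplicity_le_imp_dvd)
      show "?d y \<noteq> 0" using degree_pos[OF y(1)] .
      show "multiplicity q (?d y) \<le> multiplicity q (?d z)" if "Factorial_Ring.prime q" for q
        using z(2) that by (cases "q \<in> prime_factors (?d y)")
          (auto simp: prime_factors_multiplicity)
    qed
    then have "y \<in> S" using degree_dvd_mem[OF S(1) _ z(1) y(1)] S(2) by auto
    then show False using y by auto
  qed
  then obtain q where q: "Factorial_Ring.prime q" "\<And>x. x \<in> S \<Longrightarrow> multiplicity q (?d x) < multiplicity q (?d y)"
    by auto
  let ?f = "multiplicity q (?d y)"
  have f: "?f > 0" using q(2)[OF subringE(3)[OF S(1)]] by auto
  have Seq: "q_bounded p K q g = S" if "g \<ge> ?f" "\<exists>x\<in>K. multiplicity q (?d x) \<ge> g" for g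
  proof (rule max)
    show "subring (q_bounded p K q g) R" by (rule q_bounded_subring[OF q(1)]) (use f that in auto)
    show "q_bounded p K q g \<subset> K" using that(2) by (force simp: q_bounded_def)
    show "S \<subseteq> q_bounded p K q g" using q(2) that(1) S(2) by (force simp: q_bounded_def)
  qed
  have "multiplicity q (?d x) \<le> ?f" if x: "x \<in> K" for x
  proof (rule ccontr)
    assume "\<not> ?thesis"
    then have lt: "?f < multiplicity q (?d x)" by simp
    then have "q_bounded p K q (multiplicity q (?d x)) = S" by (intro Seq) (use x in auto)
    moreover have "y \<in> q_bounded p K q (multiplicity q (?d x))" using lt y(1) by (simp add: q_bounded_def)
    ultimately show False using y(2) by auto
  qed
  then have "critical p K q ?f" using q(1) f y(1) by (auto simp: critical_def)
  then show ?thesis using Seq[of ?f] y(1) by blast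
qed

theorem finitely_many_iff_critical:
  "finite {S. maximal_subring S (R\<lparr>carrier := K\<rparr>)} \<longleftrightarrow> finite {q. \<exists>f. critical p K q f}"
proof -
  let ?d = "frobenius_degree p"
  define M where "M q = q_bounded p K q (THE f. critical p K q f)" for q
  have M: "M q = q_bounded p K q f" if "critical p K q f" for q f
    unfolding M_def using that critical_unique by (metis the_equality)
  have "{S. maximal_subring S (R\<lparr>carrier := K\<rparr>)} = M ` {q. \<exists>f. critical p K q f}"
  proof (intro equalityI subsetI)
    fix S assume "S \<in> {S. maximal_subring S (R\<lparr>carrier := K\<rparr>)}"
    then obtain q f where "critical p K q f" "S = q_bounded p K q f"
      using maximal_subring_q_bounded by blast
    then show "S \<in> M ` {q. \<exists>f. critical p K q f}" using M by auto
  next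
    fix S assume "S \<in> M ` {q. \<exists>f. critical p K q f}"
    then obtain q f where "critical p K q f" "S = M q" by auto
    then show "S \<in> {S. maximal_subring S (R\<lparr>carrier := K\<rparr>)}" using M q_bounded_maximal by auto
  qed
  moreover have "inj_on M {q. \<exists>f. critical p K q f}"
  proof (rule inj_onI)
    fix q q' assume "q \<in> {q. \<exists>f. critical p K q f}" "q' \<in> {q. \<exists>f. critical p K q f}" and eq: "M q = M q'"
    then obtain f f' where f: "critical p K q f" "critical p K q' f'" by auto
    show "q = q'"
    proof (rule ccontr)
      assume ne: "q \<noteq> q'"
      obtain y where y: "y \<in> K" "multiplicity q (?d y) = f" using f(1) by (auto simp: critical_def)
      then obtain \<zeta> where z: "\<zeta> \<in> K" "?d \<zeta> = q ^ f"
        using degree_dvd_realized[OF subfieldE(1)[OF K] subset_refl y(1), of "q ^ f"] multiplicity_dvd by blast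
      have pq: "Factorial_Ring.prime q" "Factorial_Ring.prime q'" "f' > 0" using f by (auto simp: critical_def)
      then have "multiplicity q' (q ^ f) = 0" "multiplicity q (q ^ f) = f"
        using ne by (simp_all add: multiplicity_distinct_prime_power)
      then have "\<zeta> \<in> M q'" "\<zeta> \<notin> M q" using M[OF f(1)] M[OF f(2)] z pq by (auto simp: q_bounded_def)
      then show False using eq by simp
    qed
  qed
  ultimately show ?thesis by (simp add: finite_image_iff)
qed

end

text \<open>Let \<open>d\<close> be the least common multiple of the degrees of the adjoined elements. Every degree in the larger
  field divides \<open>lcm m d\<close> for some degree \<open>m\<close> in \<open>F\<close>, so the critical primes of the two fields can differ
  only at divisors of \<open>d\<close>.\<close>
theorem finitely_many_iff_of_finite_extension:
  assumes F: "subfield F R" and A: "finite A" "A \<subseteq> carrier R"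
    and abs: "absolutely_algebraic p (generate_field R (F \<union> A))"
  shows "finite {S. maximal_subring S (R\<lparr>carrier := F\<rparr>)} \<longleftrightarrow>
         finite {S. maximal_subring S (R\<lparr>carrier := generate_field R (F \<union> A)\<rparr>)}"
proof -
  let ?K = "generate_field R (F \<union> A)" and ?d = "frobenius_degree p"
  have FA: "F \<union> A \<subseteq> carrier R" using subfieldE(3)[OF F] A by auto
  have K: "subfield ?K R" by (rule generate_field_is_subfield[OF FA])
  have FK: "F \<subseteq> ?K" "A \<subseteq> ?K" by (auto intro: generate_field.incl)
  have absF: "absolutely_algebraic p F" using abs FK by (auto simp: absolutely_algebraic_def)
  note p = absalgD(1,2)[OF K abs]
  note iff = fixed_iff_degree_dvd[OF K abs]
  note pos = degree_pos[OF K abs]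
  define d where "d = Lcm (?d ` A)"
  have "0 \<notin> ?d ` A" using FK(2) pos by (metis imageE subsetD)
  then have d0: "d \<noteq> 0" unfolding d_def using A(1) by (simp add: Lcm_0_iff)
  define L where "L = {x \<in> ?K. \<exists>m\<in>F. ?d x dvd lcm (?d m) d}"
  have L: "subring L R"
  proof -
    have mem: "z \<in> L" if z: "z \<in> ?K" and xy: "x \<in> L" "y \<in> L"
      and cl: "\<And>n. \<lbrakk>x [^] (p ^ n) = x; y [^] (p ^ n) = y\<rbrakk> \<Longrightarrow> z [^] (p ^ n) = z" for x y z
    proof -
      obtain m1 m2 where m: "m1 \<in> F" "m2 \<in> F" "?d x dvd lcm (?d m1) d" "?d y dvd lcm (?d m2) d"
        using xy by (auto simp: L_def)
      obtain m where m': "m \<in> F" "?d m = lcm (?d m1) (?d m2)"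
        using lcm_degree(2)[OF F absF subfieldE(1)[OF F] subset_refl m(1,2)] by auto
      have "?d x dvd lcm (?d m) d" "?d y dvd lcm (?d m) d"
        using m m'(2) by (metis dvd_lcm1 dvd_lcm2 dvd_trans lcm_least)+
      then have "?d z dvd lcm (?d m) d" using cl iff xy z by (simp add: L_def)
      then show ?thesis using z m'(1) by (auto simp: L_def)
    qed
    note K' = subfieldE(1)[OF K]
    show ?thesis
    proof (rule subringI)
      show "L \<subseteq> carrier R" using subfieldE(3)[OF K] by (auto simp: L_def)
      show one: "\<one> \<in> L" using subringE(3)[OF subfieldE(1)[OF F]] subringE(3)[OF K']
        iff[of \<one> 1] by (auto simp: L_def intro!: bexI[of _ \<one>])
      fix h assume h: "h \<in> L"
      have hK: "h \<in> ?K" "h \<in> carrier R" using h subfieldE(3)[OF K] by (auto simp: L_def)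
      show "\<ominus> h \<in> L"
      proof (rule mem[OF _ h h])
        show "\<ominus> h \<in> ?K" using subringE(5)[OF K' hK(1)] .
        show "(\<ominus> h) [^] (p ^ n) = \<ominus> h" if "h [^] (p ^ n) = h" for n
          using subringE(5)[OF fixed_by_frobenius_subring[OF p], of h n] that hK by auto
      qed
      fix g assume g: "g \<in> L"
      have gK: "g \<in> ?K" "g \<in> carrier R" using g subfieldE(3)[OF K] by (auto simp: L_def)
      show "h \<otimes> g \<in> L" "h \<oplus> g \<in> L"
        by (rule mem[OF _ h g]; use hK gK subringE(6,7)[OF K'] in
            \<open>auto simp: frobenius_power_add[OF p] nat_pow_distrib\<close>)+
    qed
  qed
  have LF: "subfield L R"
  proof (rule subfieldI'[OF L])
    fix k assume "k \<in> L - {\<zero>}"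
    then have k: "k \<in> L" "k \<noteq> \<zero>" "k \<in> ?K" "k \<in> carrier R" using subringE(1)[OF L] by (auto simp: L_def)
    have "inv k \<in> ?K" using subfield_m_inv(1)[OF K] k by auto
    moreover have "inv k [^] (p ^ ?d k) = inv k"
    proof -
      have "inv k [^] (p ^ ?d k) \<otimes> k = (inv k \<otimes> k) [^] (p ^ ?d k)"
        using degree_fixed(2)[OF K abs k(3)] inv_props(1)[OF k(4,2)] k(4) by (simp add: nat_pow_distrib)
      then show ?thesis using inv_props[OF k(4,2)] k(4) by (metis inv_char m_comm nat_pow_closed nat_pow_one)
    qed
    ultimately have "?d (inv k) dvd ?d k" using iff by simp
    then show "inv k \<in> L" using k(1) \<open>inv k \<in> ?K\<close> by (auto simp: L_def intro: dvd_trans)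
  qed
  have "?K \<subseteq> L"
  proof (rule generate_field_min_subfield1[OF FA LF], rule Un_least)
    show "F \<subseteq> L" using FK by (auto simp: L_def)
    show "A \<subseteq> L" using FK subringE(3)[OF subfieldE(1)[OF F]] dvd_Lcm[of _ "?d ` A"]
      by (auto simp: L_def d_def intro!: bexI[of _ \<one>] intro: dvd_trans[OF _ dvd_lcm2])
  qed
  then have KL: "\<exists>m\<in>F. ?d x dvd lcm (?d m) d" if "x \<in> ?K" for x using that by (auto simp: L_def)
  have mult: "\<exists>m\<in>F. multiplicity q (?d x) \<le> multiplicity q (?d m)"
    if q: "Factorial_Ring.prime q" "\<not> q dvd d" and x: "x \<in> ?K" for q x
  proof -
    obtain m where m: "m \<in> F" "?d x dvd lcm (?d m) d" using KL[OF x] by auto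
    have m0: "?d m \<noteq> 0" using pos m FK by auto
    have "?d x dvd ?d m * d" using m(2) by (meson dvd_trans lcm_least dvd_triv_left dvd_triv_right)
    then have "multiplicity q (?d x) \<le> multiplicity q (?d m * d)"
      using m0 d0 by (intro dvd_imp_multiplicity_le) auto
    also have "\<dots> = multiplicity q (?d m)"
      using q m0 d0 by (simp add: prime_elem_multiplicity_mult_distrib not_dvd_imp_multiplicity_0)
    finally show ?thesis using m(1) by auto
  qed
  let ?QF = "{q. \<exists>f. critical p F q f}" and ?QK = "{q. \<exists>f. critical p ?K q f}"
  have crit: "critical p F q f \<longleftrightarrow> critical p ?K q f" if "\<not> q dvd d" for q f
  proof (cases "Factorial_Ring.prime q")
    case True
    note mult = mult[OF True that]
    have "(\<forall>y\<in>F. multiplicity q (?d y) \<le> f) \<longleftrightarrow> (\<forall>y\<in>?K. multiplicity q (?d y) \<le> f)"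
      using mult FK by (meson order_trans subsetD)
    moreover have "(\<exists>y\<in>F. multiplicity q (?d y) = f) \<longleftrightarrow> (\<exists>y\<in>?K. multiplicity q (?d y) = f)"
      if "\<forall>y\<in>F. multiplicity q (?d y) \<le> f"
      using mult FK that by (metis le_antisym subsetD)
    ultimately show ?thesis unfolding critical_def by blast
  qed (simp add: critical_def)
  have "?QF - ?QK \<subseteq> {q. q dvd d}" "?QK - ?QF \<subseteq> {q. q dvd d}" using crit by blast+
  moreover have "finite {q. q dvd d}" using d0 by (simp add: finite_divisors_nat)
  ultimately have "finite (?QF - ?QK)" "finite (?QK - ?QF)" by (meson finite_subset)+
  then have "finite ?QF \<longleftrightarrow> finite ?QK" by (meson finite_Diff2 finite_Diff)
  then show ?thesis
    using finitely_many_iff_critical[OF F absF] finitely_many_iff_critical[OF K abs] by simp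
qed

end

section \<open>Maximal subrings of finitely generated domains\<close>

text \<open>Modulo \<open>h = 1 + u d\<close> the element \<open>d\<close> is invertible with inverse \<open>-u\<close>. So if \<open>h\<close> divides a power of \<open>d\<close>, it
  divides one.\<close>
lemma (in cring) one_plus_mult_dvd_power_unit:
  assumes c: "u \<in> carrier R" "d \<in> carrier R" "c \<in> carrier R"
    and eq: "d [^] (k::nat) = (\<one> \<oplus> u \<otimes> d) \<otimes> c"
  shows "\<one> \<oplus> u \<otimes> d \<in> Units R"
proof -
  let ?h = "\<one> \<oplus> u \<otimes> d"
  have "\<exists>w\<in>carrier R. (\<ominus> u) [^] k \<otimes> d [^] k = \<one> \<oplus> ?h \<otimes> w"
  proof (induct k)
    case 0
    show ?case using c by (intro bexI[of _ \<zero>]) auto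
  next
    case (Suc k)
    then obtain w where w: "w \<in> carrier R" "(\<ominus> u) [^] k \<otimes> d [^] k = \<one> \<oplus> ?h \<otimes> w" by auto
    have "(\<ominus> u) [^] Suc k \<otimes> d [^] Suc k = ((\<ominus> u) [^] k \<otimes> d [^] k) \<otimes> ((\<ominus> u) \<otimes> d)"
      using c by (simp add: m_ac)
    also have "\<dots> = \<one> \<oplus> ?h \<otimes> (\<ominus> \<one> \<oplus> w \<otimes> ((\<ominus> u) \<otimes> d))"
      unfolding w(2) using c w(1) by algebra
    finally show ?case using c w(1) by blast
  qed
  then obtain w where w: "w \<in> carrier R" "(\<ominus> u) [^] k \<otimes> d [^] k = \<one> \<oplus> ?h \<otimes> w" by auto
  have pc: "(\<ominus> u) [^] k \<in> carrier R" using c by simp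
  have "?h \<otimes> ((\<ominus> u) [^] k \<otimes> c \<oplus> \<ominus> w) = (\<ominus> u) [^] k \<otimes> (?h \<otimes> c) \<oplus> \<ominus> (?h \<otimes> w)"
    using c w(1) pc by algebra
  also have "\<dots> = \<one> \<oplus> ?h \<otimes> w \<oplus> \<ominus> (?h \<otimes> w)" using w(2) eq by simp
  also have "\<dots> = \<one>" using c w(1) by algebra
  finally have "?h \<otimes> ((\<ominus> u) [^] k \<otimes> c \<oplus> \<ominus> w) = \<one>" .
  moreover have v: "?h \<in> carrier R" "(\<ominus> u) [^] k \<otimes> c \<oplus> \<ominus> w \<in> carrier R" using c w(1) pc by auto
  ultimately show ?thesis using m_comm[OF v] unfolding Units_def by auto
qed

context field
begin

lemma mult_divide_cancel:
  assumes "x \<in> carrier R" "h \<in> carrier R" "h \<noteq> \<zero>"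
  shows "h \<otimes> (x \<otimes> inv h) = x"
  using assms inv_props[OF assms(2,3)] by (metis m_lcomm r_one)

text \<open>A generic freeness property: for every localization of \<open>B\<close> at one element \<open>b\<close> there is a localization
  of \<open>A\<close> at one element \<open>a\<close> such that elements of \<open>A\<close> that become units in the former are already units in
  the latter. The element \<open>b\<close> is there to make the property transitive.\<close>
definition units_descend :: "'a set \<Rightarrow> 'a set \<Rightarrow> bool" where
  "units_descend A B \<longleftrightarrow> (\<forall>b\<in>B - {\<zero>}. \<exists>a\<in>A - {\<zero>}. \<forall>h\<in>A - {\<zero>}.
     (\<exists>k::nat. b [^] k \<otimes> inv h \<in> B) \<longrightarrow> (\<exists>k::nat. a [^] k \<otimes> inv h \<in> A))"

lemma units_descend_trans:
  assumes "A \<subseteq> B" "units_descend A B" "units_descend B C"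
  shows "units_descend A C"
  unfolding units_descend_def
proof
  fix c assume "c \<in> C - {\<zero>}"
  then obtain b where b: "b \<in> B - {\<zero>}"
    "\<And>h. \<lbrakk>h \<in> B - {\<zero>}; \<exists>k::nat. c [^] k \<otimes> inv h \<in> C\<rbrakk> \<Longrightarrow> \<exists>k::nat. b [^] k \<otimes> inv h \<in> B"
    using assms(3) unfolding units_descend_def by meson
  then obtain a where a: "a \<in> A - {\<zero>}"
    "\<And>h. \<lbrakk>h \<in> A - {\<zero>}; \<exists>k::nat. b [^] k \<otimes> inv h \<in> B\<rbrakk> \<Longrightarrow> \<exists>k::nat. a [^] k \<otimes> inv h \<in> A"
    using assms(2) unfolding units_descend_def by meson
  show "\<exists>a\<in>A - {\<zero>}. \<forall>h\<in>A - {\<zero>}.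
     (\<exists>k::nat. c [^] k \<otimes> inv h \<in> C) \<longrightarrow> (\<exists>k::nat. a [^] k \<otimes> inv h \<in> A)"
    using a b assms(1) by (intro bexI[OF _ a(1)]) blast
qed

lemma lead_coeff_power:
  assumes A: "subring A R" and P: "P \<in> carrier (A[X])" "P \<noteq> []"
  shows "P [^]\<^bsub>A[X]\<^esub> (k::nat) \<noteq> [] \<and> hd (P [^]\<^bsub>A[X]\<^esub> k) = hd P [^] k"
proof (induct k)
  case 0
  show ?case by (simp add: univ_poly_one)
next
  case (Suc k)
  interpret UP: domain "A[X]" using univ_poly_is_domain[OF A] .
  let ?Q = "P [^]\<^bsub>A[X]\<^esub> k"
  have Q: "?Q \<in> carrier (A[X])" using P by auto
  have "?Q \<otimes>\<^bsub>A[X]\<^esub> P \<noteq> []" using UP.integral[OF _ Q P(1)] Suc P(2) by (auto simp: univ_poly_zero)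
  moreover have "hd (poly_mult ?Q P) = hd ?Q \<otimes> hd P"
    by (rule poly_mult_lead_coeff[OF A]) (use Q P Suc in \<open>auto simp: univ_poly_carrier\<close>)
  ultimately show ?case using Suc by (simp add: univ_poly_mult)
qed

text \<open>Compare leading coefficients in \<open>b\<^sup>k = h Q\<close>.\<close>
lemma units_descend_transcendental:
  assumes A: "subring A R" and y: "y \<in> carrier R" "(transcendental over A) y"
  shows "units_descend A (simple_extension A y)"
  unfolding units_descend_def
proof
  let ?B = "simple_extension A y"
  have Ac: "A \<subseteq> carrier R" using subringE(1)[OF A] .
  interpret UP: domain "A[X]" using univ_poly_is_domain[OF A] .
  interpret ev: ring_hom_cring "A[X]" R "\<lambda>p. eval p y" using eval_cring_hom[OF A y(1)] .
  have inj: "inj_on (\<lambda>p. eval p y) (carrier (A[X]))"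
    using y(2) by (simp add: over_def transcendental_def)
  have B: "?B = (\<lambda>p. eval p y) ` carrier (A[X])" by (rule simple_extension_as_eval_img[OF Ac y(1)])
  fix b assume b: "b \<in> ?B - {\<zero>}"
  then obtain P where P: "P \<in> carrier (A[X])" "b = eval P y" "P \<noteq> []" using B by force
  have aP: "hd P \<in> A" "hd P \<noteq> \<zero>" using P by (auto simp: univ_poly_carrier[symmetric] polynomial_def)
  show "\<exists>a\<in>A - {\<zero>}. \<forall>h\<in>A - {\<zero>}. (\<exists>k::nat. b [^] k \<otimes> inv h \<in> ?B) \<longrightarrow> (\<exists>k::nat. a [^] k \<otimes> inv h \<in> A)"
  proof (rule bexI[of _ "hd P"]; (intro ballI impI)?)
    show "hd P \<in> A - {\<zero>}" using aP by auto
    fix h assume h: "h \<in> A - {\<zero>}" and "\<exists>k::nat. b [^] k \<otimes> inv h \<in> ?B"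
    then obtain k :: nat and Q where Q: "Q \<in> carrier (A[X])" "b [^] k \<otimes> inv h = eval Q y" using B by auto
    have hc: "h \<in> carrier R" "h \<noteq> \<zero>" using h Ac by auto
    have bc: "b \<in> carrier R" using P(1,2) by auto
    have H: "[h] \<in> carrier (A[X])" using h by (auto simp: univ_poly_carrier[symmetric] polynomial_def)
    have "eval (P [^]\<^bsub>A[X]\<^esub> k) y = b [^] k" using P(1,2) by simp
    also have "\<dots> = h \<otimes> eval Q y"
      using mult_divide_cancel[OF _ hc, of "b [^] k"] bc Q(2) by simp
    also have "\<dots> = eval ([h] \<otimes>\<^bsub>A[X]\<^esub> Q) y" using Q(1) H hc by simp
    finally have "eval (P [^]\<^bsub>A[X]\<^esub> k) y = eval ([h] \<otimes>\<^bsub>A[X]\<^esub> Q) y" .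
    from inj_onD[OF inj this UP.nat_pow_closed[OF P(1)] UP.m_closed[OF H Q(1)]]
    have e: "P [^]\<^bsub>A[X]\<^esub> k = [h] \<otimes>\<^bsub>A[X]\<^esub> Q" .
    have lk: "P [^]\<^bsub>A[X]\<^esub> k \<noteq> []" "hd (P [^]\<^bsub>A[X]\<^esub> k) = hd P [^] k" using lead_coeff_power[OF A P(1,3)] by auto
    have Q0: "Q \<noteq> []" using lk(1) e H UP.r_null[of "[h]"] by (auto simp: univ_poly_zero)
    have "hd (poly_mult [h] Q) = h \<otimes> hd Q"
      using poly_mult_lead_coeff[OF A, of "[h]" Q] H Q(1) Q0 by (simp add: univ_poly_carrier)
    then have hk: "hd P [^] k = h \<otimes> hd Q" using e lk by (simp add: univ_poly_mult)
    have hQ: "hd Q \<in> A" using Q(1) Q0 by (auto simp: univ_poly_carrier[symmetric] polynomial_def)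
    then have "hd P [^] k \<otimes> inv h = hd Q"
      unfolding hk using mult_divide_cancel[of "hd Q" h] inv_props[OF hc] hc Ac
      by (auto simp: m_assoc subset_iff)
    then show "\<exists>k::nat. hd P [^] k \<otimes> inv h \<in> A" using hQ by metis
  qed
qed

text \<open>Let \<open>a\<close> be a common denominator for the minimal polynomials of \<open>y\<close> and \<open>1/b\<close> over the fraction field
  of \<open>A\<close>; then \<open>y\<close> and \<open>1/b\<close> are integral over \<open>A[1/a]\<close>. If \<open>1/h\<close> were not in \<open>A[1/a]\<close>, some valuation ring
  containing \<open>A[1/a]\<close> would omit it, although that ring contains \<open>y\<close>, \<open>1/b\<close> and hence \<open>1/h\<close>.\<close>
lemma units_descend_algebraic:
  assumes A: "subring A R" and y: "y \<in> carrier R" "(algebraic over A) y"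
  shows "units_descend A (simple_extension A y)"
  unfolding units_descend_def
proof
  let ?B = "simple_extension A y" and ?F = "generate_field R A"
  have Ac: "A \<subseteq> carrier R" using subringE(1)[OF A] .
  have F: "subfield ?F R" "A \<subseteq> ?F" using generate_fieldE(1,2)[OF Ac] by auto
  have yF: "(algebraic over ?F) y" using algebraic_mono[OF F(2)] y(2) by auto
  have EF: "subfield (simple_extension ?F y) R" using simple_extension_is_subfield[OF F(1) y(1)] yF by auto
  fix b assume b: "b \<in> ?B - {\<zero>}"
  have "b \<in> simple_extension ?F y" using b mono_simple_extension[OF F(2)] by auto
  then have ib: "inv b \<in> simple_extension ?F y" using subfield_m_inv(1)[OF EF] b by auto
  have bc: "b \<in> carrier R" "b \<noteq> \<zero>" using b simple_extension_in_carrier[OF Ac y(1)] by auto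
  have ibc: "inv b \<in> carrier R" "inv b \<otimes> b = \<one>" using inv_props[OF bc] by auto
  have ibF: "(algebraic over ?F) (inv b)" by (rule simple_extesion_mem_imp_algebraic[OF F(1) y(1) yF ib])
  have Irr: "set (Irr ?F x) \<subseteq> ?F" "Irr ?F x \<noteq> []" "hd (Irr ?F x) = \<one>" "eval (Irr ?F x) x = \<zero>"
    if "x \<in> carrier R" "(algebraic over ?F) x" for x
  proof -
    note I = IrrE[OF F(1) that]
    show "set (Irr ?F x) \<subseteq> ?F" using I(1) by (auto simp: univ_poly_carrier[symmetric] polynomial_def)
    show "Irr ?F x \<noteq> []" using pirreducibleE(1)[OF subfieldE(1)[OF F(1)] I(1,2)] .
  qed (use IrrE(3,4)[OF F(1) that] in auto)
  note Iy = Irr[OF y(1) yF] and Ib = Irr[OF ibc(1) ibF]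
  let ?D = "set (Irr ?F y) \<union> set (Irr ?F (inv b))"
  obtain a where a: "a \<in> A" "a \<noteq> \<zero>" "\<And>c. c \<in> ?D \<Longrightarrow> a \<otimes> c \<in> A"
    using generate_field_common_denominator[OF A, of ?D] Iy(1) Ib(1) by auto
  have ac: "a \<in> carrier R" "inv a \<in> carrier R" "inv a \<otimes> a = \<one>" using a Ac inv_props[of a] by auto
  show "\<exists>a\<in>A - {\<zero>}. \<forall>h\<in>A - {\<zero>}. (\<exists>k::nat. b [^] k \<otimes> inv h \<in> ?B) \<longrightarrow> (\<exists>k::nat. a [^] k \<otimes> inv h \<in> A)"
  proof (rule bexI[of _ a]; (intro ballI impI)?)
    show "a \<in> A - {\<zero>}" using a by auto
    fix h assume h: "h \<in> A - {\<zero>}" and "\<exists>k::nat. b [^] k \<otimes> inv h \<in> ?B"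
    then obtain k :: nat where k: "b [^] k \<otimes> inv h \<in> ?B" by auto
    let ?C = "simple_extension A (inv a)"
    have C: "subring ?C R" "A \<subseteq> ?C" "inv a \<in> ?C"
      using simple_extension_is_subring[OF A ac(2)] simple_extension_incl[OF Ac ac(2)]
        simple_extension_mem[OF A ac(2)] by auto
    show "\<exists>k::nat. a [^] k \<otimes> inv h \<in> A"
    proof (rule ccontr)
      assume "\<not> ?thesis"
      then have "inv h \<notin> ?C" using simple_extension_inv_denominator[OF A a(1,2)] by blast
      then obtain T where T: "?C \<subseteq> T" "maximal_avoiding T (inv h)"
        using maximal_avoiding_exists[OF C(1)] by blast
      have hT: "h \<in> T" "h \<noteq> \<zero>" using h C(2) T(1) by auto
      have V: "valuation_subring T" by (rule maximal_avoiding_valuation[OF T(2) hT])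
      note T' = valuation_subringD(1)[OF V]
      have DT: "c \<in> T" if "c \<in> ?D" for c
      proof -
        have cc: "c \<in> carrier R" using that Iy(1) Ib(1) subfieldE(3)[OF F(1)] by blast
        have "c = inv a \<otimes> (a \<otimes> c)" using ac cc by (simp add: m_assoc[symmetric])
        moreover have "a \<otimes> c \<in> T" "inv a \<in> T" using a(3)[OF that] C T(1) by auto
        ultimately show ?thesis using subringE(6)[OF T'] by metis
      qed
      have one: "inv \<one> \<in> T" using subringE(3)[OF T'] by simp
      have "y \<in> T" by (rule valuation_integrally_closed[OF V y(1) _ Iy(2) _ _ Iy(4)])
          (use DT Iy(3) one in auto)
      then have "?B \<subseteq> T" using simple_extension_subring_incl[OF T'] C(2) T(1) by auto
      then have bk: "b [^] k \<otimes> inv h \<in> T" using k by auto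
      have "inv b \<in> T" by (rule valuation_integrally_closed[OF V ibc(1) _ Ib(2) _ _ Ib(4)])
          (use DT Ib(3) one in auto)
      then have "inv b [^] k \<otimes> (b [^] k \<otimes> inv h) \<in> T" using subring_pow[OF T'] bk subringE(6)[OF T'] by auto
      moreover have "inv b [^] k \<otimes> (b [^] k \<otimes> inv h) = inv h"
      proof -
        have "inv h \<in> carrier R" using inv_props[of h] hT subringE(1)[OF T'] by auto
        moreover have "inv b [^] k \<otimes> b [^] k = \<one>"
          using ibc bc by (metis nat_pow_distrib nat_pow_one)
        ultimately show ?thesis using ibc bc by (simp add: m_assoc[symmetric])
      qed
      ultimately show False using maximal_avoidingD(2)[OF T(2)] by simp
    qed
  qed
qed

lemma units_descend_finite_extension:
  assumes A: "subring A R" and ys: "set ys \<subseteq> carrier R"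
  shows "units_descend A (finite_extension A ys)"
  using ys
proof (induct ys)
  case Nil
  show ?case by (auto simp: units_descend_def)
next
  case (Cons y ys)
  let ?B = "finite_extension A ys"
  have B: "subring ?B R" using finite_extension_is_subring[OF A] Cons(2) by auto
  have "units_descend ?B (simple_extension ?B y)"
    using units_descend_algebraic[OF B] units_descend_transcendental[OF B] Cons(2)
    by (auto simp: over_def)
  moreover have "A \<subseteq> ?B" "units_descend A ?B"
    using finite_extension_incl[OF subringE(1)[OF A]] Cons by auto
  ultimately show ?case using units_descend_trans by simp
qed

text \<open>Choose \<open>d\<close> such that elements of \<open>F[z]\<close> that are units in the large ring divide a power of \<open>d\<close>. But
  \<open>1 + z d G\<close> is nonconstant and prime to \<open>d\<close>.\<close>
lemma one_plus_multiple_not_unit: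
  assumes F: "subfield F R" and z: "z \<in> carrier R" "(transcendental over F) z"
    and ys: "set ys \<subseteq> carrier R"
  defines "A \<equiv> simple_extension F z"
  shows "\<exists>d\<in>A. \<forall>G\<in>A - {\<zero>}. \<one> \<oplus> z \<otimes> d \<otimes> G \<noteq> \<zero> \<and>
    inv (\<one> \<oplus> z \<otimes> d \<otimes> G) \<notin> finite_extension A ys"
proof -
  note F' = subfieldE(1)[OF F]
  have A: "subring A R" unfolding A_def by (rule simple_extension_is_subring[OF F' z(1)])
  have zA: "z \<in> A" unfolding A_def by (rule simple_extension_mem[OF F' z(1)])
  let ?B = "finite_extension A ys"
  have "\<one> \<in> ?B - {\<zero>}" using finite_extension_incl[OF subringE(1)[OF A] ys] subringE(3)[OF A] by auto
  then obtain d where d: "d \<in> A" "d \<noteq> \<zero>"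
    and desc: "\<And>h. \<lbrakk>h \<in> A; h \<noteq> \<zero>; \<exists>k::nat. \<one> [^] k \<otimes> inv h \<in> ?B\<rbrakk> \<Longrightarrow> \<exists>k::nat. d [^] k \<otimes> inv h \<in> A"
    using units_descend_finite_extension[OF A ys] unfolding units_descend_def by (metis Diff_iff empty_iff insert_iff)
  interpret UP: domain "F[X]" using univ_poly_is_domain[OF F'] .
  interpret ev: ring_hom_cring "F[X]" R "\<lambda>p. eval p z" using eval_cring_hom[OF F' z(1)] .
  have inj: "inj_on (\<lambda>p. eval p z) (carrier (F[X]))"
    using z(2) by (simp add: over_def transcendental_def)
  have A_img: "A = (\<lambda>p. eval p z) ` carrier (F[X])"
    unfolding A_def by (rule simple_extension_as_eval_img[OF subringE(1)[OF F'] z(1)])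
  obtain D where D: "D \<in> carrier (F[X])" "d = eval D z" using d A_img by auto
  have Xc: "X \<in> carrier (F[X])" using var_closed(1)[OF F'] .
  have evX: "eval X z = z" using z(1) by (simp add: var_def)
  show ?thesis
  proof (intro bexI[OF _ d(1)] ballI)
    fix G assume G: "G \<in> A - {\<zero>}"
    then obtain g where g: "g \<in> carrier (F[X])" "G = eval g z" "g \<noteq> []" using A_img by force
    let ?h = "\<one> \<oplus> z \<otimes> d \<otimes> G"
    let ?H = "\<one>\<^bsub>F[X]\<^esub> \<oplus>\<^bsub>F[X]\<^esub> (X \<otimes>\<^bsub>F[X]\<^esub> g) \<otimes>\<^bsub>F[X]\<^esub> D"
    have D0: "D \<noteq> []" using d D by auto
    have cc: "d \<in> carrier R" "G \<in> carrier R" using d G subringE(1)[OF A] by auto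
    have H: "?H \<in> carrier (F[X])" using Xc g D by auto
    have "eval ?H z = \<one> \<oplus> (z \<otimes> G) \<otimes> d" using Xc g D evX by simp
    also have "\<dots> = ?h" using cc z(1) by (simp add: m_ac)
    finally have evH: "eval ?H z = ?h" .
    have "D \<otimes>\<^bsub>F[X]\<^esub> g \<noteq> []" using UP.integral[OF _ D(1) g(1)] D0 g(3) by (auto simp: univ_poly_zero)
    then have "degree (\<one>\<^bsub>F[X]\<^esub> \<oplus>\<^bsub>F[X]\<^esub> X \<otimes>\<^bsub>F[X]\<^esub> (D \<otimes>\<^bsub>F[X]\<^esub> g)) \<noteq> 0"
      using one_plus_var_mult_nonconstant[OF F] D g by blast
    moreover have "X \<otimes>\<^bsub>F[X]\<^esub> (D \<otimes>\<^bsub>F[X]\<^esub> g) = (X \<otimes>\<^bsub>F[X]\<^esub> g) \<otimes>\<^bsub>F[X]\<^esub> D"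
      using Xc D g by (simp add: UP.m_ac)
    ultimately have dH: "degree ?H \<noteq> 0" by simp
    have h0: "?h \<noteq> \<zero>"
    proof
      assume "?h = \<zero>"
      then have "eval ?H z = eval [] z" using evH by simp
      then have "?H = []" using inj H by (meson inj_onD univ_poly_zero_closed)
      then show False using dH by simp
    qed
    moreover have "inv ?h \<notin> ?B"
    proof
      assume "inv ?h \<in> ?B"
      have hA: "?h \<in> A" using evH H A_img by force
      have hc: "?h \<in> carrier R" using hA subringE(1)[OF A] by auto
      have ih: "inv ?h \<in> carrier R" "inv ?h \<otimes> ?h = \<one>" using inv_props[OF hc h0] by auto
      have "\<exists>k::nat. \<one> [^] k \<otimes> inv ?h \<in> ?B" using \<open>inv ?h \<in> ?B\<close> ih by simp
      from desc[OF hA h0 this] obtain k :: nat where "d [^] k \<otimes> inv ?h \<in> A" by auto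
      then obtain c where c: "c \<in> carrier (F[X])" "d [^] k \<otimes> inv ?h = eval c z" using A_img by auto
      have "eval (D [^]\<^bsub>F[X]\<^esub> k) z = d [^] k" using D by simp
      also have "\<dots> = ?h \<otimes> eval c z"
        using mult_divide_cancel[OF _ hc h0, of "d [^] k"] cc c(2) by simp
      also have "\<dots> = eval ?H z \<otimes> eval c z" using evH by simp
      also have "\<dots> = eval (?H \<otimes>\<^bsub>F[X]\<^esub> c) z" using c(1) H by (rule ev.hom_mult[symmetric, rotated])
      finally have "eval (D [^]\<^bsub>F[X]\<^esub> k) z = eval (?H \<otimes>\<^bsub>F[X]\<^esub> c) z" .
      from inj_onD[OF inj this UP.nat_pow_closed[OF D(1)] UP.m_closed[OF H c(1)]]
      have "D [^]\<^bsub>F[X]\<^esub> k = ?H \<otimes>\<^bsub>F[X]\<^esub> c" .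
      then have "?H \<in> Units (F[X])"
        by (rule UP.one_plus_mult_dvd_power_unit[rotated -1]) (use Xc g D c in auto)
      then have "degree ?H = 0" using univ_poly_units'[OF F, of ?H] by blast
      then show False using dH by simp
    qed
    ultimately show "?h \<noteq> \<zero> \<and> inv ?h \<notin> ?B" by simp
  qed
qed

text \<open>A ring that is finitely generated over \<open>F\<close> cannot be the union of a chain of proper subrings
  containing \<open>F\<close>.\<close>
lemma maximal_subring_above:
  assumes A: "finite A" "A \<subseteq> carrier R" and F: "F \<subseteq> carrier R"
    and S: "subring S R" "F \<subseteq> S" "S \<subset> generate_ring R (F \<union> A)"
  obtains M where "S \<subseteq> M" "maximal_subring M (R\<lparr>carrier := generate_ring R (F \<union> A)\<rparr>)"
proof -
  let ?G = "generate_ring R (F \<union> A)"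
  have FA: "F \<union> A \<subseteq> carrier R" using A F by auto
  have G: "subring ?G R" by (rule generate_ring_is_subring[OF FA])
  have AG: "A \<subseteq> ?G" by (auto intro: generate_ring.incl)
  have full: "?G \<subseteq> T" if "subring T R" "F \<subseteq> T" "A \<subseteq> T" for T
    by (rule generate_ring_min_subring1[OF FA that(1)]) (use that in auto)
  define Z where "Z = {T. subring T R \<and> S \<subseteq> T \<and> T \<subseteq> ?G \<and> \<not> A \<subseteq> T}"
  have "\<exists>M\<in>Z. \<forall>T\<in>Z. M \<subseteq> T \<longrightarrow> T = M"
  proof (rule subset_Zorn_nonempty)
    have "S \<in> Z" using S full by (auto simp: Z_def)
    then show "Z \<noteq> {}" by auto
    fix C assume C: "C \<noteq> {}" "subset.chain Z C"
    have mem: "subring T R" "S \<subseteq> T" "T \<subseteq> ?G" "\<not> A \<subseteq> T" if "T \<in> C" for T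
      using C(2) that by (auto simp: subset.chain_def Z_def)
    have "subring (\<Union>C) R"
    proof (rule chain_Union_subring[OF C(1) mem(1)])
      show "T \<subseteq> T' \<or> T' \<subseteq> T" if "T \<in> C" "T' \<in> C" for T T'
        using C(2) that unfolding subset.chain_def by blast
    qed
    moreover have "\<not> A \<subseteq> \<Union>C"
    proof
      assume "A \<subseteq> \<Union>C"
      then obtain T where "T \<in> C" "A \<subseteq> T" using finite_subset_Union_chain[OF A(1) _ C(1,2)] by blast
      then show False using mem(4) by auto
    qed
    ultimately show "\<Union>C \<in> Z" using C(1) mem(2,3) by (auto simp: Z_def)
  qed
  then obtain M where M: "M \<in> Z" and max: "\<And>T. \<lbrakk>T \<in> Z; M \<subseteq> T\<rbrakk> \<Longrightarrow> T = M" by blast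
  have "maximal_subring M (R\<lparr>carrier := ?G\<rparr>)"
    unfolding maximal_subring_restrict[OF G]
  proof (intro conjI allI impI)
    show "subring M R" "M \<subset> ?G" using M AG by (auto simp: Z_def)
    fix T assume T: "subring T R \<and> T \<subset> ?G \<and> M \<subseteq> T"
    then have "S \<subseteq> T" "\<not> A \<subseteq> T" using M full[of T] S(2) by (auto simp: Z_def)
    then show "T = M" using T by (intro max) (auto simp: Z_def)
  qed
  then show ?thesis using M that by (auto simp: Z_def)
qed

text \<open>Euclid's argument once more, now with the ideals of \<open>R\<close> generated by elements of \<open>F[z]\<close>. Given finitely
  many maximal subrings, let \<open>g\<close> be a nonzero element of \<open>F[z]\<close> whose multiples lie in each of them that contains such
  an ideal, and let \<open>h = 1 + z d g\<close> be a non-unit. The maximal subring containing \<open>F + h\<^sup>2 R\<close> would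
  contain both \<open>h\<^sup>2 R\<close> and \<open>g R\<close>, and these ideals add up to the unit ideal.\<close>
theorem infinitely_many_of_affine_domain:
  assumes F: "subfield F R" and A: "finite A" "A \<subseteq> carrier R"
    and z: "z \<in> A" "(transcendental over F) z"
  shows "infinite {S. maximal_subring S (R\<lparr>carrier := generate_ring R (F \<union> A)\<rparr>)}"
proof
  let ?G = "generate_ring R (F \<union> A)"
  assume fin: "finite {S. maximal_subring S (R\<lparr>carrier := ?G\<rparr>)}"
  note F' = subfieldE(1)[OF F] and Fc = subfieldE(3)[OF F]
  have FA: "F \<union> A \<subseteq> carrier R" using A Fc by auto
  have G: "subring ?G R" by (rule generate_ring_is_subring[OF FA])
  have FG: "F \<subseteq> ?G" "A \<subseteq> ?G" by (auto intro: generate_ring.incl)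
  have zc: "z \<in> carrier R" using z A by auto
  let ?A = "simple_extension F z"
  have sA: "subring ?A R" by (rule simple_extension_is_subring[OF F' zc])
  have AG: "?A \<subseteq> ?G" by (rule simple_extension_subring_incl[OF G FG(1)]) (use z FG in auto)
  have zA: "z \<in> ?A" by (rule simple_extension_mem[OF F' zc])
  obtain ys where ys: "set ys = A" using finite_list[OF A(1)] by auto
  have GB: "?G \<subseteq> finite_extension ?A ys"
  proof (rule generate_ring_min_subring1[OF FA finite_extension_is_subring[OF sA]])
    show "set ys \<subseteq> carrier R" using ys A by auto
    then show "F \<union> A \<subseteq> finite_extension ?A ys"
      using finite_extension_incl[OF subringE(1)[OF sA]] finite_extension_mem[OF sA] ys
        simple_extension_incl[OF Fc zc] by blast
  qed
  obtain d where d: "d \<in> ?A" and nonunit: "\<And>g. \<lbrakk>g \<in> ?A; g \<noteq> \<zero>\<rbrakk> \<Longrightarrow>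
      \<one> \<oplus> z \<otimes> d \<otimes> g \<noteq> \<zero> \<and> inv (\<one> \<oplus> z \<otimes> d \<otimes> g) \<notin> finite_extension ?A ys"
    using one_plus_multiple_not_unit[OF F zc z(2), of ys] ys A by auto
  define Z where "Z = {S. maximal_subring S (R\<lparr>carrier := ?G\<rparr>) \<and>
    (\<exists>g\<in>?A. g \<noteq> \<zero> \<and> (\<forall>r\<in>?G. g \<otimes> r \<in> S))}"
  have "finite Z" using fin by (rule finite_subset[rotated]) (auto simp: Z_def)
  moreover have "Z \<subseteq> Z" ..
  ultimately have "\<exists>g\<in>?A. g \<noteq> \<zero> \<and> (\<forall>S\<in>Z. \<forall>r\<in>?G. g \<otimes> r \<in> S)"
  proof (induct rule: finite_subset_induct')
    case empty
    then show ?case using subringE(3)[OF sA] one_not_zero by blast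
  next
    case (insert S D)
    then obtain g where g: "g \<in> ?A" "g \<noteq> \<zero>" "\<forall>S\<in>D. \<forall>r\<in>?G. g \<otimes> r \<in> S" by auto
    obtain g' where g': "g' \<in> ?A" "g' \<noteq> \<zero>" "\<forall>r\<in>?G. g' \<otimes> r \<in> S" using insert(2) by (auto simp: Z_def)
    have cc: "g \<in> carrier R" "g' \<in> carrier R" "g \<in> ?G" "g' \<in> ?G"
      using g g' subringE(1)[OF sA] AG by auto
    have "g \<otimes> g' \<otimes> r \<in> S'" if "S' \<in> insert S D" "r \<in> ?G" for S' r
    proof -
      have rc: "r \<in> carrier R" using that(2) subringE(1)[OF G] by auto
      have "g \<otimes> g' \<otimes> r = g \<otimes> (g' \<otimes> r)" "g \<otimes> g' \<otimes> r = g' \<otimes> (g \<otimes> r)" using cc rc by (simp_all add: m_ac)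
      moreover have "g \<otimes> r \<in> ?G" "g' \<otimes> r \<in> ?G" using cc that(2) subringE(6)[OF G] by auto
      ultimately show ?thesis using that(1) g(3) g'(3) by auto
    qed
    moreover have "g \<otimes> g' \<noteq> \<zero>" using g g' cc integral by blast
    ultimately show ?case using subringE(6)[OF sA g(1) g'(1)] by blast
  qed
  then obtain g where g: "g \<in> ?A" "g \<noteq> \<zero>" "\<And>S r. \<lbrakk>S \<in> Z; r \<in> ?G\<rbrakk> \<Longrightarrow> g \<otimes> r \<in> S" by auto
  define h where "h = \<one> \<oplus> z \<otimes> d \<otimes> g"
  have h: "h \<noteq> \<zero>" "inv h \<notin> ?G" using nonunit[OF g(1,2)] GB by (auto simp: h_def)
  have hA: "h \<in> ?A" unfolding h_def using subringE(3,6,7)[OF sA] zA d g(1) by auto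
  have c: "h \<in> carrier R" "z \<in> carrier R" "d \<in> carrier R" "g \<in> carrier R"
    using hA zA d g(1) subringE(1)[OF sA] by auto
  have Gm: "h \<in> ?G" "z \<in> ?G" "d \<in> ?G" "g \<in> ?G" using hA zA d g(1) AG by auto
  let ?S = "{c \<oplus> h \<otimes> h \<otimes> r |c r. c \<in> F \<and> r \<in> ?G}"
  have Sc: "x \<in> carrier R" if "x \<in> F \<or> x \<in> ?G" for x using that Fc subringE(1)[OF G] by auto
  have S: "subring ?S R"
  proof (rule subringI)
    show "?S \<subseteq> carrier R" using c Sc by auto
    show "\<one> \<in> ?S" using subringE(3)[OF F'] subringE(2)[OF G] c
      by (intro CollectI exI[of _ \<one>] exI[of _ \<zero>]) auto
    fix x assume "x \<in> ?S"
    then obtain a r where a: "x = a \<oplus> h \<otimes> h \<otimes> r" "a \<in> F" "r \<in> ?G" by auto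
    have ac: "a \<in> carrier R" "r \<in> carrier R" using a Sc by auto
    have "\<ominus> x = \<ominus> a \<oplus> h \<otimes> h \<otimes> (\<ominus> r)" unfolding a(1) using ac c by algebra
    then show "\<ominus> x \<in> ?S" using a subringE(5)[OF F'] subringE(5)[OF G] by blast
    fix y assume "y \<in> ?S"
    then obtain b s where b: "y = b \<oplus> h \<otimes> h \<otimes> s" "b \<in> F" "s \<in> ?G" by auto
    have bc: "b \<in> carrier R" "s \<in> carrier R" using b Sc by auto
    have "x \<oplus> y = (a \<oplus> b) \<oplus> h \<otimes> h \<otimes> (r \<oplus> s)" unfolding a(1) b(1) using ac bc c by algebra
    then show "x \<oplus> y \<in> ?S" using a b subringE(7)[OF F'] subringE(7)[OF G] by blast
    have "x \<otimes> y = (a \<otimes> b) \<oplus> h \<otimes> h \<otimes> (a \<otimes> s \<oplus> b \<otimes> r \<oplus> h \<otimes> h \<otimes> r \<otimes> s)"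
      unfolding a(1) b(1) using ac bc c by algebra
    moreover have "a \<otimes> s \<oplus> b \<otimes> r \<oplus> h \<otimes> h \<otimes> r \<otimes> s \<in> ?G"
      using subringE(6,7)[OF G] a b FG Gm by (meson subsetD)
    ultimately show "x \<otimes> y \<in> ?S" using a b subringE(6)[OF F'] by blast
  qed
  have FS: "F \<subseteq> ?S"
  proof
    fix a assume a: "a \<in> F"
    then have "a = a \<oplus> h \<otimes> h \<otimes> \<zero>" using c Sc by auto
    then show "a \<in> ?S" using a subringE(2)[OF G] by blast
  qed
  have SG: "?S \<subseteq> ?G" using FG Gm subringE(6,7)[OF G] by auto
  have "h \<notin> ?S"
  proof
    assume "h \<in> ?S"
    then obtain a r where a: "h = a \<oplus> h \<otimes> h \<otimes> r" "a \<in> F" "r \<in> ?G" by auto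
    have ac: "a \<in> carrier R" "r \<in> carrier R" using a Sc by auto
    have m: "\<one> \<oplus> \<ominus> (h \<otimes> r) \<in> ?G" using a Gm subringE(3,5,6,7)[OF G] by auto
    have e: "h \<otimes> (\<one> \<oplus> \<ominus> (h \<otimes> r)) = a"
    proof -
      have "h \<otimes> (\<one> \<oplus> \<ominus> (h \<otimes> r)) = h \<oplus> \<ominus> (h \<otimes> h \<otimes> r)" using c ac by algebra
      also have "\<dots> = a \<oplus> h \<otimes> h \<otimes> r \<oplus> \<ominus> (h \<otimes> h \<otimes> r)" using a(1) by simp
      also have "\<dots> = a" using c ac by algebra
      finally show ?thesis .
    qed
    show False
    proof (cases "a = \<zero>")
      case True
      then have "\<one> \<oplus> \<ominus> (h \<otimes> r) = \<zero>" using e h(1) c ac integral by (metis m_closed a_closed a_inv_closed one_closed)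
      then have "h \<otimes> r = \<one>" using c ac by (metis m_closed minus_eq one_closed r_right_minus_eq)
      then have "inv h = r" using c ac comm_inv_char by auto
      then show False using a h by auto
    next
      case False
      have ia: "inv a \<in> F" using subfield_m_inv(1)[OF F] a False by auto
      have "h \<otimes> ((\<one> \<oplus> \<ominus> (h \<otimes> r)) \<otimes> inv a) = a \<otimes> inv a"
        using e c ac ia Sc by (simp add: m_assoc[symmetric])
      then have "h \<otimes> ((\<one> \<oplus> \<ominus> (h \<otimes> r)) \<otimes> inv a) = \<one>" using inv_props[OF ac(1) False] by simp
      then have "inv h = (\<one> \<oplus> \<ominus> (h \<otimes> r)) \<otimes> inv a" using c ac ia Sc comm_inv_char by auto
      then show False using m ia FG subringE(6)[OF G] h(2) by auto
    qed
  qed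
  then have "?S \<subset> ?G" using SG Gm by blast
  then obtain M where M: "?S \<subseteq> M" "maximal_subring M (R\<lparr>carrier := ?G\<rparr>)"
    using maximal_subring_above[OF A Fc S FS] by blast
  have M': "subring M R" "M \<subset> ?G" using M(2) unfolding maximal_subring_restrict[OF G] by auto
  have hM: "h \<otimes> h \<otimes> r \<in> M" if "r \<in> ?G" for r
  proof -
    have "h \<otimes> h \<otimes> r = \<zero> \<oplus> h \<otimes> h \<otimes> r" using c that Sc by auto
    then have "h \<otimes> h \<otimes> r \<in> ?S" using that subringE(2)[OF F'] by blast
    then show ?thesis using M(1) by auto
  qed
  have "M \<in> Z" unfolding Z_def
  proof (intro CollectI conjI M(2) bexI[of _ "h \<otimes> h"])
    show "h \<otimes> h \<in> ?A" using subringE(6)[OF sA hA hA] .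
    show "h \<otimes> h \<noteq> \<zero>" using h c integral by blast
  qed (use hM in auto)
  \<comment> \<open>The square of \<open>h\<close> is congruent to one modulo \<open>g\<close>.\<close>
  have "?G \<subseteq> M"
  proof
    fix r assume r: "r \<in> ?G"
    have rc: "r \<in> carrier R" using r Sc by auto
    let ?u = "z \<otimes> d"
    let ?t = "?u \<oplus> ?u \<oplus> ?u \<otimes> ?u \<otimes> g"
    have uc: "?u \<in> carrier R" using c by auto
    have "h \<otimes> h \<otimes> r \<oplus> \<ominus> (g \<otimes> (?t \<otimes> r)) = r"
      unfolding h_def using c(4) uc rc by algebra
    moreover have "?t \<otimes> r \<in> ?G" using subringE(6,7)[OF G] Gm r by auto
    then have "g \<otimes> (?t \<otimes> r) \<in> M" using g(3) \<open>M \<in> Z\<close> by auto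
    ultimately show "r \<in> M" using hM[OF r] subringE(5,7)[OF M'(1)] by metis
  qed
  then show False using M'(2) by auto
qed

section \<open>The finiteness criterion\<close>

text \<open>The coefficients of a relation for \<open>x\<close> generate a finite field, over which \<open>x\<close> is algebraic.\<close>
lemma absolutely_algebraic_extension:
  assumes F: "subfield F R" and abs: "absolutely_algebraic p F"
    and x: "x \<in> carrier R" "(algebraic over F) x"
  shows "\<exists>n\<ge>1. x [^] (p ^ n) = x"
proof -
  note F' = subfieldE(1)[OF F]
  have p: "Factorial_Ring.prime p" "add_pow R p \<one> = \<zero>" using abs by (auto simp: absolutely_algebraic_def)
  obtain q where q: "q \<in> carrier (F[X])" "q \<noteq> []" "eval q x = \<zero>" using algebraicE[OF F' x] .
  have qF: "set q \<subseteq> F" "hd q \<noteq> \<zero>" using q by (auto simp: univ_poly_carrier[symmetric] polynomial_def)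
  obtain P where P: "subring P R" "finite P" "P \<subseteq> F"
  proof -
    have "\<zero> \<in> F" using subringE(2)[OF F'] .
    from subring_contains_finite[OF F abs F' subset_refl this this] show ?thesis using that by metis
  qed
  have "subring (finite_extension P xs) R \<and> finite (finite_extension P xs)" if "set xs \<subseteq> F" for xs
    using that
  proof (induct xs)
    case (Cons y xs)
    then show ?case
      using simple_extension_is_subring finite_subring_adjoin[OF F abs] subfieldE(3)[OF F] by auto
  qed (use P in auto)
  then have W: "subring (finite_extension P q) R" "finite (finite_extension P q)" using qF by auto
  have qc: "set q \<subseteq> carrier R" using qF subfieldE(3)[OF F] by auto
  have "set q \<subseteq> finite_extension P q" by (rule finite_extension_mem[OF P(1) qc])
  then have "q \<in> carrier ((finite_extension P q)[X])"
    using qF by (auto simp: univ_poly_carrier[symmetric] polynomial_def)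
  then have "(algebraic over (finite_extension P q)) x" using algebraicI q by blast
  then have "finite (simple_extension (finite_extension P q) x)"
    by (rule finite_simple_extension[OF finite_subring_subfield[OF W] W(2) x(1)])
  then show ?thesis
    using finite_subring_frobenius[OF p simple_extension_is_subring[OF W(1) x(1)]]
      simple_extension_mem[OF W(1) x(1)] by blast
qed

lemma finitely_many_subfield_imp_absolutely_algebraic:
  assumes K: "subfield K R" and fin: "finite {S. maximal_subring S (R\<lparr>carrier := K\<rparr>)}"
  shows "\<exists>p. absolutely_algebraic p K"
proof -
  interpret K: field "R\<lparr>carrier := K\<rparr>" using subfield_iff(2)[OF K] .
  obtain p where "K.absolutely_algebraic p K"
    using K.finitely_many_imp_absolutely_algebraic[OF fin] by auto
  then have "absolutely_algebraic p K"
    unfolding K.absolutely_algebraic_def absolutely_algebraic_def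
    by (simp add: nat_pow_def add_pow_def)
  then show ?thesis by blast
qed

end

theorem theorem3p1:
  fixes E :: "('a, 'b) ring_scheme"
    and F K R :: "'a set"
    and n :: nat
    and \<alpha> :: "nat \<Rightarrow> 'a"
  assumes "field E"
    and "subfield F E"
    and "\<And>i. i \<in> {1..n} \<Longrightarrow> \<alpha> i \<in> carrier E"
    and "K = generate_field E (F \<union> \<alpha> ` {1..n})"
    and "R = generate_ring E (F \<union> \<alpha> ` {1..n})"
  shows "(finitely_many_maximal_subrings E K \<longleftrightarrow>
            finitely_many_maximal_subrings E F \<and> ring.finite_dimension E F K) \<and>
         (finitely_many_maximal_subrings E R \<longleftrightarrow>
            finitely_many_maximal_subrings E F \<and>
            (\<forall>i\<in>{1..n}. (ring.algebraic E over F) (\<alpha> i))) \<and>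
         ((\<forall>i\<in>{1..n}. (ring.algebraic E over F) (\<alpha> i)) \<longleftrightarrow>
            subfield R E \<and> ring.finite_dimension E F R)"
proof -
  interpret E: field E by fact
  note F = \<open>subfield F E\<close>
  note F' = subfieldE(1)[OF F]
  let ?A = "\<alpha> ` {1..n}"
  have A: "finite ?A" "?A \<subseteq> carrier E" using assms(3) by auto
  have FA: "F \<union> ?A \<subseteq> carrier E" using A subfieldE(3)[OF F] by auto
  have K: "subfield K E" "F \<union> ?A \<subseteq> K" using E.generate_fieldE(1,2)[OF FA assms(4)] .
  have R: "subring R E" "F \<union> ?A \<subseteq> R"
    using E.generate_ring_is_subring[OF FA] unfolding assms(5) by (auto intro: generate_ring.incl)
  define alg where "alg \<longleftrightarrow> (\<forall>i\<in>{1..n}. (E.algebraic over F) (\<alpha> i))"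
  obtain ys where ys: "set ys = ?A" using finite_list[OF A(1)] by auto
  have ysc: "set ys \<subseteq> carrier E" using ys A by auto
  let ?L = "E.finite_extension F ys"
  have L: "subring ?L E" "F \<union> ?A \<subseteq> ?L"
    using E.finite_extension_is_subring[OF F' ysc] E.finite_extension_incl[OF subfieldE(3)[OF F] ysc]
      E.finite_extension_mem[OF F' ysc] ys by auto
  have "?L \<subseteq> R" by (rule E.finite_extension_subring_incl[OF R(1)]) (use R(2) ys in auto)
  moreover have "R \<subseteq> ?L" unfolding assms(5) by (rule E.generate_ring_min_subring1[OF FA L])
  ultimately have RL: "R = ?L" by auto
  have RK: "R \<subseteq> K" unfolding assms(5) by (rule E.generate_ring_min_subring1[OF FA subfieldE(1)[OF K(1)] K(2)])
  have alg_ys: "(E.algebraic over F) y" if alg "y \<in> set ys" for y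
    using that ys by (auto simp: alg_def)
  have algD: "subfield R E" "E.finite_dimension F R" "K = R" if alg
  proof -
    show Rf: "subfield R E" unfolding RL
      by (rule E.finite_extension_is_subfield[OF F ysc]) (use alg_ys that in auto)
    show "E.finite_dimension F R" unfolding RL
      by (rule E.finite_extension_finite_dimension(1)[OF F ysc]) (use alg_ys that in auto)
    have "K \<subseteq> R" unfolding assms(4) by (rule E.generate_field_min_subfield1[OF FA Rf R(2)])
    then show "K = R" using RK by auto
  qed
  have algI: alg if "subring S E" "?A \<subseteq> S" "E.finite_dimension F S" for S
    using E.finite_dimension_imp_algebraic[OF F that(1,3)] that(2) by (auto simp: alg_def)
  note fin_def = finitely_many_maximal_subrings_def
  have K_imp_alg: alg if fin: "finitely_many_maximal_subrings E K"
  proof -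
    obtain p where p: "E.absolutely_algebraic p K"
      using E.finitely_many_subfield_imp_absolutely_algebraic[OF K(1)] fin by (auto simp: fin_def)
    show alg unfolding alg_def
    proof
      fix i assume "i \<in> {1..n}"
      then have x: "\<alpha> i \<in> K" "\<alpha> i \<in> carrier E" using K(2) A by auto
      then obtain m where m: "m \<ge> 1" "\<alpha> i [^]\<^bsub>E\<^esub> (p ^ m) = \<alpha> i" "Factorial_Ring.prime p"
        using p by (auto simp: E.absolutely_algebraic_def)
      have "2 \<le> p ^ m" using prime_ge_2_nat[OF m(3)] self_le_power[of p m] m(1) by auto
      then show "(E.algebraic over F) (\<alpha> i)" using E.algebraic_of_pow_eq[OF F' x(2) m(2)] by blast
    qed
  qed
  have transfer: "finitely_many_maximal_subrings E F \<longleftrightarrow> finitely_many_maximal_subrings E K" if alg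
  proof -
    have *: ?thesis if "E.absolutely_algebraic p K" for p
      using E.finitely_many_iff_of_finite_extension[OF F A] that unfolding assms(4) fin_def by blast
    have "\<exists>p. E.absolutely_algebraic p K" if fin: "finitely_many_maximal_subrings E F"
    proof -
      obtain p where p: "E.absolutely_algebraic p F"
        using E.finitely_many_subfield_imp_absolutely_algebraic[OF F] fin by (auto simp: fin_def)
      have "\<exists>n\<ge>1. x [^]\<^bsub>E\<^esub> (p ^ n) = x" if x: "x \<in> K" for x
      proof (rule E.absolutely_algebraic_extension[OF F p])
        show "x \<in> carrier E" using x subfieldE(3)[OF K(1)] by auto
        show "(E.algebraic over F) x"
          using E.finite_dimension_imp_algebraic[OF F R(1) algD(2)[OF \<open>alg\<close>]] x algD(3)[OF \<open>alg\<close>] by auto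
      qed
      then have "E.absolutely_algebraic p K" using p by (auto simp: E.absolutely_algebraic_def)
      then show ?thesis by blast
    qed
    moreover have "\<exists>p. E.absolutely_algebraic p K" if "finitely_many_maximal_subrings E K"
      using E.finitely_many_subfield_imp_absolutely_algebraic[OF K(1)] that by (auto simp: fin_def)
    ultimately show ?thesis using * by blast
  qed
  have R_imp_alg: alg if fin: "finitely_many_maximal_subrings E R"
  proof (rule ccontr)
    assume "\<not> alg"
    then obtain z where "z \<in> ?A" "(E.transcendental over F) z" by (auto simp: alg_def over_def)
    then show False using E.infinitely_many_of_affine_domain[OF F A] fin
      unfolding fin_def assms(5) by blast
  qed
  have 1: "finitely_many_maximal_subrings E K \<longleftrightarrow>
      finitely_many_maximal_subrings E F \<and> E.finite_dimension F K"
  proof -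
    have "E.finite_dimension F K \<longleftrightarrow> alg"
    proof
      assume "E.finite_dimension F K"
      then show alg using algI[OF subfieldE(1)[OF K(1)]] K(2) by simp
    next
      assume a: alg
      show "E.finite_dimension F K" using algD(2,3)[OF a] by simp
    qed
    then show ?thesis using K_imp_alg transfer by blast
  qed
  have 2: "finitely_many_maximal_subrings E R \<longleftrightarrow> finitely_many_maximal_subrings E F \<and> alg"
  proof
    assume R: "finitely_many_maximal_subrings E R"
    then have a: alg by (rule R_imp_alg)
    show "finitely_many_maximal_subrings E F \<and> alg" using transfer[OF a] algD(3)[OF a] R a by simp
  next
    assume F: "finitely_many_maximal_subrings E F \<and> alg"
    then have a: alg ..
    show "finitely_many_maximal_subrings E R" using transfer[OF a] algD(3)[OF a] F by simp
  qed
  have 3: "alg \<longleftrightarrow> subfield R E \<and> E.finite_dimension F R"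
  proof
    assume a: alg
    show "subfield R E \<and> E.finite_dimension F R" using algD(1,2)[OF a] by simp
  next
    assume "subfield R E \<and> E.finite_dimension F R"
    then show alg using algI[OF R(1)] R(2) by simp
  qed
  show ?thesis using 1 2 3 unfolding alg_def by blast
qed

end
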